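(* Let $G$ be a Lie group with Lie algebra $\mathfrak{g}$ and let $(g,J)$ be a left-invariant almost pseudo-Hermitian structure on $G$. If $(G,g,J)$ is nearly pseudo-Kähler, then the tangent Lie group $TG$ admits a left-invariant nearly pseudo-Kähler structure, namely the induced structure $(\widehat{g},\widehat{J})$ on $TG$ defined in the context. Moreover, if the almost complex structure $J$ on $G$ is non-integrable, then so is the induced almost complex structure $\widehat{J}$ on $TG$. Hence, if $(G,g,J)$ is strictly nearly pseudo-Kähler, then so is $(TG,\widehat{g},\widehat{J})$.
   Context: An almost pseudo-Hermitian structure on a smooth manifold $M$ is a pair $(g,J)$ where $g$ is a pseudo-Riemannian metric (a nondegenerate symmetric bilinear form on each tangent space, not necessarily positive definite) and $J$ is an almost complex structure ($J^2=-\mathrm{id}$) that is compatible with $g$, i.e. $g(JX,JY)=g(X,Y)$ for all $X,Y$. Let $\nabla$ be the Levi-Civita connection of $g$. $(M,g,J)$ is nearly pseudo-Kähler if $(\nabla_XJ)X=0$ for all vector fields $X$ on $M$. $J$ is integrable if and only if its Nijenhuis tensor $N_J(X,Y):=J[JX,Y]+J[X,JY]+[X,Y]-[JX,JY]$ vanishes identically. With associated 2-form $\omega(\cdot,\cdot):=g(J\cdot,\cdot)$, $(M,g,J)$ is pseudo-Kähler if $J$ is integrable and $\omega$ is closed; it is strictly nearly pseudo-Kähler if it is nearly pseudo-Kähler but not pseudo-Kähler. On a Lie group, a structure $(g,J)$ is left-invariant if $g$ and $J$ are invariant under all left translations. Tangent Lie group: put $\mathfrak{g}:=T_eG$, with the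 Lie bracket of left-invariant vector fields. Identify $TG$ with $G\times\mathfrak{g}$ via $T_aG\ni A\mapsto (a,(l_{a^{-1}})_*A)$, where $l_a$ is left translation by $a\in G$. The Lie group structure on $TG$ is $$(a,X)\cdot(b,Y):=(ab,\mathrm{Ad}_{b^{-1}}X+Y),\qquad (a,X)^{-1}:=(a^{-1},-\mathrm{Ad}_aX),$$ for $a,b\in G$, $X,Y\in\mathfrak{g}$. As a vector space, the Lie algebra $\mathrm{Lie}(TG)$ of $TG$ is $\mathfrak{g}\oplus\mathfrak{g}$; for $X\in\mathfrak{g}$ write $X^c:=(X,0)$ and $X^v:=(0,X)$. The brackets on $\mathrm{Lie}(TG)$ are $$[X^c,Y^c]=[X,Y]^c,\qquad [X^c,Y^v]=[X,Y]^v,\qquad [X^v,Y^v]=0.$$ Induced structure: $\widehat{J}$ is the left-invariant bundle map $T(TG)\to T(TG)$ determined by $\widehat{J}X^c:=(JX)^c$ and $\widehat{J}X^v:=(JX)^v$ for all $X\in\mathfrak{g}$, and $\widehat{g}$ is the left-invariant symmetric bilinear form on $TG$ determined by $\widehat{g}(X^c,Y^c)=\widehat{g}(X^v,Y^v)=0$ and $\widehat{g}(X^c,Y^v):=g(X,Y)$ for all $X,Y\in\mathfrak{g}$. *)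

theory Defs
  imports "HOL-Analysis.Analysis" "HOL-Algebra.Group" "HOL-Library.Function_Algebras"
begin

section \<open>Smooth maps between Euclidean spaces\<close>

primrec Ck_on :: "nat \<Rightarrow> 'e::real_normed_vector set \<Rightarrow> ('e \<Rightarrow> 'f::real_normed_vector) \<Rightarrow> bool" where
  "Ck_on 0 S f \<longleftrightarrow> continuous_on S f"
| "Ck_on (Suc k) S f \<longleftrightarrow>
     (\<forall>x\<in>S. f differentiable (at x)) \<and> (\<forall>v. Ck_on k S (\<lambda>x. frechet_derivative f (at x) v))"

text \<open>Only used for open \<open>S\<close>.\<close>

definition smooth_on :: "'e::real_normed_vector set \<Rightarrow> ('e \<Rightarrow> 'f::real_normed_vector) \<Rightarrow> bool" where
  "smooth_on S f \<longleftrightarrow> (\<forall>k. Ck_on k S f)"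


section \<open>Smooth manifolds\<close>

text \<open>
  A chart is a pair of its domain and its coordinate map, and a manifold is given by an atlas,
  which need not be maximal. Both the underlying set and the topology are induced by the atlas.
\<close>

type_synonym ('a, 'e) chart = "'a set \<times> ('a \<Rightarrow> 'e)"

definition mcarrier :: "('a, 'e) chart set \<Rightarrow> 'a set" where
  "mcarrier A = (\<Union>c\<in>A. fst c)"

definition chart_inv :: "('a, 'e) chart \<Rightarrow> 'e \<Rightarrow> 'a" where
  "chart_inv c = inv_into (fst c) (snd c)"

definition mtopology :: "('a, 'e::topological_space) chart set \<Rightarrow> 'a topology" where
  "mtopology A = topology_generated_by {fst c \<inter> snd c -` W | c W. c \<in> A \<and> open W}"

definition smooth_manifold :: "('a, 'e::euclidean_space) chart set \<Rightarrow> bool" where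
  "smooth_manifold A \<longleftrightarrow>
     (\<forall>c\<in>A. inj_on (snd c) (fst c) \<and> open (snd c ` fst c)) \<and>
     (\<forall>c\<in>A. \<forall>d\<in>A. open (snd c ` (fst c \<inter> fst d)) \<and>
        smooth_on (snd c ` (fst c \<inter> fst d)) (snd d \<circ> chart_inv c)) \<and>
     Hausdorff_space (mtopology A) \<and> second_countable (mtopology A)"

definition prod_atlas ::
  "('a, 'e) chart set \<Rightarrow> ('b, 'f) chart set \<Rightarrow> ('a \<times> 'b, 'e \<times> 'f) chart set" where
  "prod_atlas A B = {(fst c \<times> fst d, map_prod (snd c) (snd d)) | c d. c \<in> A \<and> d \<in> B}"

text \<open>The openness condition below expresses the continuity of \<open>F\<close>.\<close>

definition smooth_map ::
  "('a, 'e::euclidean_space) chart set \<Rightarrow> ('b, 'f::euclidean_space) chart set \<Rightarrow> ('a \<Rightarrow> 'b) \<Rightarrow> bool" where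
  "smooth_map A B F \<longleftrightarrow>
     F ` mcarrier A \<subseteq> mcarrier B \<and>
     (\<forall>c\<in>A. \<forall>d\<in>B.
        open (snd c ` (fst c \<inter> F -` fst d)) \<and>
        smooth_on (snd c ` (fst c \<inter> F -` fst d)) (snd d \<circ> F \<circ> chart_inv c))"

definition smooth_fun :: "('a, 'e::euclidean_space) chart set \<Rightarrow> ('a \<Rightarrow> real) \<Rightarrow> bool" where
  "smooth_fun A f \<longleftrightarrow> (\<forall>c\<in>A. smooth_on (snd c ` fst c) (f \<circ> chart_inv c))"


section \<open>Tangent vectors and vector fields\<close>

instantiation "fun" :: (type, real_vector) real_vector
begin

definition scaleR_fun :: "real \<Rightarrow> ('a \<Rightarrow> 'b) \<Rightarrow> 'a \<Rightarrow> 'b" where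
  "scaleR_fun r f = (\<lambda>x. r *\<^sub>R f x)"

instance
  by standard (simp_all add: scaleR_fun_def plus_fun_def fun_eq_iff scaleR_add_right scaleR_add_left)

end

text \<open>
  A tangent vector at \<open>p\<close> is the family of its coordinate vectors in all charts around \<open>p\<close>; the
  coordinate vectors transform by the derivatives of the transition maps. The value at charts
  that are not charts around \<open>p\<close> is set to zero, so that \<open>tangent_space A p\<close> is a linear subspace of a
  function space.
\<close>

type_synonym ('a, 'e) tvec = "('a, 'e) chart \<Rightarrow> 'e"

definition charts_at :: "('a, 'e) chart set \<Rightarrow> 'a \<Rightarrow> ('a, 'e) chart set" where
  "charts_at A p = {c \<in> A. p \<in> fst c}"

definition chart_at :: "('a, 'e) chart set \<Rightarrow> 'a \<Rightarrow> ('a, 'e) chart" where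
  "chart_at A p = (SOME c. c \<in> charts_at A p)"

definition tangent_space :: "('a, 'e::euclidean_space) chart set \<Rightarrow> 'a \<Rightarrow> ('a, 'e) tvec set" where
  "tangent_space A p = {v.
     (\<forall>c. c \<notin> charts_at A p \<longrightarrow> v c = 0) \<and>
     (\<forall>c\<in>charts_at A p. \<forall>d\<in>charts_at A p.
        v d = frechet_derivative (snd d \<circ> chart_inv c) (at (snd c p)) (v c))}"

text \<open>The results of the next two definitions do not depend on the choice of \<open>chart_at A p\<close>.\<close>

definition differential ::
  "('a, 'e::euclidean_space) chart set \<Rightarrow> ('b, 'f::euclidean_space) chart set \<Rightarrow> ('a \<Rightarrow> 'b) \<Rightarrow>
   'a \<Rightarrow> ('a, 'e) tvec \<Rightarrow> ('b, 'f) tvec" where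
  "differential A B F p v = (\<lambda>d. if d \<in> charts_at B (F p)
     then let c = chart_at A p in
       frechet_derivative (snd d \<circ> F \<circ> chart_inv c) (at (snd c p)) (v c)
     else 0)"

definition dir_deriv ::
  "('a, 'e::euclidean_space) chart set \<Rightarrow> 'a \<Rightarrow> ('a, 'e) tvec \<Rightarrow> ('a \<Rightarrow> real) \<Rightarrow> real" where
  "dir_deriv A p v f = (let c = chart_at A p in
     frechet_derivative (f \<circ> chart_inv c) (at (snd c p)) (v c))"

text \<open>
  The values of functions, vector fields and tensor fields outside \<open>mcarrier A\<close> are irrelevant; all
  identities between them are stated on \<open>mcarrier A\<close>.
\<close>

type_synonym ('a, 'e) vfield = "'a \<Rightarrow> ('a, 'e) tvec"

definition vector_field :: "('a, 'e::euclidean_space) chart set \<Rightarrow> ('a, 'e) vfield \<Rightarrow> bool" where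
  "vector_field A X \<longleftrightarrow>
     (\<forall>p\<in>mcarrier A. X p \<in> tangent_space A p) \<and>
     (\<forall>c\<in>A. smooth_on (snd c ` fst c) (\<lambda>x. X (chart_inv c x) c))"

definition vf_deriv ::
  "('a, 'e::euclidean_space) chart set \<Rightarrow> ('a, 'e) vfield \<Rightarrow> ('a \<Rightarrow> real) \<Rightarrow> 'a \<Rightarrow> real" where
  "vf_deriv A X f p = dir_deriv A p (X p) f"

definition bracket ::
  "('a, 'e::euclidean_space) chart set \<Rightarrow> ('a, 'e) vfield \<Rightarrow> ('a, 'e) vfield \<Rightarrow> ('a, 'e) vfield" where
  "bracket A X Y p = (\<lambda>c. if c \<in> charts_at A p
     then frechet_derivative (\<lambda>x. Y (chart_inv c x) c) (at (snd c p)) (X p c)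
        - frechet_derivative (\<lambda>x. X (chart_inv c x) c) (at (snd c p)) (Y p c)
     else 0)"


section \<open>Almost pseudo-Hermitian structures\<close>

type_synonym ('a, 'e) metric_field = "'a \<Rightarrow> ('a, 'e) tvec \<Rightarrow> ('a, 'e) tvec \<Rightarrow> real"

type_synonym ('a, 'e) endo_field = "'a \<Rightarrow> ('a, 'e) tvec \<Rightarrow> ('a, 'e) tvec"

definition pseudo_metric ::
  "('a, 'e::euclidean_space) chart set \<Rightarrow> ('a, 'e) metric_field \<Rightarrow> bool" where
  "pseudo_metric A g \<longleftrightarrow>
     (\<forall>p\<in>mcarrier A.
        (\<forall>u\<in>tangent_space A p. \<forall>v\<in>tangent_space A p. g p u v = g p v u) \<and>
        (\<forall>u\<in>tangent_space A p. \<forall>v\<in>tangent_space A p. \<forall>w\<in>tangent_space A p. \<forall>r.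
           g p (r *\<^sub>R u + v) w = r * g p u w + g p v w) \<and>
        (\<forall>u\<in>tangent_space A p. (\<forall>v\<in>tangent_space A p. g p u v = 0) \<longrightarrow> u = 0)) \<and>
     (\<forall>X Y. vector_field A X \<longrightarrow> vector_field A Y \<longrightarrow> smooth_fun A (\<lambda>p. g p (X p) (Y p)))"

definition almost_complex ::
  "('a, 'e::euclidean_space) chart set \<Rightarrow> ('a, 'e) endo_field \<Rightarrow> bool" where
  "almost_complex A J \<longleftrightarrow>
     (\<forall>p\<in>mcarrier A.
        (\<forall>u\<in>tangent_space A p. J p u \<in> tangent_space A p \<and> J p (J p u) = - u) \<and>
        (\<forall>u\<in>tangent_space A p. \<forall>v\<in>tangent_space A p. \<forall>r.
           J p (r *\<^sub>R u + v) = r *\<^sub>R J p u + J p v)) \<and>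
     (\<forall>X. vector_field A X \<longrightarrow> vector_field A (\<lambda>p. J p (X p)))"

definition almost_pseudo_hermitian ::
  "('a, 'e::euclidean_space) chart set \<Rightarrow> ('a, 'e) metric_field \<Rightarrow> ('a, 'e) endo_field \<Rightarrow> bool" where
  "almost_pseudo_hermitian A g J \<longleftrightarrow>
     pseudo_metric A g \<and> almost_complex A J \<and>
     (\<forall>p\<in>mcarrier A. \<forall>u\<in>tangent_space A p. \<forall>v\<in>tangent_space A p.
        g p (J p u) (J p v) = g p u v)"

definition connection ::
  "('a, 'e::euclidean_space) chart set \<Rightarrow>
   (('a, 'e) vfield \<Rightarrow> ('a, 'e) vfield \<Rightarrow> ('a, 'e) vfield) \<Rightarrow> bool" where
  "connection A D \<longleftrightarrow>
     (\<forall>X Y. vector_field A X \<longrightarrow> vector_field A Y \<longrightarrow> vector_field A (D X Y)) \<and>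
     (\<forall>X Y Z f. vector_field A X \<longrightarrow> vector_field A Y \<longrightarrow> vector_field A Z \<longrightarrow> smooth_fun A f \<longrightarrow>
        (\<forall>p\<in>mcarrier A.
           D (\<lambda>q. X q + Y q) Z p = D X Z p + D Y Z p \<and>
           D (\<lambda>q. f q *\<^sub>R X q) Z p = f p *\<^sub>R D X Z p \<and>
           D X (\<lambda>q. Y q + Z q) p = D X Y p + D X Z p \<and>
           D X (\<lambda>q. f q *\<^sub>R Y q) p = f p *\<^sub>R D X Y p + vf_deriv A X f p *\<^sub>R Y p))"

definition levi_civita ::
  "('a, 'e::euclidean_space) chart set \<Rightarrow> ('a, 'e) metric_field \<Rightarrow>
   (('a, 'e) vfield \<Rightarrow> ('a, 'e) vfield \<Rightarrow> ('a, 'e) vfield) \<Rightarrow> bool" where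
  "levi_civita A g D \<longleftrightarrow>
     connection A D \<and>
     (\<forall>X Y. vector_field A X \<longrightarrow> vector_field A Y \<longrightarrow>
        (\<forall>p\<in>mcarrier A. D X Y p - D Y X p = bracket A X Y p)) \<and>
     (\<forall>X Y Z. vector_field A X \<longrightarrow> vector_field A Y \<longrightarrow> vector_field A Z \<longrightarrow>
        (\<forall>p\<in>mcarrier A. vf_deriv A X (\<lambda>q. g q (Y q) (Z q)) p
           = g p (D X Y p) (Z p) + g p (Y p) (D X Z p)))"

definition covariant_deriv_endo ::
  "(('a, 'e) vfield \<Rightarrow> ('a, 'e::euclidean_space) vfield \<Rightarrow> ('a, 'e) vfield) \<Rightarrow> ('a, 'e) endo_field \<Rightarrow>
   ('a, 'e) vfield \<Rightarrow> ('a, 'e) vfield \<Rightarrow> ('a, 'e) vfield" where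
  "covariant_deriv_endo D J X Y = (\<lambda>p. D X (\<lambda>q. J q (Y q)) p - J p (D X Y p))"

text \<open>The Levi-Civita connection is unique on vector fields over \<open>mcarrier A\<close>, so \<open>\<exists>D\<close> below just names it.\<close>

definition nearly_pseudo_kahler ::
  "('a, 'e::euclidean_space) chart set \<Rightarrow> ('a, 'e) metric_field \<Rightarrow> ('a, 'e) endo_field \<Rightarrow> bool" where
  "nearly_pseudo_kahler A g J \<longleftrightarrow>
     almost_pseudo_hermitian A g J \<and>
     (\<exists>D. levi_civita A g D \<and>
        (\<forall>X. vector_field A X \<longrightarrow> (\<forall>p\<in>mcarrier A. covariant_deriv_endo D J X X p = 0)))"

definition nijenhuis ::
  "('a, 'e::euclidean_space) chart set \<Rightarrow> ('a, 'e) endo_field \<Rightarrow>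
   ('a, 'e) vfield \<Rightarrow> ('a, 'e) vfield \<Rightarrow> ('a, 'e) vfield" where
  "nijenhuis A J X Y = (\<lambda>p.
     J p (bracket A (\<lambda>q. J q (X q)) Y p) + J p (bracket A X (\<lambda>q. J q (Y q)) p)
     + bracket A X Y p - bracket A (\<lambda>q. J q (X q)) (\<lambda>q. J q (Y q)) p)"

definition integrable_complex ::
  "('a, 'e::euclidean_space) chart set \<Rightarrow> ('a, 'e) endo_field \<Rightarrow> bool" where
  "integrable_complex A J \<longleftrightarrow>
     (\<forall>X Y. vector_field A X \<longrightarrow> vector_field A Y \<longrightarrow> (\<forall>p\<in>mcarrier A. nijenhuis A J X Y p = 0))"

definition fundamental_form ::
  "('a, 'e) metric_field \<Rightarrow> ('a, 'e) endo_field \<Rightarrow> 'a \<Rightarrow> ('a, 'e) tvec \<Rightarrow> ('a, 'e) tvec \<Rightarrow> real" where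
  "fundamental_form g J p u v = g p (J p u) v"

text \<open>Exterior derivative of a 2-form, by the invariant formula.\<close>

definition ext_deriv2 ::
  "('a, 'e::euclidean_space) chart set \<Rightarrow> ('a \<Rightarrow> ('a, 'e) tvec \<Rightarrow> ('a, 'e) tvec \<Rightarrow> real) \<Rightarrow>
   ('a, 'e) vfield \<Rightarrow> ('a, 'e) vfield \<Rightarrow> ('a, 'e) vfield \<Rightarrow> 'a \<Rightarrow> real" where
  "ext_deriv2 A w X Y Z p =
     vf_deriv A X (\<lambda>q. w q (Y q) (Z q)) p
     - vf_deriv A Y (\<lambda>q. w q (X q) (Z q)) p
     + vf_deriv A Z (\<lambda>q. w q (X q) (Y q)) p
     - w p (bracket A X Y p) (Z p) + w p (bracket A X Z p) (Y p) - w p (bracket A Y Z p) (X p)"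

definition closed_form2 ::
  "('a, 'e::euclidean_space) chart set \<Rightarrow> ('a \<Rightarrow> ('a, 'e) tvec \<Rightarrow> ('a, 'e) tvec \<Rightarrow> real) \<Rightarrow> bool" where
  "closed_form2 A w \<longleftrightarrow>
     (\<forall>X Y Z. vector_field A X \<longrightarrow> vector_field A Y \<longrightarrow> vector_field A Z \<longrightarrow>
        (\<forall>p\<in>mcarrier A. ext_deriv2 A w X Y Z p = 0))"

definition pseudo_kahler ::
  "('a, 'e::euclidean_space) chart set \<Rightarrow> ('a, 'e) metric_field \<Rightarrow> ('a, 'e) endo_field \<Rightarrow> bool" where
  "pseudo_kahler A g J \<longleftrightarrow>
     almost_pseudo_hermitian A g J \<and> integrable_complex A J \<and> closed_form2 A (fundamental_form g J)"

definition strictly_nearly_pseudo_kahler ::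
  "('a, 'e::euclidean_space) chart set \<Rightarrow> ('a, 'e) metric_field \<Rightarrow> ('a, 'e) endo_field \<Rightarrow> bool" where
  "strictly_nearly_pseudo_kahler A g J \<longleftrightarrow> nearly_pseudo_kahler A g J \<and> \<not> pseudo_kahler A g J"


section \<open>Lie groups and left-invariant structures\<close>

definition lie_group :: "('a, 'm) monoid_scheme \<Rightarrow> ('a, 'e::euclidean_space) chart set \<Rightarrow> bool" where
  "lie_group G A \<longleftrightarrow>
     group G \<and> smooth_manifold A \<and> mcarrier A = carrier G \<and>
     smooth_map (prod_atlas A A) A (\<lambda>(a, b). a \<otimes>\<^bsub>G\<^esub> b) \<and>
     smooth_map A A (\<lambda>a. inv\<^bsub>G\<^esub> a)"

definition ltrans ::
  "('a, 'm) monoid_scheme \<Rightarrow> ('a, 'e::euclidean_space) chart set \<Rightarrow> 'a \<Rightarrow> 'a \<Rightarrow>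
   ('a, 'e) tvec \<Rightarrow> ('a, 'e) tvec" where
  "ltrans G A a p = differential A A (\<lambda>x. a \<otimes>\<^bsub>G\<^esub> x) p"

definition left_invariant_metric ::
  "('a, 'm) monoid_scheme \<Rightarrow> ('a, 'e::euclidean_space) chart set \<Rightarrow> ('a, 'e) metric_field \<Rightarrow> bool" where
  "left_invariant_metric G A g \<longleftrightarrow>
     (\<forall>a\<in>carrier G. \<forall>p\<in>carrier G. \<forall>u\<in>tangent_space A p. \<forall>v\<in>tangent_space A p.
        g (a \<otimes>\<^bsub>G\<^esub> p) (ltrans G A a p u) (ltrans G A a p v) = g p u v)"

definition left_invariant_endo ::
  "('a, 'm) monoid_scheme \<Rightarrow> ('a, 'e::euclidean_space) chart set \<Rightarrow> ('a, 'e) endo_field \<Rightarrow> bool" where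
  "left_invariant_endo G A J \<longleftrightarrow>
     (\<forall>a\<in>carrier G. \<forall>p\<in>carrier G. \<forall>u\<in>tangent_space A p.
        J (a \<otimes>\<^bsub>G\<^esub> p) (ltrans G A a p u) = ltrans G A a p (J p u))"

definition left_invariant_aph ::
  "('a, 'm) monoid_scheme \<Rightarrow> ('a, 'e::euclidean_space) chart set \<Rightarrow>
   ('a, 'e) metric_field \<Rightarrow> ('a, 'e) endo_field \<Rightarrow> bool" where
  "left_invariant_aph G A g J \<longleftrightarrow>
     almost_pseudo_hermitian A g J \<and> left_invariant_metric G A g \<and> left_invariant_endo G A J"


section \<open>The tangent Lie group\<close>

definition lie_alg :: "('a, 'm) monoid_scheme \<Rightarrow> ('a, 'e::euclidean_space) chart set \<Rightarrow> ('a, 'e) tvec set" where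
  "lie_alg G A = tangent_space A \<one>\<^bsub>G\<^esub>"

definition Ad ::
  "('a, 'm) monoid_scheme \<Rightarrow> ('a, 'e::euclidean_space) chart set \<Rightarrow> 'a \<Rightarrow> ('a, 'e) tvec \<Rightarrow> ('a, 'e) tvec" where
  "Ad G A b = differential A A (\<lambda>x. b \<otimes>\<^bsub>G\<^esub> x \<otimes>\<^bsub>G\<^esub> inv\<^bsub>G\<^esub> b) \<one>\<^bsub>G\<^esub>"

text \<open>
  By left translation, the tangent bundle is identified with \<open>carrier G \<times> lie_alg G A\<close>.
  The inverse of \<open>(a, X)\<close> in the group below is \<open>(a\<inverse>, - Ad a X)\<close>.
\<close>

definition tangent_group ::
  "('a, 'm) monoid_scheme \<Rightarrow> ('a, 'e::euclidean_space) chart set \<Rightarrow> ('a \<times> ('a, 'e) tvec) monoid" where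
  "tangent_group G A =
     \<lparr>carrier = carrier G \<times> lie_alg G A,
      monoid.mult = (\<lambda>(a, X) (b, Y). (a \<otimes>\<^bsub>G\<^esub> b, Ad G A (inv\<^bsub>G\<^esub> b) X + Y)),
      one = (\<one>\<^bsub>G\<^esub>, 0)\<rparr>"

text \<open>
  The vector space \<open>lie_alg G A\<close> is a manifold via the linear isomorphisms to the model space that
  evaluate a tangent vector in a chart around the unit element.
\<close>

definition lie_alg_atlas ::
  "('a, 'm) monoid_scheme \<Rightarrow> ('a, 'e::euclidean_space) chart set \<Rightarrow> (('a, 'e) tvec, 'e) chart set" where
  "lie_alg_atlas G A = {(lie_alg G A, \<lambda>X. X c) | c. c \<in> charts_at A \<one>\<^bsub>G\<^esub>}"

definition tangent_atlas ::
  "('a, 'm) monoid_scheme \<Rightarrow> ('a, 'e::euclidean_space) chart set \<Rightarrow>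
   ('a \<times> ('a, 'e) tvec, 'e \<times> 'e) chart set" where
  "tangent_atlas G A = prod_atlas A (lie_alg_atlas G A)"

type_synonym ('a, 'e) ttvec = "('a \<times> ('a, 'e) tvec, 'e \<times> 'e) tvec"

text \<open>
  \<open>c_lift\<close> and \<open>v_lift\<close> are the two inclusions of the Lie algebra into the tangent space
  of the tangent group at its unit \<open>(\<one>, 0)\<close>: the differential of \<open>a \<mapsto> (a, 0)\<close>, and the velocity of
  \<open>t \<mapsto> (\<one>, t X)\<close>.
\<close>

definition c_lift ::
  "('a, 'm) monoid_scheme \<Rightarrow> ('a, 'e::euclidean_space) chart set \<Rightarrow> ('a, 'e) tvec \<Rightarrow> ('a, 'e) ttvec" where
  "c_lift G A = differential A (tangent_atlas G A) (\<lambda>a. (a, 0)) \<one>\<^bsub>G\<^esub>"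

definition v_lift ::
  "('a, 'm) monoid_scheme \<Rightarrow> ('a, 'e::euclidean_space) chart set \<Rightarrow> ('a, 'e) tvec \<Rightarrow> ('a, 'e) ttvec" where
  "v_lift G A X = (\<lambda>c. if c \<in> charts_at (tangent_atlas G A) (\<one>\<^bsub>G\<^esub>, 0)
     then vector_derivative (\<lambda>t. snd c (\<one>\<^bsub>G\<^esub>, t *\<^sub>R X)) (at 0)
     else 0)"

text \<open>The unique pair \<open>(X, Y)\<close> with \<open>W = X\<^sup>c + Y\<^sup>v\<close>.\<close>

definition cv_parts ::
  "('a, 'm) monoid_scheme \<Rightarrow> ('a, 'e::euclidean_space) chart set \<Rightarrow> ('a, 'e) ttvec \<Rightarrow>
   ('a, 'e) tvec \<times> ('a, 'e) tvec" where
  "cv_parts G A W = (THE P. fst P \<in> lie_alg G A \<and> snd P \<in> lie_alg G A \<and>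
     W = c_lift G A (fst P) + v_lift G A (snd P))"

definition hat_g_unit ::
  "('a, 'm) monoid_scheme \<Rightarrow> ('a, 'e::euclidean_space) chart set \<Rightarrow> ('a, 'e) metric_field \<Rightarrow>
   ('a, 'e) ttvec \<Rightarrow> ('a, 'e) ttvec \<Rightarrow> real" where
  "hat_g_unit G A g W W' =
     (let (X, Y) = cv_parts G A W; (X', Y') = cv_parts G A W' in
        g \<one>\<^bsub>G\<^esub> X Y' + g \<one>\<^bsub>G\<^esub> X' Y)"

definition hat_J_unit ::
  "('a, 'm) monoid_scheme \<Rightarrow> ('a, 'e::euclidean_space) chart set \<Rightarrow> ('a, 'e) endo_field \<Rightarrow>
   ('a, 'e) ttvec \<Rightarrow> ('a, 'e) ttvec" where
  "hat_J_unit G A J W =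
     (let (X, Y) = cv_parts G A W in c_lift G A (J \<one>\<^bsub>G\<^esub> X) + v_lift G A (J \<one>\<^bsub>G\<^esub> Y))"

definition hat_g ::
  "('a, 'm) monoid_scheme \<Rightarrow> ('a, 'e::euclidean_space) chart set \<Rightarrow> ('a, 'e) metric_field \<Rightarrow>
   ('a \<times> ('a, 'e) tvec, 'e \<times> 'e) metric_field" where
  "hat_g G A g q u w =
     (let TG = tangent_group G A; L = ltrans TG (tangent_atlas G A) (inv\<^bsub>TG\<^esub> q) q in
        hat_g_unit G A g (L u) (L w))"

definition hat_J ::
  "('a, 'm) monoid_scheme \<Rightarrow> ('a, 'e::euclidean_space) chart set \<Rightarrow> ('a, 'e) endo_field \<Rightarrow>
   ('a \<times> ('a, 'e) tvec, 'e \<times> 'e) endo_field" where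
  "hat_J G A J q u =
     (let TG = tangent_group G A; TA = tangent_atlas G A in
        ltrans TG TA q \<one>\<^bsub>TG\<^esub> (hat_J_unit G A J (ltrans TG TA (inv\<^bsub>TG\<^esub> q) q u)))"

end

theory Submission
  imports Defs
begin

text \<open>
  The Lie algebra of the tangent group is \<open>\<gg> \<otimes> \<real>[\<epsilon>]/(\<epsilon>\<^sup>2)\<close>: reading \<open>X\<^sup>c + Y\<^sup>v\<close> as \<open>X + \<epsilon> Y\<close>, its bracket
  and the induced \<open>J\<close> are the extensions of scalars of the bracket and of \<open>J\<close>, and the induced metric is the
  \<open>\<epsilon>\<close>-part of the extension of \<open>g\<close>. Multilinear identities survive extension of scalars. So the
  theorem holds because, for a left-invariant structure, everything in question is a
  multilinear identity on the Lie algebra.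

  To see this, the tangent bundle is trivialized by left translations: a vector field \<open>X\<close> becomes a function
  \<open>th X\<close> with values in the model space, and \<open>L\<close> is the inverse operation. The bracket becomes
  \<open>[X, Y] = L (d(th Y)(X) - d(th X)(Y) + br (th X) (th Y))\<close> (\<open>bracket_trivialized\<close>). In the
  Nijenhuis tensor and in \<open>d\<omega>\<close> of a left-invariant structure all derivatives cancel, so that both are given by
  the structure constants (\<open>nijenhuis_trivialized\<close>, \<open>ext_deriv2_trivialized\<close>). A Levi-Civita
  connection is the same as a bilinear map \<open>B\<close> on the Lie algebra that is torsion-free and metric, and the
  structure is nearly pseudo-Kaehler if and only if such a \<open>B\<close> satisfies \<open>B x (j x) = j (B x x)\<close>
  (\<open>nearly_pseudo_kahlerI\<close>, \<open>nearly_pseudo_kahlerE\<close>). The last condition is quadratic in \<open>x\<close>; its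
  polarization is bilinear and passes to \<open>\<real>[\<epsilon>]\<close> (\<open>hat_nearly_pseudo_kahler\<close>). Conversely, integrability and
  closedness on the tangent group restrict to \<open>G\<close> by inserting \<open>X\<^sup>c, Y\<^sup>c\<close> and \<open>X\<^sup>c, Y\<^sup>c, Z\<^sup>v\<close>
  (\<open>integrable_of_hat\<close>, \<open>closed_of_hat\<close>).

  What remains is the tangent group itself. It is a Lie group because \<open>Ad\<close> is a partial derivative of
  the conjugation map and hence smooth (\<open>smooth_fun_at_Ad\<close>, \<open>lie_group_TG\<close>). Its bracket is found
  from the derivative of \<open>Ad\<close> (\<open>dderiv_Ad_inv\<close>, \<open>T_br\<close>). The analytic fact behind all bracket
  computations is the symmetry of second derivatives.
\<close>

section \<open>Calculus of smooth maps between Euclidean spaces\<close>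

abbreviation fderiv :: "('a::real_normed_vector \<Rightarrow> 'b::real_normed_vector) \<Rightarrow> 'a \<Rightarrow> 'a \<Rightarrow> 'b" where
  "fderiv f x \<equiv> frechet_derivative f (at x)"

lemma frechet_derivative_eqI: "(f has_derivative f') (at x) \<Longrightarrow> fderiv f x = f'"
  using frechet_derivative_at by metis

lemma frechet_derivative_has_derivative:
  "f differentiable (at x) \<Longrightarrow> (f has_derivative fderiv f x) (at x)"
  by (simp add: frechet_derivative_works)

lemma Ck_on_cong:
  assumes "open S" "\<And>x. x \<in> S \<Longrightarrow> f x = g x" "Ck_on k S f"
  shows "Ck_on k S g"
  using assms(2,3)
proof (induction k arbitrary: f g)
  case 0
  then show ?case by (simp cong: continuous_on_cong)
next
  case (Suc k)
  have d: "g differentiable (at x)" if "x \<in> S" for x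
  proof -
    have "(f has_derivative fderiv f x) (at x)"
      by (rule frechet_derivative_has_derivative) (use Suc.prems that in auto)
    then show ?thesis
      using has_derivative_transform_within_open[OF _ assms(1) that] Suc.prems(1)
      unfolding differentiable_def by blast
  qed
  have "Ck_on k S (\<lambda>x. fderiv g x v)" for v
  proof (rule Suc.IH[of "\<lambda>x. fderiv f x v"])
    fix x assume x: "x \<in> S"
    have "fderiv f x = fderiv g x"
      by (rule frechet_derivative_transform_within_open[OF _ assms(1) x]) (use Suc.prems x in auto)
    then show "fderiv f x v = fderiv g x v" by simp
  qed (use Suc.prems in simp)
  with d show ?case by simp
qed

lemma Ck_on_Suc_imp: "Ck_on (Suc k) S f \<Longrightarrow> Ck_on k S f"
proof (induction k arbitrary: f)
  case 0
  then show ?case by (auto intro!: continuous_at_imp_continuous_on differentiable_imp_continuous_within)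
next
  case (Suc k)
  then show ?case by (metis Ck_on.simps(2))
qed

lemma Ck_on_subset: "Ck_on k S f \<Longrightarrow> T \<subseteq> S \<Longrightarrow> Ck_on k T f"
proof (induction k arbitrary: f)
  case 0
  then show ?case by (auto intro: continuous_on_subset)
qed auto

lemma Ck_on_local:
  assumes "\<And>x. x \<in> S \<Longrightarrow> \<exists>U. open U \<and> x \<in> U \<and> Ck_on k U f"
  shows "Ck_on k S f"
  using assms
proof (induction k arbitrary: f)
  case 0
  show ?case
    unfolding Ck_on.simps
  proof (intro continuous_at_imp_continuous_on ballI)
    fix x assume "x \<in> S"
    then obtain U where "open U" "x \<in> U" "continuous_on U f" using 0 by auto
    then show "isCont f x" by (simp add: continuous_on_eq_continuous_at)
  qed
next
  case (Suc k)
  show ?case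
    unfolding Ck_on.simps
  proof (intro conjI ballI allI)
    fix x assume "x \<in> S"
    then show "f differentiable at x" using Suc.prems by fastforce
  next
    fix v
    show "Ck_on k S (\<lambda>x. fderiv f x v)"
      by (rule Suc.IH) (use Suc.prems in fastforce)
  qed
qed

lemma Ck_on_const: "Ck_on k S (\<lambda>x. c)"
  by (induction k arbitrary: c) (auto simp: frechet_derivative_const)

lemma Ck_on_bounded_linear_comp:
  assumes h: "bounded_linear h" and S: "open S" and "Ck_on k S f"
  shows "Ck_on k S (\<lambda>x. h (f x))"
  using assms(3)
proof (induction k arbitrary: f)
  case 0
  then show ?case using bounded_linear.continuous_on[OF h] by auto
next
  case (Suc k)
  have D: "((\<lambda>x. h (f x)) has_derivative (\<lambda>v. h (fderiv f x v))) (at x)"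
    if "x \<in> S" for x
    by (rule bounded_linear.has_derivative[OF h], rule frechet_derivative_has_derivative)
       (use Suc.prems that in auto)
  have "Ck_on k S (\<lambda>x. h (fderiv f x v))" for v
    using Suc by auto
  then have "Ck_on k S (\<lambda>x. fderiv (\<lambda>x. h (f x)) x v)" for v
    by (rule Ck_on_cong[OF S, rotated]) (simp add: frechet_derivative_eqI[OF D])
  then show ?case using D by (auto simp: differentiable_def)
qed

lemma Ck_on_add:
  assumes S: "open S" and "Ck_on k S f" "Ck_on k S g"
  shows "Ck_on k S (\<lambda>x. f x + g x)"
  using assms(2,3)
proof (induction k arbitrary: f g)
  case 0
  then show ?case by (auto intro: continuous_on_add)
next
  case (Suc k)
  have D: "((\<lambda>x. f x + g x) has_derivative
      (\<lambda>v. fderiv f x v + fderiv g x v)) (at x)"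
    if "x \<in> S" for x
    by (rule has_derivative_add; rule frechet_derivative_has_derivative) (use Suc.prems that in auto)
  have "Ck_on k S (\<lambda>x. fderiv f x v + fderiv g x v)" for v
    using Suc by auto
  then have "Ck_on k S (\<lambda>x. fderiv (\<lambda>x. f x + g x) x v)" for v
    by (rule Ck_on_cong[OF S, rotated]) (simp add: frechet_derivative_eqI[OF D])
  then show ?case using D by (auto simp: differentiable_def)
qed

lemma Ck_on_bilinear:
  assumes b: "bounded_bilinear b" and S: "open S" and "Ck_on k S f" "Ck_on k S g"
  shows "Ck_on k S (\<lambda>x. b (f x) (g x))"
  using assms(3,4)
proof (induction k arbitrary: f g)
  case 0
  then show ?case using bounded_bilinear.continuous_on[OF b] by auto
next
  case (Suc k)
  have D: "((\<lambda>x. b (f x) (g x)) has_derivative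
      (\<lambda>v. b (f x) (fderiv g x v) + b (fderiv f x v) (g x))) (at x)"
    if "x \<in> S" for x
    by (rule bounded_bilinear.FDERIV[OF b]; rule frechet_derivative_has_derivative)
       (use Suc.prems that in auto)
  have "Ck_on k S (\<lambda>x. b (f x) (fderiv g x v) + b (fderiv f x v) (g x))" for v
    using Suc.prems Ck_on_Suc_imp[OF Suc.prems(1)] Ck_on_Suc_imp[OF Suc.prems(2)]
    by (intro Ck_on_add S Suc.IH) auto
  then have "Ck_on k S (\<lambda>x. fderiv (\<lambda>x. b (f x) (g x)) x v)" for v
    by (rule Ck_on_cong[OF S, rotated]) (simp add: frechet_derivative_eqI[OF D])
  then show ?case using D by (auto simp: differentiable_def)
qed

lemma Ck_on_bounded_linear:
  assumes h: "bounded_linear h"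
  shows "Ck_on k S h"
proof (cases k)
  case 0
  then show ?thesis using bounded_linear.continuous_on[OF h continuous_on_id] by simp
next
  case (Suc j)
  have "(h has_derivative h) (at x)" for x using bounded_linear_imp_has_derivative[OF h] .
  then have "fderiv h x = h" "h differentiable (at x)" for x
    by (auto simp: frechet_derivative_eqI differentiable_def)
  then show ?thesis
    using Suc by (simp add: Ck_on_const)
qed

lemma Ck_on_sum:
  assumes S: "open S" and "\<And>i. i \<in> I \<Longrightarrow> Ck_on k S (f i)"
  shows "Ck_on k S (\<lambda>x. \<Sum>i\<in>I. f i x)"
  using assms(2) by (induction I rule: infinite_finite_induct) (auto intro!: Ck_on_const Ck_on_add S)

text \<open>
  The chain rule writes the derivative of a composition as
  \<open>\<Sum>i. (Df(x) v \<bullet> i) Dg(f x) i\<close>; the finite basis separates the directions, so that induction on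
  the order of differentiability applies to each \<open>Dg(\<cdot>) i\<close>.
\<close>

lemma has_derivative_basis_expansion:
  fixes g' :: "'b::euclidean_space \<Rightarrow> 'c::real_normed_vector"
  assumes "linear g'"
  shows "g' w = (\<Sum>i\<in>Basis. (w \<bullet> i) *\<^sub>R g' i)"
proof -
  have "g' (\<Sum>i\<in>Basis. (w \<bullet> i) *\<^sub>R i) = (\<Sum>i\<in>Basis. (w \<bullet> i) *\<^sub>R g' i)"
    by (simp add: linear_sum[OF assms] linear_cmul[OF assms])
  then show ?thesis by (simp add: euclidean_representation)
qed

lemma Ck_on_compose:
  fixes g :: "'b::euclidean_space \<Rightarrow> 'c::real_normed_vector"
  assumes S: "open S" and T: "open T" and "f ` S \<subseteq> T" and "Ck_on k S f" "Ck_on k T g"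
  shows "Ck_on k S (\<lambda>x. g (f x))"
  using assms(4,5)
proof (induction k arbitrary: g)
  case 0
  then show ?case using assms(3) by (auto intro: continuous_on_compose2)
next
  case (Suc k)
  have D: "((\<lambda>x. g (f x)) has_derivative
      (\<lambda>v. fderiv g (f x) (fderiv f x v))) (at x)"
    and gd: "g differentiable (at (f x))"
    if "x \<in> S" for x
  proof -
    show gd: "g differentiable (at (f x))" using Suc.prems assms(3) that by auto
    have "(f has_derivative fderiv f x) (at x)"
      by (rule frechet_derivative_has_derivative) (use Suc.prems that in auto)
    from diff_chain_at[OF this frechet_derivative_has_derivative[OF gd]]
    show "((\<lambda>x. g (f x)) has_derivative
      (\<lambda>v. fderiv g (f x) (fderiv f x v))) (at x)"
      by (simp add: o_def)
  qed
  have D': "fderiv (\<lambda>x. g (f x)) x v =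
     (\<Sum>i\<in>Basis. (fderiv f x v \<bullet> i) *\<^sub>R fderiv g (f x) i)"
    if "x \<in> S" for x v
    unfolding frechet_derivative_eqI[OF D[OF that]]
    by (rule has_derivative_basis_expansion) (rule linear_frechet_derivative[OF gd[OF that]])
  have *: "Ck_on k S (\<lambda>x. fderiv g (f x) i)" for i
    by (rule Suc.IH[of "\<lambda>y. fderiv g y i"])
       (use Suc.prems Ck_on_Suc_imp[OF Suc.prems(1)] in auto)
  have "Ck_on k S (\<lambda>x. (fderiv f x v \<bullet> i) *\<^sub>R fderiv g (f x) i)" for i v
    by (intro Ck_on_bilinear[OF bounded_bilinear_scaleR S] Ck_on_bilinear[OF bounded_bilinear_inner S]
        Ck_on_const *) (use Suc.prems in auto)
  then have "Ck_on k S (\<lambda>x. \<Sum>i\<in>Basis. (fderiv f x v \<bullet> i) *\<^sub>R fderiv g (f x) i)" for v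
    by (intro Ck_on_sum S)
  then have "Ck_on k S (\<lambda>x. fderiv (\<lambda>x. g (f x)) x v)" for v
    by (rule Ck_on_cong[OF S, rotated]) (simp add: D')
  then show ?case using D by (auto simp: differentiable_def)
qed

text \<open>
  Smoothness on some neighbourhood of the point. In this form it passes to derivatives
  and composites without keeping track of domains.
\<close>

definition smooth_at :: "('e::real_normed_vector \<Rightarrow> 'f::real_normed_vector) \<Rightarrow> 'e \<Rightarrow> bool" where
  "smooth_at f x \<longleftrightarrow> (\<exists>U. open U \<and> x \<in> U \<and> smooth_on U f)"

lemma smooth_on_iff_smooth_at:
  assumes "open S"
  shows "smooth_on S f \<longleftrightarrow> (\<forall>x\<in>S. smooth_at f x)"
proof
  assume "smooth_on S f"
  then show "\<forall>x\<in>S. smooth_at f x" using assms unfolding smooth_at_def by blast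
next
  assume a: "\<forall>x\<in>S. smooth_at f x"
  show "smooth_on S f"
    unfolding smooth_on_def
    by (intro allI Ck_on_local) (use a in \<open>auto simp: smooth_at_def smooth_on_def\<close>)
qed

lemma smooth_at_cong:
  assumes "\<forall>\<^sub>F y in nhds x. f y = g y"
  shows "smooth_at f x \<longleftrightarrow> smooth_at g x"
proof -
  have *: "smooth_at g x" if ev: "\<forall>\<^sub>F y in nhds x. f y = g y" and smooth_fun_at: "smooth_at f x" for f g :: "'a \<Rightarrow> 'b"
  proof -
    obtain V where V: "open V" "x \<in> V" "\<And>y. y \<in> V \<Longrightarrow> f y = g y"
      using ev unfolding eventually_nhds by blast
    obtain U where U: "open U" "x \<in> U" "smooth_on U f" using smooth_fun_at unfolding smooth_at_def by auto
    have "smooth_on (U \<inter> V) g"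
      unfolding smooth_on_def
    proof
      fix k
      have "Ck_on k (U \<inter> V) f" using U(3) Ck_on_subset unfolding smooth_on_def by blast
      then show "Ck_on k (U \<inter> V) g"
        by (rule Ck_on_cong[rotated 2]) (use U V in auto)
    qed
    then show ?thesis unfolding smooth_at_def using U V by blast
  qed
  show ?thesis using *[of f g] *[of g f] assms by (auto simp: eq_commute)
qed

lemma eventually_smooth_at: "smooth_at f x \<Longrightarrow> \<forall>\<^sub>F y in nhds x. smooth_at f y"
  unfolding eventually_nhds smooth_at_def by blast

lemma smooth_at_const [simp]: "smooth_at (\<lambda>x. c) x"
  unfolding smooth_at_def smooth_on_def using Ck_on_const by blast

lemma smooth_at_bounded_linear: "bounded_linear h \<Longrightarrow> smooth_at h x"
  unfolding smooth_at_def smooth_on_def using Ck_on_bounded_linear by blast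

lemma smooth_at_ident [simp]: "smooth_at (\<lambda>x. x) x"
  by (rule smooth_at_bounded_linear) (rule bounded_linear_ident)

lemma smooth_at_bilinear:
  assumes "bounded_bilinear b" "smooth_at f x" "smooth_at g x"
  shows "smooth_at (\<lambda>x. b (f x) (g x)) x"
proof -
  obtain U V where "open U" "x \<in> U" "smooth_on U f" "open V" "x \<in> V" "smooth_on V g"
    using assms unfolding smooth_at_def by auto
  then have "smooth_on (U \<inter> V) (\<lambda>x. b (f x) (g x))" "open (U \<inter> V)" "x \<in> U \<inter> V"
    unfolding smooth_on_def
    by (auto intro!: Ck_on_bilinear[OF assms(1)] intro: Ck_on_subset)
  then show ?thesis unfolding smooth_at_def by blast
qed

lemma smooth_at_add:
  assumes "smooth_at f x" "smooth_at g x"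
  shows "smooth_at (\<lambda>x. f x + g x) x"
proof -
  obtain U V where "open U" "x \<in> U" "smooth_on U f" "open V" "x \<in> V" "smooth_on V g"
    using assms unfolding smooth_at_def by auto
  then have "smooth_on (U \<inter> V) (\<lambda>x. f x + g x)" "open (U \<inter> V)" "x \<in> U \<inter> V"
    unfolding smooth_on_def
    by (auto intro!: Ck_on_add intro: Ck_on_subset)
  then show ?thesis unfolding smooth_at_def by blast
qed

lemma smooth_at_differentiable: "smooth_at f x \<Longrightarrow> f differentiable (at x)"
proof -
  assume "smooth_at f x"
  then obtain U where "x \<in> U" "Ck_on (Suc 0) U f" unfolding smooth_at_def smooth_on_def by blast
  then show ?thesis by simp
qed

lemma smooth_at_isCont: "smooth_at f x \<Longrightarrow> isCont f x"
  using smooth_at_differentiable differentiable_imp_continuous_within by blast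

lemma smooth_at_has_derivative:
  "smooth_at f x \<Longrightarrow> (f has_derivative fderiv f x) (at x)"
  using smooth_at_differentiable frechet_derivative_has_derivative by blast

lemma smooth_at_compose:
  fixes g :: "'b::euclidean_space \<Rightarrow> 'c::real_normed_vector"
  assumes "smooth_at f x" "smooth_at g (f x)"
  shows "smooth_at (\<lambda>x. g (f x)) x"
proof -
  obtain U V where U: "open U" "x \<in> U" "smooth_on U f" and V: "open V" "f x \<in> V" "smooth_on V g"
    using assms unfolding smooth_at_def by auto
  have "Ck_on 0 U f" using U(3) unfolding smooth_on_def by blast
  then have "continuous_on U f" by simp
  then have o: "open (f -` V \<inter> U)" using U V continuous_on_open_vimage by blast
  have "smooth_on (f -` V \<inter> U) (\<lambda>x. g (f x))"
    unfolding smooth_on_def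
  proof
    fix k
    have "Ck_on k U f" "Ck_on k V g" using U(3) V(3) unfolding smooth_on_def by blast+
    then show "Ck_on k (f -` V \<inter> U) (\<lambda>x. g (f x))"
      using Ck_on_compose[OF o V(1) _ Ck_on_subset[of k U f]] by auto
  qed
  then show ?thesis unfolding smooth_at_def using o U V by blast
qed

lemma smooth_at_sum:
  "(\<And>i. i \<in> I \<Longrightarrow> smooth_at (f i) x) \<Longrightarrow> smooth_at (\<lambda>x. \<Sum>i\<in>I. f i x) x"
  by (induction I rule: infinite_finite_induct) (auto intro: smooth_at_add)

lemma smooth_at_linear_comp:
  assumes "bounded_linear h" "smooth_at f x"
  shows "smooth_at (\<lambda>x. h (f x)) x"
proof -
  obtain U where U: "open U" "x \<in> U" "smooth_on U f" using assms(2) unfolding smooth_at_def by blast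
  then have "smooth_on U (\<lambda>x. h (f x))"
    unfolding smooth_on_def using Ck_on_bounded_linear_comp[OF assms(1)] by blast
  with U show ?thesis unfolding smooth_at_def by blast
qed

lemma smooth_at_Pair:
  assumes "smooth_at f x" "smooth_at g x"
  shows "smooth_at (\<lambda>x. (f x, g x)) x"
proof -
  have l: "bounded_linear (\<lambda>u. (u, 0))" "bounded_linear (\<lambda>u. (0, u))"
    by (intro bounded_linear_Pair bounded_linear_ident bounded_linear_zero)+
  have "smooth_at (\<lambda>x. (f x, 0) + (0, g x)) x"
    by (intro smooth_at_add smooth_at_linear_comp[OF l(1)] smooth_at_linear_comp[OF l(2)] assms)
  then show ?thesis by simp
qed

lemma smooth_at_derivative:
  assumes "smooth_at f x"
  shows "smooth_at (\<lambda>y. fderiv f y v) x"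
proof -
  obtain U where U: "open U" "x \<in> U" "smooth_on U f" using assms unfolding smooth_at_def by blast
  then have "Ck_on (Suc k) U f" for k unfolding smooth_on_def by blast
  then have "smooth_on U (\<lambda>y. fderiv f y v)"
    unfolding smooth_on_def by simp
  with U show ?thesis unfolding smooth_at_def by blast
qed

text \<open>
  \<open>Ck_on\<close> differentiates along constant directions only. Expanding the direction in the finite basis gives
  smoothness also when base point and direction move together.
\<close>

lemma smooth_at_derivative_joint:
  fixes f :: "'b::euclidean_space \<Rightarrow> 'c::real_normed_vector"
  assumes f: "smooth_at f (p a)" and p: "smooth_at p a" and v: "smooth_at v a"
  shows "smooth_at (\<lambda>a. fderiv f (p a) (v a)) a"
proof -
  have "filterlim p (nhds (p a)) (nhds a)"
    using smooth_at_isCont[OF p] by (simp add: continuous_at tendsto_nhds_iff)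
  then have ev: "\<forall>\<^sub>F y in nhds a. smooth_at f (p y)"
    using eventually_smooth_at[OF f] by (simp add: filterlim_iff)
  have "smooth_at (\<lambda>a. \<Sum>i\<in>Basis. (v a \<bullet> i) *\<^sub>R fderiv f (p a) i) a"
    by (intro smooth_at_sum smooth_at_bilinear[OF bounded_bilinear_scaleR]
        smooth_at_bilinear[OF bounded_bilinear_inner] v smooth_at_const
        smooth_at_compose[OF p] smooth_at_derivative f)
  then show ?thesis
    by (rule iffD1[OF smooth_at_cong, rotated])
       (use ev in eventually_elim,
        rule has_derivative_basis_expansion[symmetric],
        auto intro: linear_frechet_derivative smooth_at_differentiable)
qed

lemma
  fixes f :: "'a::euclidean_space \<Rightarrow> 'b::euclidean_space \<Rightarrow> 'c::real_normed_vector"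
  assumes "smooth_at (\<lambda>z. f (fst z) (snd z)) (x, y)"
  shows frechet_derivative_partial_snd:
      "fderiv (f x) y w = fderiv (\<lambda>z. f (fst z) (snd z)) (x, y) (0, w)"
    and frechet_derivative_partial_fst:
      "fderiv (\<lambda>x. f x y) x v = fderiv (\<lambda>z. f (fst z) (snd z)) (x, y) (v, 0)"
    and smooth_at_partial_snd: "smooth_at (f x) y"
    and smooth_at_partial_fst: "smooth_at (\<lambda>x. f x y) x"
proof -
  let ?F = "\<lambda>z. f (fst z) (snd z)"
  note D = smooth_at_has_derivative[OF assms]
  have 1: "(Pair x has_derivative (\<lambda>w. (0, w))) (at y)"
    by (auto intro!: derivative_eq_intros)
  have 2: "((\<lambda>x. (x, y)) has_derivative (\<lambda>v. (v, 0))) (at x)"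
    by (auto intro!: derivative_eq_intros)
  have "(f x has_derivative (\<lambda>w. fderiv ?F (x,y) (0, w))) (at y)"
    using diff_chain_at[OF 1, of ?F] D by (simp add: o_def)
  from frechet_derivative_eqI[OF this]
  show "fderiv (f x) y w = fderiv ?F (x, y) (0, w)" by simp
  have "((\<lambda>x. f x y) has_derivative (\<lambda>w. fderiv ?F (x,y) (w, 0))) (at x)"
    using diff_chain_at[OF 2, of ?F] D by (simp add: o_def)
  from frechet_derivative_eqI[OF this]
  show "fderiv (\<lambda>x. f x y) x v = fderiv ?F (x, y) (v, 0)" by simp
  show "smooth_at (f x) y"
    using smooth_at_compose[of "Pair x" y ?F] assms by (simp add: smooth_at_Pair)
  show "smooth_at (\<lambda>x. f x y) x"
    using smooth_at_compose[of "\<lambda>x. (x, y)" x ?F] assms by (simp add: smooth_at_Pair)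
qed

text \<open>
  The second difference \<open>F(x + tu + tv) - F(x + tu) - F(x + tv) + F(x)\<close> is symmetric in \<open>u\<close> and \<open>v\<close>,
  and two applications of the mean value theorem express it by a mixed second derivative.
\<close>

lemma second_difference_mean_value:
  fixes F :: "'a::real_normed_vector \<Rightarrow> real"
  assumes t: "t > 0"
    and F: "\<And>s r. 0 \<le> s \<Longrightarrow> s \<le> t \<Longrightarrow> 0 \<le> r \<Longrightarrow> r \<le> t \<Longrightarrow> smooth_at F (x + s *\<^sub>R u + r *\<^sub>R v)"
  obtains s r where "0 \<le> s" "s \<le> t" "0 \<le> r" "r \<le> t"
    "F (x + t *\<^sub>R u + t *\<^sub>R v) - F (x + t *\<^sub>R u) - F (x + t *\<^sub>R v) + F x =
      t * (t * fderiv (\<lambda>y. fderiv F y u) (x + s *\<^sub>R u + r *\<^sub>R v) v)"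
proof -
  let ?Fu = "\<lambda>y. fderiv F y u"
  let ?g = "\<lambda>s. F (x + s *\<^sub>R u + t *\<^sub>R v) - F (x + s *\<^sub>R u)"
  have 1: "((\<lambda>s. F (x + s *\<^sub>R u + r *\<^sub>R v)) has_real_derivative ?Fu (x + s *\<^sub>R u + r *\<^sub>R v)) (at s)"
    if "0 \<le> s" "s \<le> t" "0 \<le> r" "r \<le> t" for s r
  proof -
    have a: "((\<lambda>s. x + s *\<^sub>R u + r *\<^sub>R v) has_derivative (\<lambda>h. h *\<^sub>R u)) (at s)"
      using has_derivative_add[OF has_derivative_add[OF has_derivative_const has_derivative_scaleR_left[OF has_derivative_ident]] has_derivative_const]
      by simp
    have "((\<lambda>s. F (x + s *\<^sub>R u + r *\<^sub>R v)) has_derivative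
        (\<lambda>h. fderiv F (x + s *\<^sub>R u + r *\<^sub>R v) (h *\<^sub>R u))) (at s)"
      using diff_chain_at[OF a smooth_at_has_derivative[OF F[OF that]]] by (simp add: o_def)
    moreover have "fderiv F (x + s *\<^sub>R u + r *\<^sub>R v) (h *\<^sub>R u) = ?Fu (x + s *\<^sub>R u + r *\<^sub>R v) * h" for h
      using linear_cmul[OF linear_frechet_derivative[OF smooth_at_differentiable[OF F[OF that]]]] by simp
    ultimately show ?thesis by (simp add: has_field_derivative_def)
  qed
  have 2: "((\<lambda>r. ?Fu (x + s *\<^sub>R u + r *\<^sub>R v)) has_real_derivative
      fderiv ?Fu (x + s *\<^sub>R u + r *\<^sub>R v) v) (at r)"
    if "0 \<le> s" "s \<le> t" "0 \<le> r" "r \<le> t" for s r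
  proof -
    note smooth_fun_at = smooth_at_derivative[OF F[OF that], of u]
    have a: "((\<lambda>r. x + s *\<^sub>R u + r *\<^sub>R v) has_derivative (\<lambda>h. h *\<^sub>R v)) (at r)"
      using has_derivative_add[OF has_derivative_const has_derivative_scaleR_left[OF has_derivative_ident]]
      by simp
    have "((\<lambda>r. ?Fu (x + s *\<^sub>R u + r *\<^sub>R v)) has_derivative
        (\<lambda>h. fderiv ?Fu (x + s *\<^sub>R u + r *\<^sub>R v) (h *\<^sub>R v))) (at r)"
      using diff_chain_at[OF a smooth_at_has_derivative[OF smooth_fun_at]] by (simp add: o_def)
    moreover have "fderiv ?Fu (x + s *\<^sub>R u + r *\<^sub>R v) (h *\<^sub>R v) =
        fderiv ?Fu (x + s *\<^sub>R u + r *\<^sub>R v) v * h" for h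
      using linear_cmul[OF linear_frechet_derivative[OF smooth_at_differentiable[OF smooth_fun_at]]] by simp
    ultimately show ?thesis by (simp add: has_field_derivative_def)
  qed
  have "\<exists>s. 0 < s \<and> s < t \<and> ?g t - ?g 0 =
      (t - 0) * (?Fu (x + s *\<^sub>R u + t *\<^sub>R v) - ?Fu (x + s *\<^sub>R u))"
    by (rule MVT2[OF t]) (use 1[of _ t] 1[of _ 0] t in \<open>auto intro!: DERIV_diff\<close>)
  then obtain s where s: "0 < s" "s < t" "?g t - ?g 0 = t * (?Fu (x + s *\<^sub>R u + t *\<^sub>R v) - ?Fu (x + s *\<^sub>R u))"
    by auto
  have "\<exists>r. 0 < r \<and> r < t \<and> ?Fu (x + s *\<^sub>R u + t *\<^sub>R v) - ?Fu (x + s *\<^sub>R u + 0 *\<^sub>R v) =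
      (t - 0) * fderiv ?Fu (x + s *\<^sub>R u + r *\<^sub>R v) v"
    by (rule MVT2[OF t]) (use 2[of s] s in auto)
  then obtain r where r: "0 < r" "r < t" "?Fu (x + s *\<^sub>R u + t *\<^sub>R v) - ?Fu (x + s *\<^sub>R u) =
      t * fderiv ?Fu (x + s *\<^sub>R u + r *\<^sub>R v) v"
    by auto
  show ?thesis
    by (rule that[of s r]) (use s r in auto)
qed

text \<open>
  If the two mixed derivatives differed at \<open>x\<close>, continuity would keep their values apart on a ball; but the
  mean values of the symmetric second difference are equal and are attained in that ball.
\<close>

lemma symmetric_second_derivative_real:
  fixes F :: "'a::real_normed_vector \<Rightarrow> real"
  assumes "smooth_at F x"
  shows "fderiv (\<lambda>y. fderiv F y u) x v =
    fderiv (\<lambda>y. fderiv F y v) x u"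
proof (rule ccontr)
  define D where "D u v y = fderiv (\<lambda>y. fderiv F y u) y v" for u v y
  assume "\<not> ?thesis"
  then have ne: "D u v x \<noteq> D v u x" by (simp add: D_def)
  have "smooth_at (D u v) x" "smooth_at (D v u) x"
    unfolding D_def by (intro smooth_at_derivative assms)+
  then have lim: "(D u v \<longlongrightarrow> D u v x) (nhds x)" "(D v u \<longlongrightarrow> D v u x) (nhds x)"
    using smooth_at_isCont by (auto simp: continuous_at tendsto_nhds_iff)
  define e where "e = dist (D u v x) (D v u x) / 2"
  have "e > 0" using ne by (simp add: e_def)
  then have "\<forall>\<^sub>F y in nhds x. smooth_at F y \<and> dist (D u v y) (D u v x) < e \<and> dist (D v u y) (D v u x) < e"
    using lim by (intro eventually_conj eventually_smooth_at assms tendstoD)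
  then obtain d where d: "d > 0" and
    dd: "\<And>y. dist y x < d \<Longrightarrow> smooth_at F y \<and> dist (D u v y) (D u v x) < e \<and> dist (D v u y) (D v u x) < e"
    unfolding eventually_nhds_metric by auto
  (* so small that the parallelogram spanned by t u and t v stays in the ball of radius d *)
  define t where "t = d / (2 * (norm u + norm v + 1))"
  have n: "norm u + norm v + 1 > 0" by (smt (verit) norm_ge_zero)
  have t: "t > 0" using d n by (simp add: t_def)
  have tn: "t * (norm u + norm v) < d"
  proof -
    have "t * (norm u + norm v + 1) = d / 2" using n by (simp add: t_def field_simps)
    then show ?thesis using d t by (simp add: algebra_simps)
  qed
  have near: "dist (x + s *\<^sub>R u + r *\<^sub>R v) x < d" if "0 \<le> s" "s \<le> t" "0 \<le> r" "r \<le> t" for s r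
  proof -
    have "dist (x + s *\<^sub>R u + r *\<^sub>R v) x = norm (s *\<^sub>R u + r *\<^sub>R v)" by (simp add: dist_norm)
    also have "\<dots> \<le> s * norm u + r * norm v"
      using norm_triangle_ineq[of "s *\<^sub>R u" "r *\<^sub>R v"] that by simp
    also have "\<dots> \<le> t * (norm u + norm v)"
      using that by (simp add: distrib_left add_mono mult_right_mono)
    finally show ?thesis using tn by simp
  qed
  have near': "dist (x + s *\<^sub>R v + r *\<^sub>R u) x < d" if "0 \<le> s" "s \<le> t" "0 \<le> r" "r \<le> t" for s r
    using near[of r s] that by (simp add: ac_simps)
  obtain s r where 1: "0 \<le> s" "s \<le> t" "0 \<le> r" "r \<le> t"
    "F (x + t *\<^sub>R u + t *\<^sub>R v) - F (x + t *\<^sub>R u) - F (x + t *\<^sub>R v) + F x =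
      t * (t * D u v (x + s *\<^sub>R u + r *\<^sub>R v))"
    using second_difference_mean_value[OF t, of F x u v] dd near unfolding D_def by blast
  obtain s' r' where 2: "0 \<le> s'" "s' \<le> t" "0 \<le> r'" "r' \<le> t"
    "F (x + t *\<^sub>R v + t *\<^sub>R u) - F (x + t *\<^sub>R v) - F (x + t *\<^sub>R u) + F x =
      t * (t * D v u (x + s' *\<^sub>R v + r' *\<^sub>R u))"
    using second_difference_mean_value[OF t, of F x v u] dd near' unfolding D_def by blast
  have "x + t *\<^sub>R v + t *\<^sub>R u = x + t *\<^sub>R u + t *\<^sub>R v" by (simp add: ac_simps)
  with 1(5) 2(5) have "t * (t * D u v (x + s *\<^sub>R u + r *\<^sub>R v)) = t * (t * D v u (x + s' *\<^sub>R v + r' *\<^sub>R u))"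
    by (smt (verit))
  then have eq: "D u v (x + s *\<^sub>R u + r *\<^sub>R v) = D v u (x + s' *\<^sub>R v + r' *\<^sub>R u)" using t by simp
  have "dist (D u v x) (D v u x) < e + e"
    using dd[OF near[OF 1(1-4)]] dd[OF near'[OF 2(1-4)]] eq
    by (metis dist_commute dist_triangle_less_add)
  then show False by (simp add: e_def)
qed

lemma frechet_derivative_linear_comp:
  assumes "bounded_linear h" "f differentiable (at x)"
  shows "fderiv (\<lambda>x. h (f x)) x = (\<lambda>v. h (fderiv f x v))"
  by (rule frechet_derivative_eqI)
     (rule bounded_linear.has_derivative[OF assms(1) frechet_derivative_has_derivative[OF assms(2)]])

lemma frechet_derivative_cong:
  assumes "\<forall>\<^sub>F y in nhds x. f y = g y"
  shows "fderiv f x = fderiv g x"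
proof -
  have ev: "\<forall>\<^sub>F y in at x. f y = g y" and x: "f x = g x"
    using assms by (auto simp: eventually_nhds_conv_at)
  have "(f has_derivative D) (at x) \<longleftrightarrow> (g has_derivative D) (at x)" for D
    using has_derivative_transform_eventually[of f D x UNIV g]
      has_derivative_transform_eventually[of g D x UNIV f] ev x by (auto simp: eq_commute)
  then show ?thesis unfolding frechet_derivative_def by simp
qed

lemma symmetric_second_derivative:
  fixes F :: "'a::real_normed_vector \<Rightarrow> 'b::euclidean_space"
  assumes F: "smooth_at F x"
  shows "fderiv (\<lambda>y. fderiv F y u) x v =
    fderiv (\<lambda>y. fderiv F y v) x u"
proof (rule euclidean_eqI)
  fix i :: 'b
  have il: "bounded_linear (\<lambda>z. z \<bullet> i)" by (rule bounded_linear_inner_left)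
  let ?Fi = "\<lambda>y. F y \<bullet> i"
  have "fderiv (\<lambda>y. fderiv ?Fi y u) x v =
    fderiv (\<lambda>y. fderiv F y u) x v \<bullet> i" for u v
  proof -
    have "\<forall>\<^sub>F y in nhds x. fderiv ?Fi y u = fderiv F y u \<bullet> i"
      using eventually_smooth_at[OF F]
      by eventually_elim (simp add: frechet_derivative_linear_comp[OF il smooth_at_differentiable])
    then show ?thesis
      by (simp add: frechet_derivative_cong frechet_derivative_linear_comp[OF il]
          smooth_at_differentiable[OF smooth_at_derivative[OF F]])
  qed
  then show "fderiv (\<lambda>y. fderiv F y u) x v \<bullet> i =
    fderiv (\<lambda>y. fderiv F y v) x u \<bullet> i"
    using symmetric_second_derivative_real[OF smooth_at_linear_comp[OF il F], of u v] by simp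
qed

section \<open>Smooth functions on manifolds, point by point\<close>

text \<open>
  The part of \<open>smooth_manifold\<close> on which the differential calculus rests. It passes to products without
  a topological argument.
\<close>

definition atlas :: "('a, 'e::euclidean_space) chart set \<Rightarrow> bool" where
  "atlas A \<longleftrightarrow>
     (\<forall>c\<in>A. inj_on (snd c) (fst c) \<and> open (snd c ` fst c)) \<and>
     (\<forall>c\<in>A. \<forall>d\<in>A. open (snd c ` (fst c \<inter> fst d)) \<and>
        smooth_on (snd c ` (fst c \<inter> fst d)) (snd d \<circ> chart_inv c))"

lemma smooth_manifold_iff_atlas:
  "smooth_manifold A \<longleftrightarrow> atlas A \<and> Hausdorff_space (mtopology A) \<and> second_countable (mtopology A)"
  unfolding smooth_manifold_def atlas_def by blast

lemma charts_atD: "c \<in> charts_at A p \<Longrightarrow> c \<in> A" "c \<in> charts_at A p \<Longrightarrow> p \<in> fst c"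
  "c \<in> charts_at A p \<Longrightarrow> p \<in> mcarrier A"
  by (auto simp: charts_at_def mcarrier_def)

lemma charts_atI: "c \<in> A \<Longrightarrow> p \<in> fst c \<Longrightarrow> c \<in> charts_at A p"
  by (simp add: charts_at_def)

lemma chart_at_in: "p \<in> mcarrier A \<Longrightarrow> chart_at A p \<in> charts_at A p"
  unfolding chart_at_def by (rule someI_ex) (auto simp: charts_at_def mcarrier_def)

lemma chart_inv_snd: "atlas A \<Longrightarrow> c \<in> A \<Longrightarrow> p \<in> fst c \<Longrightarrow> chart_inv c (snd c p) = p"
  unfolding chart_inv_def atlas_def by auto

lemma chart_inv_snd_at: "atlas A \<Longrightarrow> c \<in> charts_at A p \<Longrightarrow> chart_inv c (snd c p) = p"
  by (erule chart_inv_snd[OF _ charts_atD(1) charts_atD(2)])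

lemma snd_chart_inv: "x \<in> snd c ` fst c \<Longrightarrow> snd c (chart_inv c x) = x"
  unfolding chart_inv_def by (rule f_inv_into_f)

lemma chart_inv_mem: "x \<in> snd c ` fst c \<Longrightarrow> chart_inv c x \<in> fst c"
  unfolding chart_inv_def by (rule inv_into_into)

lemma eventually_in_charts:
  assumes "atlas A" "c \<in> charts_at A p" "d \<in> charts_at A p"
  shows "\<forall>\<^sub>F x in nhds (snd c p). x \<in> snd c ` fst c \<and> chart_inv c x \<in> fst c \<and> chart_inv c x \<in> fst d \<and>
    snd c (chart_inv c x) = x"
proof -
  have "\<forall>\<^sub>F x in nhds (snd c p). x \<in> snd c ` (fst c \<inter> fst d)"
    using assms by (intro eventually_nhds_in_open) (auto simp: atlas_def charts_at_def)
  then show ?thesis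
  proof eventually_elim
    case (elim x)
    then obtain q where q: "q \<in> fst c" "q \<in> fst d" "x = snd c q" by auto
    then have "chart_inv c x = q" using chart_inv_snd[OF assms(1)] charts_atD(1)[OF assms(2)] by auto
    with q show ?case by auto
  qed
qed

lemma smooth_at_transition:
  assumes "atlas A" "c \<in> charts_at A p" "d \<in> charts_at A p"
  shows "smooth_at (\<lambda>x. snd d (chart_inv c x)) (snd c p)"
proof -
  have "open (snd c ` (fst c \<inter> fst d))" "smooth_on (snd c ` (fst c \<inter> fst d)) (snd d \<circ> chart_inv c)"
    "snd c p \<in> snd c ` (fst c \<inter> fst d)"
    using assms by (auto simp: atlas_def charts_at_def)
  then show ?thesis by (auto simp: smooth_on_iff_smooth_at o_def)
qed

lemma smooth_at_tendsto: "smooth_at f x \<Longrightarrow> filterlim f (nhds (f x)) (nhds x)"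
  using smooth_at_isCont by (simp add: continuous_at tendsto_nhds_iff)

text \<open>The neighbourhood filter of a point, seen through a chart; any chart gives the same filter.\<close>

definition mnhds :: "('a, 'e::euclidean_space) chart set \<Rightarrow> 'a \<Rightarrow> 'a filter" where
  "mnhds A p = filtermap (chart_inv (chart_at A p)) (nhds (snd (chart_at A p) p))"

lemma mnhds_chart:
  assumes A: "atlas A" and c: "c \<in> charts_at A p"
  shows "mnhds A p = filtermap (chart_inv c) (nhds (snd c p))"
proof -
  have *: "eventually P (filtermap (chart_inv c) (nhds (snd c p)))"
    if c: "c \<in> charts_at A p" and d: "d \<in> charts_at A p"
      and P: "eventually P (filtermap (chart_inv d) (nhds (snd d p)))" for c d P
  proof -
    have p: "chart_inv c (snd c p) = p" by (rule chart_inv_snd_at[OF A c])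
    have "filterlim (\<lambda>x. snd d (chart_inv c x)) (nhds (snd d p)) (nhds (snd c p))"
      using smooth_at_tendsto[OF smooth_at_transition[OF A c d]] by (simp add: p)
    moreover have "\<forall>\<^sub>F y in nhds (snd d p). P (chart_inv d y)"
      using P by (simp add: eventually_filtermap)
    ultimately have "\<forall>\<^sub>F x in nhds (snd c p). P (chart_inv d (snd d (chart_inv c x)))"
      by (rule eventually_compose_filterlim[rotated])
    with eventually_in_charts[OF A c d] have "\<forall>\<^sub>F x in nhds (snd c p). P (chart_inv c x)"
      by eventually_elim (use chart_inv_snd[OF A charts_atD(1)[OF d]] in auto)
    then show ?thesis by (simp add: eventually_filtermap)
  qed
  have "chart_at A p \<in> charts_at A p" by (rule chart_at_in[OF charts_atD(3)[OF c]])
  with *[OF this c] *[OF c this] show ?thesis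
    unfolding mnhds_def filter_eq_iff by blast
qed

lemma eventually_mnhds_chart:
  assumes "atlas A" "c \<in> charts_at A p"
  shows "eventually P (mnhds A p) \<longleftrightarrow> (\<forall>\<^sub>F x in nhds (snd c p). P (chart_inv c x))"
  by (simp add: mnhds_chart[OF assms] eventually_filtermap)

lemma eventually_mnhds_self:
  assumes A: "atlas A" and p: "p \<in> mcarrier A" and P: "eventually P (mnhds A p)"
  shows "P p"
proof -
  note c = chart_at_in[OF p]
  have "P (chart_inv (chart_at A p) (snd (chart_at A p) p))"
    using P unfolding eventually_mnhds_chart[OF A c] by (rule eventually_nhds_x_imp_x)
  then show ?thesis using chart_inv_snd[OF A] charts_atD[OF c] by simp
qed

lemma eventually_mnhds_in_chart:
  assumes A: "atlas A" and c: "c \<in> charts_at A p"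
  shows "\<forall>\<^sub>F q in mnhds A p. c \<in> charts_at A q"
  unfolding eventually_mnhds_chart[OF A c]
  using eventually_in_charts[OF A c c] by eventually_elim (use c in \<open>auto simp: charts_at_def\<close>)

lemma eventually_mnhds_mcarrier:
  assumes A: "atlas A" and p: "p \<in> mcarrier A"
  shows "\<forall>\<^sub>F q in mnhds A p. q \<in> mcarrier A"
  using eventually_mnhds_in_chart[OF A chart_at_in[OF p]] by eventually_elim (rule charts_atD(3))

text \<open>
  Functions into a vector space are treated separately from maps between manifolds: they can be added,
  multiplied and differentiated, and require no chart of the target.
\<close>

definition smooth_fun_at :: "('a, 'e::euclidean_space) chart set \<Rightarrow> ('a \<Rightarrow> 'v::real_normed_vector) \<Rightarrow> 'a \<Rightarrow> bool" where
  "smooth_fun_at A f p \<longleftrightarrow> p \<in> mcarrier A \<and> smooth_at (\<lambda>x. f (chart_inv (chart_at A p) x)) (snd (chart_at A p) p)"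

lemma smooth_fun_at_mcarrier: "smooth_fun_at A f p \<Longrightarrow> p \<in> mcarrier A"
  by (simp add: smooth_fun_at_def)

lemma smooth_fun_at_chart:
  assumes A: "atlas A" and c: "c \<in> charts_at A p"
  shows "smooth_fun_at A f p \<longleftrightarrow> smooth_at (\<lambda>x. f (chart_inv c x)) (snd c p)"
proof -
  have *: "smooth_at (\<lambda>x. f (chart_inv c x)) (snd c p)"
    if c: "c \<in> charts_at A p" and d: "d \<in> charts_at A p"
      and P: "smooth_at (\<lambda>x. f (chart_inv d x)) (snd d p)" for c d
  proof -
    have p: "chart_inv c (snd c p) = p" by (rule chart_inv_snd_at[OF A c])
    have "smooth_at (\<lambda>x. f (chart_inv d (snd d (chart_inv c x)))) (snd c p)"
      by (rule smooth_at_compose[OF smooth_at_transition[OF A c d], of "\<lambda>x. f (chart_inv d x)"])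
         (use P in \<open>simp add: p\<close>)
    then show ?thesis
      by (rule iffD1[OF smooth_at_cong, rotated])
         (use eventually_in_charts[OF A c d] in eventually_elim,
          use chart_inv_snd[OF A charts_atD(1)[OF d]] in auto)
  qed
  have "p \<in> mcarrier A" using charts_atD(3)[OF c] .
  with *[OF chart_at_in[OF this] c] *[OF c chart_at_in[OF this]] show ?thesis
    unfolding smooth_fun_at_def by blast
qed

lemma smooth_fun_at_cong:
  assumes A: "atlas A" and "\<forall>\<^sub>F q in mnhds A p. f q = g q"
  shows "smooth_fun_at A f p \<longleftrightarrow> smooth_fun_at A g p"
proof (cases "p \<in> mcarrier A")
  case True
  then show ?thesis
    using assms(2) unfolding smooth_fun_at_chart[OF A chart_at_in[OF True]] eventually_mnhds_chart[OF A chart_at_in[OF True]]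
    by (intro smooth_at_cong) simp
qed (simp add: smooth_fun_at_def)

lemma smooth_fun_at_transform:
  "atlas A \<Longrightarrow> smooth_fun_at A f p \<Longrightarrow> \<forall>\<^sub>F q in mnhds A p. f q = g q \<Longrightarrow> smooth_fun_at A g p"
  by (rule smooth_fun_at_cong[THEN iffD1])

lemma eventually_smooth_fun_at:
  assumes A: "atlas A" and f: "smooth_fun_at A f p"
  shows "\<forall>\<^sub>F q in mnhds A p. smooth_fun_at A f q"
proof -
  have c: "chart_at A p \<in> charts_at A p" by (rule chart_at_in[OF smooth_fun_at_mcarrier[OF f]])
  let ?c = "chart_at A p"
  have "\<forall>\<^sub>F x in nhds (snd ?c p). smooth_at (\<lambda>x. f (chart_inv ?c x)) x"
    by (rule eventually_smooth_at) (use f in \<open>simp add: smooth_fun_at_def\<close>)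
  with eventually_in_charts[OF A c c] show ?thesis
    unfolding eventually_mnhds_chart[OF A c]
  proof eventually_elim
    case (elim x)
    have "?c \<in> charts_at A (chart_inv ?c x)" using elim charts_atD(1)[OF c] by (simp add: charts_at_def)
    from smooth_fun_at_chart[OF A this, of f] show ?case using elim by simp
  qed
qed

lemma smooth_fun_at_const: "p \<in> mcarrier A \<Longrightarrow> smooth_fun_at A (\<lambda>q. k) p"
  by (simp add: smooth_fun_at_def)

lemma smooth_fun_at_bilinear: "bounded_bilinear b \<Longrightarrow> smooth_fun_at A f p \<Longrightarrow> smooth_fun_at A g p \<Longrightarrow> smooth_fun_at A (\<lambda>q. b (f q) (g q)) p"
  unfolding smooth_fun_at_def by (auto intro: smooth_at_bilinear)

lemma smooth_fun_at_add: "smooth_fun_at A f p \<Longrightarrow> smooth_fun_at A g p \<Longrightarrow> smooth_fun_at A (\<lambda>q. f q + g q) p"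
  unfolding smooth_fun_at_def by (auto intro: smooth_at_add)

lemma smooth_fun_at_linear: "bounded_linear h \<Longrightarrow> smooth_fun_at A f p \<Longrightarrow> smooth_fun_at A (\<lambda>q. h (f q)) p"
  unfolding smooth_fun_at_def by (auto intro: smooth_at_linear_comp)

lemma smooth_fun_at_Pair: "smooth_fun_at A f p \<Longrightarrow> smooth_fun_at A g p \<Longrightarrow> smooth_fun_at A (\<lambda>q. (f q, g q)) p"
  unfolding smooth_fun_at_def by (auto intro: smooth_at_Pair)

lemma smooth_fun_at_sum: "p \<in> mcarrier A \<Longrightarrow> (\<And>i. i \<in> I \<Longrightarrow> smooth_fun_at A (f i) p) \<Longrightarrow> smooth_fun_at A (\<lambda>q. \<Sum>i\<in>I. f i q) p"
  unfolding smooth_fun_at_def by (auto intro: smooth_at_sum)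

lemma smooth_fun_at_coord:
  assumes A: "atlas A" and c: "c \<in> charts_at A p"
  shows "smooth_fun_at A (snd c) p"
  unfolding smooth_fun_at_chart[OF A c] by (rule smooth_at_transition[OF A c c])

lemma smooth_fun_iff:
  assumes A: "atlas A"
  shows "smooth_fun A f \<longleftrightarrow> (\<forall>p\<in>mcarrier A. smooth_fun_at A f p)"
  unfolding smooth_fun_def
proof (intro iffI ballI)
  fix p assume *: "\<forall>c\<in>A. smooth_on (snd c ` fst c) (f \<circ> chart_inv c)" and p: "p \<in> mcarrier A"
  note c = chart_at_in[OF p]
  from * charts_atD(1)[OF c] have "smooth_on (snd (chart_at A p) ` fst (chart_at A p)) (f \<circ> chart_inv (chart_at A p))" by blast
  moreover have "open (snd (chart_at A p) ` fst (chart_at A p))"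
    using A charts_atD(1)[OF c] by (simp add: atlas_def)
  ultimately show "smooth_fun_at A f p"
    unfolding smooth_fun_at_chart[OF A c] using charts_atD(2)[OF c] by (simp add: smooth_on_iff_smooth_at o_def)
next
  fix c assume *: "\<forall>p\<in>mcarrier A. smooth_fun_at A f p" and c: "c \<in> A"
  have o: "open (snd c ` fst c)" using A c by (simp add: atlas_def)
  show "smooth_on (snd c ` fst c) (f \<circ> chart_inv c)"
    unfolding smooth_on_iff_smooth_at[OF o]
  proof
    fix x assume "x \<in> snd c ` fst c"
    then obtain p where p: "p \<in> fst c" "x = snd c p" by auto
    then have "c \<in> charts_at A p" using c by (simp add: charts_at_def)
    then show "smooth_at (f \<circ> chart_inv c) x"
      using * smooth_fun_at_chart[OF A, of c p f] charts_atD(3)[of c A p] p by (auto simp: o_def)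
  qed
qed

text \<open>
  The filter condition is the continuity of \<open>F\<close> at \<open>p\<close>: near \<open>p\<close>, the values of \<open>F\<close> stay in the
  domain of the chart.
\<close>

definition smooth_map_at ::
  "('a, 'e::euclidean_space) chart set \<Rightarrow> ('b, 'f::euclidean_space) chart set \<Rightarrow> ('a \<Rightarrow> 'b) \<Rightarrow> 'a \<Rightarrow> bool" where
  "smooth_map_at A B F p \<longleftrightarrow> F p \<in> mcarrier B \<and> filterlim F (mnhds B (F p)) (mnhds A p) \<and>
     smooth_fun_at A (\<lambda>q. snd (chart_at B (F p)) (F q)) p"

lemma smooth_map_at_mcarrier: "smooth_map_at A B F p \<Longrightarrow> p \<in> mcarrier A" "smooth_map_at A B F p \<Longrightarrow> F p \<in> mcarrier B"
  by (auto simp: smooth_map_at_def smooth_fun_at_def)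

lemma smooth_fun_at_comp:
  assumes A: "atlas A" and B: "atlas B" and f: "smooth_fun_at B f (F p)" and F: "smooth_map_at A B F p"
  shows "smooth_fun_at A (\<lambda>q. f (F q)) p"
proof -
  let ?d = "chart_at B (F p)" and ?c = "chart_at A p"
  have d: "?d \<in> charts_at B (F p)" and c: "?c \<in> charts_at A p"
    by (intro chart_at_in smooth_map_at_mcarrier[OF F])+
  have p: "chart_inv ?c (snd ?c p) = p" by (rule chart_inv_snd_at[OF A c])
  have "smooth_at (\<lambda>x. snd ?d (F (chart_inv ?c x))) (snd ?c p)"
    by (rule smooth_fun_at_chart[OF A c, THEN iffD1]) (use F in \<open>simp add: smooth_map_at_def\<close>)
  then have "smooth_at (\<lambda>x. f (chart_inv ?d (snd ?d (F (chart_inv ?c x))))) (snd ?c p)"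
    by (rule smooth_at_compose[of _ _ "\<lambda>y. f (chart_inv ?d y)"])
       (use f smooth_fun_at_chart[OF B d, of f] in \<open>simp add: p\<close>)
  then have 1: "smooth_fun_at A (\<lambda>q. f (chart_inv ?d (snd ?d (F q)))) p"
    by (simp add: smooth_fun_at_chart[OF A c])
  have "\<forall>\<^sub>F q in mnhds A p. ?d \<in> charts_at B (F q)"
    by (rule eventually_compose_filterlim[OF eventually_mnhds_in_chart[OF B d]]) (use F in \<open>simp add: smooth_map_at_def\<close>)
  then have "\<forall>\<^sub>F q in mnhds A p. f (chart_inv ?d (snd ?d (F q))) = f (F q)"
    by eventually_elim (simp add: chart_inv_snd_at[OF B])
  from smooth_fun_at_transform[OF A 1 this] show ?thesis .
qed

text \<open>
  A single chart of the target whose domain \<open>F\<close> enters is enough. Continuity follows since the chart is a local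
  homeomorphism, and the smoothness in other charts follows by a transition map.
\<close>

lemma smooth_map_atI:
  assumes A: "atlas A" and B: "atlas B" and d: "d \<in> charts_at B (F p)"
    and ev: "\<forall>\<^sub>F q in mnhds A p. F q \<in> fst d" and s: "smooth_fun_at A (\<lambda>q. snd d (F q)) p"
  shows "smooth_map_at A B F p"
proof -
  let ?c = "chart_at A p" and ?e = "chart_at B (F p)"
  have c: "?c \<in> charts_at A p" by (rule chart_at_in[OF smooth_fun_at_mcarrier[OF s]])
  have e: "?e \<in> charts_at B (F p)" by (rule chart_at_in[OF charts_atD(3)[OF d]])
  have p: "chart_inv ?c (snd ?c p) = p" by (rule chart_inv_snd_at[OF A c])
  have sc: "smooth_at (\<lambda>x. snd d (F (chart_inv ?c x))) (snd ?c p)"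
    by (rule smooth_fun_at_chart[OF A c, THEN iffD1, OF s])
  have ev': "\<forall>\<^sub>F x in nhds (snd ?c p). F (chart_inv ?c x) \<in> fst d"
    using ev by (simp add: eventually_mnhds_chart[OF A c])
  have "filterlim F (mnhds B (F p)) (mnhds A p)"
    unfolding filterlim_iff
  proof (intro allI impI)
    fix P assume "eventually P (mnhds B (F p))"
    then have "\<forall>\<^sub>F y in nhds (snd d (F p)). P (chart_inv d y)"
      by (simp add: eventually_mnhds_chart[OF B d])
    then have "\<forall>\<^sub>F x in nhds (snd ?c p). P (chart_inv d (snd d (F (chart_inv ?c x))))"
      using eventually_compose_filterlim[OF _ smooth_at_tendsto[OF sc], of "\<lambda>y. P (chart_inv d y)"] by (simp add: p)
    with ev' show "\<forall>\<^sub>F q in mnhds A p. P (F q)"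
      unfolding eventually_mnhds_chart[OF A c]
      by eventually_elim (use chart_inv_snd[OF B charts_atD(1)[OF d]] in simp)
  qed
  moreover have "smooth_fun_at A (\<lambda>q. snd ?e (F q)) p"
  proof -
    have "smooth_at (\<lambda>x. snd ?e (chart_inv d (snd d (F (chart_inv ?c x))))) (snd ?c p)"
      using smooth_at_compose[OF sc, of "\<lambda>y. snd ?e (chart_inv d y)"] smooth_at_transition[OF B d e]
      by (simp add: p)
    then have 1: "smooth_fun_at A (\<lambda>q. snd ?e (chart_inv d (snd d (F q)))) p" by (simp add: smooth_fun_at_chart[OF A c])
    have "\<forall>\<^sub>F q in mnhds A p. snd ?e (chart_inv d (snd d (F q))) = snd ?e (F q)"
      using ev by eventually_elim (use chart_inv_snd[OF B charts_atD(1)[OF d]] in simp)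
    from smooth_fun_at_transform[OF A 1 this] show ?thesis .
  qed
  ultimately show ?thesis using charts_atD(3)[OF d] by (simp add: smooth_map_at_def)
qed

lemma eventually_smooth_map_at:
  "smooth_map_at A B F p \<Longrightarrow> eventually P (mnhds B (F p)) \<Longrightarrow> \<forall>\<^sub>F q in mnhds A p. P (F q)"
  unfolding smooth_map_at_def using eventually_compose_filterlim[of P "mnhds B (F p)" F "mnhds A p"] by simp

lemma smooth_map_at_compose:
  assumes A: "atlas A" and B: "atlas B" and C: "atlas C" and F: "smooth_map_at A B F p" and G: "smooth_map_at B C G (F p)"
  shows "smooth_map_at A C (\<lambda>q. G (F q)) p"
proof -
  let ?e = "chart_at C (G (F p))"
  have e: "?e \<in> charts_at C (G (F p))" by (rule chart_at_in[OF smooth_map_at_mcarrier(2)[OF G]])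
  show ?thesis
  proof (rule smooth_map_atI[OF A C, where d = ?e])
    show "?e \<in> charts_at C (G (F p))" by (rule e)
    show "\<forall>\<^sub>F q in mnhds A p. G (F q) \<in> fst ?e"
      using eventually_smooth_map_at[OF F eventually_smooth_map_at[OF G eventually_mnhds_in_chart[OF C e]]]
      by eventually_elim (rule charts_atD(2))
    show "smooth_fun_at A (\<lambda>q. snd ?e (G (F q))) p"
      by (rule smooth_fun_at_comp[OF A B _ F]) (use G in \<open>simp add: smooth_map_at_def\<close>)
  qed
qed

lemma smooth_map_at_cong:
  assumes A: "atlas A" and "\<forall>\<^sub>F q in mnhds A p. F q = G q" and p: "p \<in> mcarrier A"
  shows "smooth_map_at A B F p \<longleftrightarrow> smooth_map_at A B G p"
proof -
  have "F p = G p" using eventually_mnhds_self[OF A p assms(2)] .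
  moreover have "filterlim F X (mnhds A p) \<longleftrightarrow> filterlim G X (mnhds A p)" for X
    by (rule filterlim_cong) (use assms in auto)
  moreover have "smooth_fun_at A (\<lambda>q. h (F q)) p \<longleftrightarrow> smooth_fun_at A (\<lambda>q. h (G q)) p" for h :: "_ \<Rightarrow> 'd"
    by (rule smooth_fun_at_cong[OF A]) (use assms(2) in \<open>eventually_elim, simp\<close>)
  ultimately show ?thesis by (simp add: smooth_map_at_def)
qed

lemma smooth_map_at_const:
  assumes "atlas A" "atlas B" "p \<in> mcarrier A" "b \<in> mcarrier B"
  shows "smooth_map_at A B (\<lambda>q. b) p"
  by (rule smooth_map_atI[OF assms(1,2), where d = "chart_at B b"])
     (use assms chart_at_in[OF assms(4)] charts_atD(2)[OF chart_at_in[OF assms(4)]] in \<open>auto simp: smooth_fun_at_const\<close>)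

lemma smooth_map_at_ident:
  assumes A: "atlas A" and p: "p \<in> mcarrier A"
  shows "smooth_map_at A A (\<lambda>q. q) p"
proof (rule smooth_map_atI[OF A A, where d = "chart_at A p"])
  show "\<forall>\<^sub>F q in mnhds A p. q \<in> fst (chart_at A p)"
    using eventually_mnhds_in_chart[OF A chart_at_in[OF p]] by eventually_elim (rule charts_atD(2))
qed (use chart_at_in[OF p] smooth_fun_at_coord[OF A chart_at_in[OF p]] in simp_all)

text \<open>
  The open preimages of chart domains in \<open>smooth_map\<close> are the global form of the pointwise filter
  condition.
\<close>

lemma smooth_map_iff:
  assumes A: "atlas A" and B: "atlas B"
  shows "smooth_map A B F \<longleftrightarrow> (\<forall>p\<in>mcarrier A. smooth_map_at A B F p)"
proof
  assume F: "smooth_map A B F"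
  show "\<forall>p\<in>mcarrier A. smooth_map_at A B F p"
  proof
    fix p assume p: "p \<in> mcarrier A"
    let ?c = "chart_at A p" and ?d = "chart_at B (F p)"
    have Fp: "F p \<in> mcarrier B" using F p by (auto simp: smooth_map_def)
    note c = chart_at_in[OF p] and d = chart_at_in[OF Fp]
    let ?U = "snd ?c ` (fst ?c \<inter> F -` fst ?d)"
    have U: "open ?U" "smooth_on ?U (snd ?d \<circ> F \<circ> chart_inv ?c)"
      using F charts_atD(1)[OF c] charts_atD(1)[OF d] by (auto simp: smooth_map_def)
    have pU: "snd ?c p \<in> ?U" using charts_atD(2)[OF c] charts_atD(2)[OF d] by blast
    show "smooth_map_at A B F p"
    proof (rule smooth_map_atI[OF A B, where d = ?d])
      show "?d \<in> charts_at B (F p)" by (rule d)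
      have "\<forall>\<^sub>F x in nhds (snd ?c p). x \<in> ?U" by (rule eventually_nhds_in_open[OF U(1) pU])
      then show "\<forall>\<^sub>F q in mnhds A p. F q \<in> fst ?d"
        unfolding eventually_mnhds_chart[OF A c]
        by eventually_elim (use chart_inv_snd[OF A charts_atD(1)[OF c]] in auto)
      show "smooth_fun_at A (\<lambda>q. snd ?d (F q)) p"
        unfolding smooth_fun_at_chart[OF A c] using bspec[OF U(2)[unfolded smooth_on_iff_smooth_at[OF U(1)]] pU]
        by (simp add: o_def)
    qed
  qed
next
  assume F: "\<forall>p\<in>mcarrier A. smooth_map_at A B F p"
  have charts: "open (snd c ` (fst c \<inter> F -` fst d)) \<and>
        smooth_on (snd c ` (fst c \<inter> F -` fst d)) (snd d \<circ> F \<circ> chart_inv c)"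
    if c: "c \<in> A" and d: "d \<in> B" for c d
  proof -
    let ?U = "snd c ` (fst c \<inter> F -` fst d)"
    have *: "(\<forall>\<^sub>F x in nhds x. x \<in> ?U) \<and> smooth_at (snd d \<circ> F \<circ> chart_inv c) x" if x: "x \<in> ?U" for x
    proof -
      obtain p where p: "p \<in> fst c" "F p \<in> fst d" "x = snd c p" using x by auto
      have cp: "c \<in> charts_at A p" and dp: "d \<in> charts_at B (F p)" using p c d by (auto simp: charts_at_def)
      have Fp: "smooth_map_at A B F p" using F charts_atD(3)[OF cp] by blast
      have "\<forall>\<^sub>F x in nhds (snd c p). F (chart_inv c x) \<in> fst d"
        using eventually_smooth_map_at[OF Fp eventually_mnhds_in_chart[OF B dp]]
        unfolding eventually_mnhds_chart[OF A cp] by eventually_elim (rule charts_atD(2))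
      with eventually_in_charts[OF A cp cp]
      have "\<forall>\<^sub>F x in nhds (snd c p). x \<in> ?U"
        by eventually_elim (auto intro!: image_eqI[of _ "snd c" "chart_inv c _"])
      moreover have "smooth_at (\<lambda>x. snd d (F (chart_inv c x))) (snd c p)"
        by (rule smooth_fun_at_chart[OF A cp, THEN iffD1, OF smooth_fun_at_comp[OF A B smooth_fun_at_coord[OF B dp] Fp]])
      ultimately show ?thesis using p by (simp add: o_def)
    qed
    have o: "open ?U"
    proof (subst open_subopen, intro ballI)
      fix x assume "x \<in> ?U"
      from conjunct1[OF *[OF this]] obtain T where "open T" "x \<in> T" "\<forall>y\<in>T. y \<in> ?U"
        unfolding eventually_nhds by (elim exE conjE)
      then show "\<exists>T. open T \<and> x \<in> T \<and> T \<subseteq> ?U" by (intro exI[of _ T]) (simp add: subset_eq)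
    qed
    show ?thesis unfolding smooth_on_iff_smooth_at[OF o] by (intro conjI o ballI conjunct2[OF *])
  qed
  have "F ` mcarrier A \<subseteq> mcarrier B" by (intro image_subsetI smooth_map_at_mcarrier(2)[of A B F] F[rule_format])
  then show "smooth_map A B F"
    unfolding smooth_map_def using charts by simp
qed

section \<open>Tangent vectors as derivations\<close>

text \<open>
  \<open>dir_deriv\<close> for vector-valued functions. With the coordinate maps as such functions, tangent vectors are
  recovered from their derivations (\<open>dderiv_coord\<close>).
\<close>

definition dderiv :: "('a, 'e::euclidean_space) chart set \<Rightarrow> 'a \<Rightarrow> ('a \<Rightarrow> 'v::real_normed_vector) \<Rightarrow> ('a, 'e) tvec \<Rightarrow> 'v" where
  "dderiv A p f v = fderiv (\<lambda>x. f (chart_inv (chart_at A p) x)) (snd (chart_at A p) p) (v (chart_at A p))"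

lemma dir_deriv_dderiv: "dir_deriv A p v f = dderiv A p f v"
  by (simp add: dir_deriv_def dderiv_def Let_def o_def)

lemma tangent_space_chartD:
  assumes "v \<in> tangent_space A p" "c \<in> charts_at A p" "d \<in> charts_at A p"
  shows "v d = fderiv (\<lambda>x. snd d (chart_inv c x)) (snd c p) (v c)"
  using assms unfolding tangent_space_def o_def by blast

lemma dderiv_chart:
  assumes A: "atlas A" and c: "c \<in> charts_at A p" and v: "v \<in> tangent_space A p" and f: "smooth_fun_at A f p"
  shows "dderiv A p f v = fderiv (\<lambda>x. f (chart_inv c x)) (snd c p) (v c)"
proof -
  let ?d = "chart_at A p"
  have d: "?d \<in> charts_at A p" by (rule chart_at_in[OF smooth_fun_at_mcarrier[OF f]])
  have p: "chart_inv ?d (snd ?d p) = p" by (rule chart_inv_snd_at[OF A d])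
  have D1: "((\<lambda>x. snd c (chart_inv ?d x)) has_derivative
      fderiv (\<lambda>x. snd c (chart_inv ?d x)) (snd ?d p)) (at (snd ?d p))"
    by (rule smooth_at_has_derivative[OF smooth_at_transition[OF A d c]])
  have "((\<lambda>x. f (chart_inv c x)) has_derivative fderiv (\<lambda>x. f (chart_inv c x)) (snd c p)) (at (snd c p))"
    by (rule smooth_at_has_derivative) (rule smooth_fun_at_chart[OF A c, THEN iffD1, OF f])
  then have D2: "((\<lambda>x. f (chart_inv c x)) has_derivative fderiv (\<lambda>x. f (chart_inv c x)) (snd c p))
      (at (snd c (chart_inv ?d (snd ?d p))))" by (simp add: p)
  have ev: "\<forall>\<^sub>F x in nhds (snd ?d p). f (chart_inv c (snd c (chart_inv ?d x))) = f (chart_inv ?d x)"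
    using eventually_in_charts[OF A d c]
    by eventually_elim (use chart_inv_snd[OF A charts_atD(1)[OF c]] in simp)
  have "dderiv A p f v = fderiv (\<lambda>x. f (chart_inv c (snd c (chart_inv ?d x)))) (snd ?d p) (v ?d)"
    unfolding dderiv_def frechet_derivative_cong[OF ev] ..
  also have "\<dots> = fderiv (\<lambda>x. f (chart_inv c x)) (snd c p) (v c)"
    using frechet_derivative_eqI[OF diff_chain_at[OF D1 D2]] tangent_space_chartD[OF v d c]
    by (simp add: o_def)
  finally show ?thesis .
qed

lemma dderiv_cong:
  assumes A: "atlas A" and p: "p \<in> mcarrier A" and "\<forall>\<^sub>F q in mnhds A p. f q = g q"
  shows "dderiv A p f v = dderiv A p g v"
  unfolding dderiv_def
  by (subst frechet_derivative_cong) (use assms(3) eventually_mnhds_chart[OF A chart_at_in[OF p]] in auto)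

lemma dderiv_const [simp]: "dderiv A p (\<lambda>q. k) v = 0"
  by (simp add: dderiv_def)

lemma smooth_fun_at_dderiv_has_derivative:
  "smooth_fun_at A f p \<Longrightarrow> ((\<lambda>x. f (chart_inv (chart_at A p) x)) has_derivative
    fderiv (\<lambda>x. f (chart_inv (chart_at A p) x)) (snd (chart_at A p) p)) (at (snd (chart_at A p) p))"
  by (rule smooth_at_has_derivative) (simp add: smooth_fun_at_def)

lemma dderiv_add_vec: "smooth_fun_at A f p \<Longrightarrow> dderiv A p f (v + w) = dderiv A p f v + dderiv A p f w"
  unfolding dderiv_def by (simp add: linear_add[OF has_derivative_linear[OF smooth_fun_at_dderiv_has_derivative]])

lemma dderiv_scaleR_vec: "smooth_fun_at A f p \<Longrightarrow> dderiv A p f (r *\<^sub>R v) = r *\<^sub>R dderiv A p f v"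
  unfolding dderiv_def scaleR_fun_def by (simp add: linear_cmul[OF has_derivative_linear[OF smooth_fun_at_dderiv_has_derivative]])

lemma dderiv_linear_comp: "bounded_linear h \<Longrightarrow> smooth_fun_at A f p \<Longrightarrow> dderiv A p (\<lambda>q. h (f q)) v = h (dderiv A p f v)"
  unfolding dderiv_def by (subst frechet_derivative_linear_comp) (auto simp: smooth_fun_at_def smooth_at_differentiable)

lemma dderiv_add: "smooth_fun_at A f p \<Longrightarrow> smooth_fun_at A g p \<Longrightarrow> dderiv A p (\<lambda>q. f q + g q) v = dderiv A p f v + dderiv A p g v"
  unfolding dderiv_def
  by (simp add: frechet_derivative_eqI[OF has_derivative_add[OF smooth_fun_at_dderiv_has_derivative smooth_fun_at_dderiv_has_derivative]])

lemma dderiv_bilinear: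
  assumes "bounded_bilinear b" "smooth_fun_at A f p" "smooth_fun_at A g p" and A: "atlas A"
  shows "dderiv A p (\<lambda>q. b (f q) (g q)) v = b (f p) (dderiv A p g v) + b (dderiv A p f v) (g p)"
proof -
  have "chart_inv (chart_at A p) (snd (chart_at A p) p) = p"
    using chart_inv_snd[OF A] charts_atD[OF chart_at_in[OF smooth_fun_at_mcarrier[OF assms(2)]]] by blast
  then show ?thesis
    unfolding dderiv_def
    using frechet_derivative_eqI[OF bounded_bilinear.FDERIV[OF assms(1) smooth_fun_at_dderiv_has_derivative smooth_fun_at_dderiv_has_derivative, OF assms(2,3)]]
    by simp
qed

lemma dderiv_coord:
  assumes A: "atlas A" and v: "v \<in> tangent_space A p" and c: "c \<in> charts_at A p"
  shows "dderiv A p (snd c) v = v c"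
  unfolding dderiv_def
  using tangent_space_chartD[OF v chart_at_in[OF charts_atD(3)[OF c]] c] by simp

text \<open>
  The inverse of the evaluation \<open>v \<mapsto> v c\<close> on the tangent space at \<open>p\<close>.
\<close>

definition tvec_of :: "('a, 'e::euclidean_space) chart set \<Rightarrow> 'a \<Rightarrow> ('a, 'e) chart \<Rightarrow> 'e \<Rightarrow> ('a, 'e) tvec" where
  "tvec_of A p c x = (\<lambda>d. if d \<in> charts_at A p
     then fderiv (\<lambda>y. snd d (chart_inv c y)) (snd c p) x else 0)"

lemma frechet_derivative_own_chart:
  assumes A: "atlas A" and c: "c \<in> charts_at A p"
  shows "fderiv (\<lambda>x. snd c (chart_inv c x)) (snd c p) = (\<lambda>v. v)"
proof -
  have "\<forall>\<^sub>F x in nhds (snd c p). snd c (chart_inv c x) = x"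
    using eventually_in_charts[OF A c c] by eventually_elim simp
  then show ?thesis by (simp add: frechet_derivative_cong)
qed

lemma tvec_of_chart [simp]: "atlas A \<Longrightarrow> c \<in> charts_at A p \<Longrightarrow> tvec_of A p c x c = x"
  by (simp add: tvec_of_def frechet_derivative_own_chart)

lemma tvec_of_tangent:
  assumes A: "atlas A" and c: "c \<in> charts_at A p"
  shows "tvec_of A p c x \<in> tangent_space A p"
proof -
  have trans: "tvec_of A p c x e = fderiv (snd e \<circ> chart_inv d) (snd d p) (tvec_of A p c x d)"
    if d: "d \<in> charts_at A p" and e: "e \<in> charts_at A p" for d e
  proof -
    have p: "chart_inv c (snd c p) = p" by (rule chart_inv_snd_at[OF A c])
    have D1: "((\<lambda>x. snd d (chart_inv c x)) has_derivative
      fderiv (\<lambda>x. snd d (chart_inv c x)) (snd c p)) (at (snd c p))"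
      by (rule smooth_at_has_derivative[OF smooth_at_transition[OF A c d]])
    have D2: "((\<lambda>x. snd e (chart_inv d x)) has_derivative
      fderiv (\<lambda>x. snd e (chart_inv d x)) (snd d p)) (at (snd d (chart_inv c (snd c p))))"
      using smooth_at_has_derivative[OF smooth_at_transition[OF A d e]] by (simp add: p)
    have ev: "\<forall>\<^sub>F x in nhds (snd c p). snd e (chart_inv d (snd d (chart_inv c x))) = snd e (chart_inv c x)"
      using eventually_in_charts[OF A c d]
      by eventually_elim (use chart_inv_snd[OF A charts_atD(1)[OF d]] in simp)
    show ?thesis
      using frechet_derivative_eqI[OF diff_chain_at[OF D1 D2]] frechet_derivative_cong[OF ev] d e
      by (simp add: tvec_of_def o_def)
  qed
  have "tvec_of A p c x e = 0" if "e \<notin> charts_at A p" for e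
    using that by (simp add: tvec_of_def)
  then show ?thesis
    unfolding tangent_space_def by (intro CollectI conjI allI impI ballI trans)
qed

lemma tangent_outside: "v \<in> tangent_space A p \<Longrightarrow> c \<notin> charts_at A p \<Longrightarrow> v c = 0"
  unfolding tangent_space_def by blast

lemma tangent_eq_tvec_of:
  assumes "v \<in> tangent_space A p" "c \<in> charts_at A p"
  shows "v = tvec_of A p c (v c)"
proof
  fix d show "v d = tvec_of A p c (v c) d"
    by (cases "d \<in> charts_at A p")
       (use tangent_space_chartD[OF assms, of d] tangent_outside[OF assms(1), of d] in \<open>simp_all add: tvec_of_def\<close>)
qed

lemma tangent_eqI:
  assumes "v \<in> tangent_space A p" "w \<in> tangent_space A p" "c \<in> charts_at A p" "v c = w c"
  shows "v = w"
  using tangent_eq_tvec_of[OF assms(1,3)] tangent_eq_tvec_of[OF assms(2,3)] assms(4) by simp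

lemma linear_transition:
  "atlas A \<Longrightarrow> c \<in> charts_at A p \<Longrightarrow> d \<in> charts_at A p \<Longrightarrow>
    linear (fderiv (\<lambda>x. snd d (chart_inv c x)) (snd c p))"
  by (intro linear_frechet_derivative smooth_at_differentiable smooth_at_transition)

lemma tangentI:
  assumes "\<And>c. c \<notin> charts_at A p \<Longrightarrow> v c = 0"
    and "\<And>c d. c \<in> charts_at A p \<Longrightarrow> d \<in> charts_at A p \<Longrightarrow>
      v d = fderiv (\<lambda>x. snd d (chart_inv c x)) (snd c p) (v c)"
  shows "v \<in> tangent_space A p"
  unfolding tangent_space_def o_def using assms by blast

lemma tangent_zero: "atlas A \<Longrightarrow> 0 \<in> tangent_space A p"
  by (rule tangentI) (simp_all add: linear_0[OF linear_transition])

lemma tangent_add: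
  assumes A: "atlas A" and v: "v \<in> tangent_space A p" and w: "w \<in> tangent_space A p"
  shows "v + w \<in> tangent_space A p"
proof (rule tangentI)
  fix c d assume c: "c \<in> charts_at A p" and d: "d \<in> charts_at A p"
  show "(v + w) d = fderiv (\<lambda>x. snd d (chart_inv c x)) (snd c p) ((v + w) c)"
    by (simp only: plus_fun_apply linear_add[OF linear_transition[OF A c d]]
        tangent_space_chartD[OF v c d] tangent_space_chartD[OF w c d])
qed (simp add: tangent_outside[OF v] tangent_outside[OF w])

lemma tangent_scaleR:
  assumes A: "atlas A" and v: "v \<in> tangent_space A p"
  shows "r *\<^sub>R v \<in> tangent_space A p"
proof (rule tangentI)
  fix c d assume c: "c \<in> charts_at A p" and d: "d \<in> charts_at A p"
  show "(r *\<^sub>R v) d = fderiv (\<lambda>x. snd d (chart_inv c x)) (snd c p) ((r *\<^sub>R v) c)"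
    by (simp only: scaleR_fun_def linear_cmul[OF linear_transition[OF A c d]] tangent_space_chartD[OF v c d])
qed (simp add: tangent_outside[OF v] scaleR_fun_def)

lemma tangent_uminus:
  "atlas A \<Longrightarrow> v \<in> tangent_space A p \<Longrightarrow> - v \<in> tangent_space A p"
  using tangent_scaleR[of A v p "-1"] by simp

lemma differential_dderiv:
  "d \<in> charts_at B (F p) \<Longrightarrow> differential A B F p v d = dderiv A p (\<lambda>q. snd d (F q)) v"
  by (simp add: differential_def dderiv_def Let_def o_def)

lemma differential_tvec_of:
  assumes A: "atlas A" and B: "atlas B" and F: "smooth_map_at A B F p" and d: "d \<in> charts_at B (F p)"
  shows "differential A B F p v = tvec_of B (F p) d (dderiv A p (\<lambda>q. snd d (F q)) v)"
proof
  fix e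
  show "differential A B F p v e = tvec_of B (F p) d (dderiv A p (\<lambda>q. snd d (F q)) v) e"
  proof (cases "e \<in> charts_at B (F p)")
    case e: True
    let ?c = "chart_at A p"
    have c: "?c \<in> charts_at A p" by (rule chart_at_in[OF smooth_map_at_mcarrier(1)[OF F]])
    have p: "chart_inv ?c (snd ?c p) = p" by (rule chart_inv_snd_at[OF A c])
    have "smooth_fun_at A (\<lambda>q. snd d (F q)) p" by (rule smooth_fun_at_comp[OF A B smooth_fun_at_coord[OF B d] F])
    note D1 = smooth_fun_at_dderiv_has_derivative[OF this]
    have D2: "((\<lambda>x. snd e (chart_inv d x)) has_derivative
      fderiv (\<lambda>x. snd e (chart_inv d x)) (snd d (F p))) (at (snd d (F (chart_inv ?c (snd ?c p)))))"
      using smooth_at_has_derivative[OF smooth_at_transition[OF B d e]] by (simp add: p)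
    have "\<forall>\<^sub>F q in mnhds A p. snd e (chart_inv d (snd d (F q))) = snd e (F q)"
      using eventually_smooth_map_at[OF F eventually_mnhds_in_chart[OF B d]]
      by eventually_elim (simp add: chart_inv_snd_at[OF B])
    from dderiv_cong[OF A smooth_map_at_mcarrier(1)[OF F] this]
    have "differential A B F p v e = dderiv A p (\<lambda>q. snd e (chart_inv d (snd d (F q)))) v"
      by (simp add: differential_dderiv e)
    then show ?thesis
      using frechet_derivative_eqI[OF diff_chain_at[OF D1 D2]] e
      by (simp add: tvec_of_def dderiv_def o_def)
  qed (simp add: differential_def tvec_of_def)
qed

lemma differential_tangent:
  assumes A: "atlas A" and B: "atlas B" and F: "smooth_map_at A B F p"
  shows "differential A B F p v \<in> tangent_space B (F p)"
  using tvec_of_tangent[OF B chart_at_in[OF smooth_map_at_mcarrier(2)[OF F]]]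
    differential_tvec_of[OF assms chart_at_in[OF smooth_map_at_mcarrier(2)[OF F]]] by metis

text \<open>
  The chain rule. It allows computing with differentials by applying them to functions, without charts.
\<close>

lemma dderiv_differential:
  assumes A: "atlas A" and B: "atlas B" and F: "smooth_map_at A B F p" and f: "smooth_fun_at B f (F p)"
  shows "dderiv B (F p) f (differential A B F p v) = dderiv A p (\<lambda>q. f (F q)) v"
proof -
  let ?c = "chart_at A p" and ?d = "chart_at B (F p)"
  have c: "?c \<in> charts_at A p" by (rule chart_at_in[OF smooth_map_at_mcarrier(1)[OF F]])
  have d: "?d \<in> charts_at B (F p)" by (rule chart_at_in[OF smooth_map_at_mcarrier(2)[OF F]])
  have p: "chart_inv ?c (snd ?c p) = p" by (rule chart_inv_snd_at[OF A c])
  have "smooth_fun_at A (\<lambda>q. snd ?d (F q)) p" by (rule smooth_fun_at_comp[OF A B smooth_fun_at_coord[OF B d] F])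
  note D1 = smooth_fun_at_dderiv_has_derivative[OF this]
  have D2: "((\<lambda>x. f (chart_inv ?d x)) has_derivative
      fderiv (\<lambda>x. f (chart_inv ?d x)) (snd ?d (F p))) (at (snd ?d (F (chart_inv ?c (snd ?c p)))))"
    using smooth_fun_at_dderiv_has_derivative[OF f] by (simp add: p)
  have "\<forall>\<^sub>F q in mnhds A p. f (chart_inv ?d (snd ?d (F q))) = f (F q)"
    using eventually_smooth_map_at[OF F eventually_mnhds_in_chart[OF B d]]
    by eventually_elim (simp add: chart_inv_snd_at[OF B])
  from dderiv_cong[OF A smooth_map_at_mcarrier(1)[OF F] this]
  have "dderiv A p (\<lambda>q. f (F q)) v = dderiv A p (\<lambda>q. f (chart_inv ?d (snd ?d (F q)))) v" by simp
  then show ?thesis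
    using frechet_derivative_eqI[OF diff_chain_at[OF D1 D2]]
    by (simp add: dderiv_def[of A] dderiv_def[of B] differential_dderiv[of ?d B F p A, OF d] o_def)
qed

lemma differential_compose:
  assumes A: "atlas A" and B: "atlas B" and C: "atlas C"
    and F: "smooth_map_at A B F p" and G: "smooth_map_at B C G (F p)"
  shows "differential B C G (F p) (differential A B F p v) = differential A C (\<lambda>q. G (F q)) p v"
proof
  fix e
  show "differential B C G (F p) (differential A B F p v) e = differential A C (\<lambda>q. G (F q)) p v e"
  proof (cases "e \<in> charts_at C (G (F p))")
    case True
    then show ?thesis
      using dderiv_differential[OF A B F smooth_fun_at_comp[OF B C smooth_fun_at_coord[OF C True] G]]
      by (simp add: differential_dderiv)
  qed (simp add: differential_def)
qed

lemma differential_cong: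
  fixes B :: "('b, 'f::euclidean_space) chart set" and F G :: "'a \<Rightarrow> 'b"
  assumes A: "atlas A" and p: "p \<in> mcarrier A" and "\<forall>\<^sub>F q in mnhds A p. F q = G q"
  shows "differential A B F p v = differential A B G p v"
proof
  fix d :: "('b, 'f) chart"
  have "F p = G p" using eventually_mnhds_self[OF A p assms(3)] .
  moreover have "dderiv A p (\<lambda>q. snd d (F q)) v = dderiv A p (\<lambda>q. snd d (G q)) v"
    by (rule dderiv_cong[OF A p]) (use assms(3) in \<open>eventually_elim, simp\<close>)
  ultimately show "differential A B F p v d = differential A B G p v d"
    by (cases "d \<in> charts_at B (G p)") (simp add: differential_dderiv, simp add: differential_def)
qed

lemma differential_ident:
  assumes A: "atlas A" and v: "v \<in> tangent_space A p"
  shows "differential A A (\<lambda>q. q) p v = v"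
proof
  fix d show "differential A A (\<lambda>q. q) p v d = v d"
    using dderiv_coord[OF A v] tangent_outside[OF v]
    by (cases "d \<in> charts_at A p") (simp add: differential_dderiv, simp add: differential_def)
qed

lemma differential_add:
  assumes A: "atlas A" and B: "atlas B" and F: "smooth_map_at A B F p"
  shows "differential A B F p (v + w) = differential A B F p v + differential A B F p w"
proof
  fix d show "differential A B F p (v + w) d = (differential A B F p v + differential A B F p w) d"
    using dderiv_add_vec[OF smooth_fun_at_comp[OF A B smooth_fun_at_coord[OF B] F]]
    by (cases "d \<in> charts_at B (F p)") (simp add: differential_dderiv, simp add: differential_def)
qed

lemma differential_scaleR:
  assumes A: "atlas A" and B: "atlas B" and F: "smooth_map_at A B F p"
  shows "differential A B F p (r *\<^sub>R v) = r *\<^sub>R differential A B F p v"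
proof
  fix d show "differential A B F p (r *\<^sub>R v) d = (r *\<^sub>R differential A B F p v) d"
    using dderiv_scaleR_vec[OF smooth_fun_at_comp[OF A B smooth_fun_at_coord[OF B] F]]
    by (cases "d \<in> charts_at B (F p)")
       (simp add: differential_dderiv scaleR_fun_def, simp add: differential_def scaleR_fun_def)
qed

section \<open>Vector fields and the bracket as a commutator\<close>

lemma vector_field_iff:
  assumes A: "atlas A"
  shows "vector_field A X \<longleftrightarrow>
    (\<forall>p\<in>mcarrier A. X p \<in> tangent_space A p \<and> (\<forall>c\<in>charts_at A p. smooth_fun_at A (\<lambda>q. X q c) p))"
proof -
  have "(\<forall>c\<in>A. smooth_on (snd c ` fst c) (\<lambda>x. X (chart_inv c x) c)) \<longleftrightarrow>
      (\<forall>c\<in>A. \<forall>p\<in>fst c. smooth_at (\<lambda>x. X (chart_inv c x) c) (snd c p))"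
  proof (rule ball_cong[OF refl])
    fix c assume "c \<in> A"
    then have "open (snd c ` fst c)" using A by (simp add: atlas_def)
    from smooth_on_iff_smooth_at[OF this]
    show "smooth_on (snd c ` fst c) (\<lambda>x. X (chart_inv c x) c) \<longleftrightarrow>
        (\<forall>p\<in>fst c. smooth_at (\<lambda>x. X (chart_inv c x) c) (snd c p))" by blast
  qed
  also have "\<dots> \<longleftrightarrow> (\<forall>c\<in>A. \<forall>p\<in>fst c. smooth_fun_at A (\<lambda>q. X q c) p)"
    by (intro ball_cong refl smooth_fun_at_chart[OF A charts_atI, symmetric])
  also have "\<dots> \<longleftrightarrow> (\<forall>p\<in>mcarrier A. \<forall>c\<in>charts_at A p. smooth_fun_at A (\<lambda>q. X q c) p)"
    by (auto simp: mcarrier_def charts_at_def)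
  finally show ?thesis unfolding vector_field_def by blast
qed

lemma vector_fieldD:
  assumes "atlas A" "vector_field A X"
  shows "p \<in> mcarrier A \<Longrightarrow> X p \<in> tangent_space A p"
    and "c \<in> charts_at A p \<Longrightarrow> smooth_fun_at A (\<lambda>q. X q c) p"
proof -
  note X = assms(2)[unfolded vector_field_iff[OF assms(1)]]
  show "p \<in> mcarrier A \<Longrightarrow> X p \<in> tangent_space A p" using X by blast
  show "smooth_fun_at A (\<lambda>q. X q c) p" if "c \<in> charts_at A p"
    using X charts_atD(3)[OF that] that by blast
qed

text \<open>
  \<open>dderiv\<close> at \<open>q\<close> is defined through the chart \<open>chart_at A q\<close>, which jumps with \<open>q\<close>. To differentiate it
  in \<open>q\<close>, one has to compute it in one fixed chart near \<open>p\<close>.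
\<close>

lemma eventually_dderiv_chart:
  assumes A: "atlas A" and c: "c \<in> charts_at A p" and f: "smooth_fun_at A f p"
    and X: "\<forall>\<^sub>F q in mnhds A p. X q \<in> tangent_space A q"
  shows "\<forall>\<^sub>F x in nhds (snd c p). dderiv A (chart_inv c x) f (X (chart_inv c x)) =
    fderiv (\<lambda>x. f (chart_inv c x)) x (X (chart_inv c x) c)"
  using eventually_in_charts[OF A c c] X[unfolded eventually_mnhds_chart[OF A c]]
    eventually_smooth_fun_at[OF A f, unfolded eventually_mnhds_chart[OF A c]]
proof eventually_elim
  case (elim x)
  have "c \<in> charts_at A (chart_inv c x)" using elim charts_atD(1)[OF c] by (simp add: charts_at_def)
  from dderiv_chart[OF A this, of "X (chart_inv c x)" f] show ?case using elim by simp
qed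

lemma smooth_fun_at_dderiv:
  fixes f :: "'a \<Rightarrow> 'v::euclidean_space"
  assumes A: "atlas A" and c: "c \<in> charts_at A p" and f: "smooth_fun_at A f p"
    and X: "\<forall>\<^sub>F q in mnhds A p. X q \<in> tangent_space A q" and Xs: "smooth_fun_at A (\<lambda>q. X q c) p"
  shows "smooth_fun_at A (\<lambda>q. dderiv A q f (X q)) p"
proof -
  have "smooth_at (\<lambda>x. fderiv (\<lambda>x. f (chart_inv c x)) x (X (chart_inv c x) c)) (snd c p)"
    by (rule smooth_at_derivative_joint)
       (simp_all add: smooth_fun_at_chart[OF A c, THEN iffD1, OF f] smooth_fun_at_chart[OF A c, THEN iffD1, OF Xs])
  then show ?thesis
    unfolding smooth_fun_at_chart[OF A c]
    by (rule smooth_at_cong[THEN iffD2, rotated]) (rule eventually_dderiv_chart[OF A c f X])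
qed

lemma eventually_vector_field:
  assumes "atlas A" "vector_field A X" "p \<in> mcarrier A"
  shows "\<forall>\<^sub>F q in mnhds A p. X q \<in> tangent_space A q"
  using eventually_mnhds_mcarrier[OF assms(1,3)] by eventually_elim (rule vector_fieldD(1)[OF assms(1,2)])

lemma smooth_fun_at_dderiv_vector_field:
  fixes f :: "'a \<Rightarrow> 'v::euclidean_space"
  assumes A: "atlas A" and f: "smooth_fun_at A f p" and X: "vector_field A X"
  shows "smooth_fun_at A (\<lambda>q. dderiv A q f (X q)) p"
  by (rule smooth_fun_at_dderiv[OF A chart_at_in[OF smooth_fun_at_mcarrier[OF f]] f eventually_vector_field[OF A X smooth_fun_at_mcarrier[OF f]]
        vector_fieldD(2)[OF A X chart_at_in[OF smooth_fun_at_mcarrier[OF f]]]])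

text \<open>
  The pairing \<open>(y, w) \<mapsto> Df(y) w\<close> is jointly smooth and linear in \<open>w\<close>; the two summands are its partial
  derivatives.
\<close>

lemma frechet_derivative_applied:
  fixes f :: "'a::euclidean_space \<Rightarrow> 'b::euclidean_space"
  assumes f: "smooth_at f x" and h: "smooth_at h x"
  shows "fderiv (\<lambda>y. fderiv f y (h y)) x v =
    fderiv (\<lambda>y. fderiv f y (h x)) x v +
    fderiv f x (fderiv h x v)"
proof -
  let ?k = "\<lambda>y w. fderiv f y w"
  let ?K = "\<lambda>z. fderiv f (fst z) (snd z)"
  have lin: "linear (?k x)" by (rule linear_frechet_derivative[OF smooth_at_differentiable[OF f]])
  have K: "smooth_at ?K (x, h x)"
    by (rule smooth_at_derivative_joint)
       (auto simp: f smooth_at_bounded_linear bounded_linear_fst bounded_linear_snd)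
  have "((\<lambda>y. (y, h y)) has_derivative (\<lambda>v. (v, fderiv h x v))) (at x)"
    by (intro has_derivative_Pair has_derivative_ident smooth_at_has_derivative h)
  from diff_chain_at[OF this smooth_at_has_derivative[OF K]]
  have "((\<lambda>y. ?k y (h y)) has_derivative (\<lambda>v. fderiv ?K (x, h x) (v, fderiv h x v))) (at x)"
    by (simp add: o_def)
  from fun_cong[OF frechet_derivative_eqI[OF this], of v]
  have "fderiv (\<lambda>y. ?k y (h y)) x v =
      fderiv ?K (x, h x) ((v, 0) + (0, fderiv h x v))"
    by simp
  also have "\<dots> = fderiv ?K (x, h x) (v, 0) + fderiv ?K (x, h x) (0, fderiv h x v)"
    by (rule linear_add[OF linear_frechet_derivative[OF smooth_at_differentiable[OF K]]])
  also have "fderiv ?K (x, h x) (v, 0) = fderiv (\<lambda>y. ?k y (h x)) x v"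
    by (rule frechet_derivative_partial_fst[symmetric, OF K])
  also have "fderiv ?K (x, h x) (0, fderiv h x v) =
      fderiv (?k x) (h x) (fderiv h x v)"
    by (rule frechet_derivative_partial_snd[symmetric, OF K])
  also have "fderiv (?k x) (h x) = ?k x"
    by (rule frechet_derivative_eqI[OF linear_imp_has_derivative[OF lin]])
  finally show ?thesis .
qed

text \<open>
  In a chart, both iterated derivatives contain the second derivative of \<open>F\<close>; by its symmetry only
  the derivatives of the coefficients survive in the commutator.
\<close>

lemma dderiv_bracket:
  fixes F :: "'a \<Rightarrow> 'v::euclidean_space"
  assumes A: "atlas A" and F: "smooth_fun_at A F p" and X: "vector_field A X" and Y: "vector_field A Y"
  shows "dderiv A p F (bracket A X Y p) =
    dderiv A p (\<lambda>q. dderiv A q F (Y q)) (X p) - dderiv A p (\<lambda>q. dderiv A q F (X q)) (Y p)"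
proof -
  let ?c = "chart_at A p"
  note p = smooth_fun_at_mcarrier[OF F]
  note c = chart_at_in[OF p]
  define f where "f x = F (chart_inv ?c x)" for x
  define x0 where "x0 = snd ?c p"
  have f: "smooth_at f x0" using smooth_fun_at_chart[OF A c, THEN iffD1, OF F] by (simp add: f_def[abs_def] x0_def)
  have lin: "linear (fderiv f x0)"
    by (rule linear_frechet_derivative[OF smooth_at_differentiable[OF f]])
  have iter: "dderiv A p (\<lambda>q. dderiv A q F (Y q)) (X p) =
      fderiv (\<lambda>y. fderiv f y (Y p ?c)) x0 (X p ?c) +
      fderiv f x0 (fderiv (\<lambda>x. Y (chart_inv ?c x) ?c) x0 (X p ?c))"
    if Y: "vector_field A Y" for X Y
  proof -
    have h: "smooth_at (\<lambda>x. Y (chart_inv ?c x) ?c) x0"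
      unfolding x0_def by (rule smooth_fun_at_chart[OF A c, THEN iffD1, OF vector_fieldD(2)[OF A Y c]])
    have "dderiv A p (\<lambda>q. dderiv A q F (Y q)) (X p) =
      fderiv (\<lambda>x. fderiv f x (Y (chart_inv ?c x) ?c)) x0 (X p ?c)"
      unfolding dderiv_def[of A p] x0_def f_def[abs_def]
      by (subst frechet_derivative_cong[OF eventually_dderiv_chart[OF A c F eventually_vector_field[OF A Y p]]]) (rule refl)
    also have "\<dots> = fderiv (\<lambda>y. fderiv f y (Y (chart_inv ?c x0) ?c)) x0 (X p ?c) +
      fderiv f x0 (fderiv (\<lambda>x. Y (chart_inv ?c x) ?c) x0 (X p ?c))"
      by (rule frechet_derivative_applied[OF f h])
    finally show ?thesis by (simp add: x0_def chart_inv_snd_at[OF A c])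
  qed
  have "dderiv A p F (bracket A X Y p) = fderiv f x0
      (fderiv (\<lambda>x. Y (chart_inv ?c x) ?c) x0 (X p ?c)
        - fderiv (\<lambda>x. X (chart_inv ?c x) ?c) x0 (Y p ?c))"
    using c by (simp add: dderiv_def bracket_def f_def[abs_def] x0_def)
  also have "\<dots> = fderiv f x0 (fderiv (\<lambda>x. Y (chart_inv ?c x) ?c) x0 (X p ?c))
      - fderiv f x0 (fderiv (\<lambda>x. X (chart_inv ?c x) ?c) x0 (Y p ?c))"
    by (rule linear_diff[OF lin])
  finally show ?thesis
    using iter[OF X, of Y] iter[OF Y, of X] symmetric_second_derivative[OF f, of "X p ?c" "Y p ?c"] by simp
qed

lemma eventually_dderiv_coord:
  assumes A: "atlas A" and c: "c \<in> charts_at A p" and X: "vector_field A X"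
  shows "\<forall>\<^sub>F q in mnhds A p. dderiv A q (snd c) (X q) = X q c"
  using eventually_mnhds_in_chart[OF A c] eventually_vector_field[OF A X charts_atD(3)[OF c]]
  by eventually_elim (rule dderiv_coord[OF A])

lemma bracket_dderiv:
  assumes A: "atlas A" and c: "c \<in> charts_at A p" and X: "vector_field A X" and Y: "vector_field A Y"
  shows "bracket A X Y p c = dderiv A p (\<lambda>q. Y q c) (X p) - dderiv A p (\<lambda>q. X q c) (Y p)"
  using dderiv_chart[OF A c vector_fieldD(1)[OF A X charts_atD(3)[OF c]] vector_fieldD(2)[OF A Y c]]
    dderiv_chart[OF A c vector_fieldD(1)[OF A Y charts_atD(3)[OF c]] vector_fieldD(2)[OF A X c]] c
  by (simp add: bracket_def)

text \<open>
  Applied to the coordinates of another chart, \<open>dderiv_bracket\<close> is the transformation rule for tangent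
  vectors.
\<close>

lemma bracket_tangent:
  assumes A: "atlas A" and p: "p \<in> mcarrier A" and X: "vector_field A X" and Y: "vector_field A Y"
  shows "bracket A X Y p \<in> tangent_space A p"
proof -
  let ?c = "chart_at A p"
  note c = chart_at_in[OF p]
  have "bracket A X Y p d = tvec_of A p ?c (bracket A X Y p ?c) d" for d
  proof (cases "d \<in> charts_at A p")
    case d: True
    have "tvec_of A p ?c (bracket A X Y p ?c) d = dderiv A p (snd d) (bracket A X Y p)"
      using d by (simp add: tvec_of_def dderiv_def)
    also have "\<dots> = dderiv A p (\<lambda>q. dderiv A q (snd d) (Y q)) (X p) - dderiv A p (\<lambda>q. dderiv A q (snd d) (X q)) (Y p)"
      by (rule dderiv_bracket[OF A smooth_fun_at_coord[OF A d] X Y])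
    also have "\<dots> = bracket A X Y p d"
      unfolding bracket_dderiv[OF A d X Y] dderiv_cong[OF A p eventually_dderiv_coord[OF A d X]]
        dderiv_cong[OF A p eventually_dderiv_coord[OF A d Y]] ..
    finally show ?thesis by simp
  qed (simp add: bracket_def tvec_of_def)
  then have "bracket A X Y p = tvec_of A p ?c (bracket A X Y p ?c)" ..
  then show ?thesis using tvec_of_tangent[OF A c] by metis
qed

section \<open>Products of manifolds\<close>

definition prod_chart :: "('a, 'e) chart \<Rightarrow> ('b, 'f) chart \<Rightarrow> ('a \<times> 'b, 'e \<times> 'f) chart" where
  "prod_chart c d = (fst c \<times> fst d, map_prod (snd c) (snd d))"

lemma fst_prod_chart [simp]: "fst (prod_chart c d) = fst c \<times> fst d"
  and snd_prod_chart [simp]: "snd (prod_chart c d) z = (snd c (fst z), snd d (snd z))"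
  by (auto simp: prod_chart_def map_prod_def split: prod.split)

lemma prod_atlas_prod_chart: "prod_atlas A B = {prod_chart c d | c d. c \<in> A \<and> d \<in> B}"
  by (simp add: prod_atlas_def prod_chart_def)

lemma mcarrier_prod: "mcarrier (prod_atlas A B) = mcarrier A \<times> mcarrier B"
  unfolding mcarrier_def prod_atlas_prod_chart by fastforce

lemma charts_at_prodI:
  "c \<in> charts_at A p \<Longrightarrow> d \<in> charts_at B q \<Longrightarrow> prod_chart c d \<in> charts_at (prod_atlas A B) (p, q)"
  unfolding charts_at_def prod_atlas_prod_chart by (simp add: del: split_paired_Ex) blast

lemma snd_prod_chart_image: "snd (prod_chart c d) ` (S \<times> T) = (snd c ` S) \<times> (snd d ` T)"
  by (auto simp: prod_chart_def)

lemma chart_inv_prod: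
  assumes "inj_on (snd c) (fst c)" "inj_on (snd d) (fst d)" "x \<in> snd c ` fst c" "y \<in> snd d ` fst d"
  shows "chart_inv (prod_chart c d) (x, y) = (chart_inv c x, chart_inv d y)"
proof -
  have "inj_on (snd (prod_chart c d)) (fst (prod_chart c d))"
    using assms(1,2) by (simp add: prod_chart_def map_prod_inj_on)
  then show ?thesis
    unfolding chart_inv_def[of "prod_chart c d"]
    by (rule inv_into_f_eq) (simp_all add: assms chart_inv_mem snd_chart_inv)
qed

lemma atlas_chartD: "atlas A \<Longrightarrow> c \<in> A \<Longrightarrow> inj_on (snd c) (fst c)" "atlas A \<Longrightarrow> c \<in> A \<Longrightarrow> open (snd c ` fst c)"
  by (auto simp: atlas_def)

lemma atlas_transD:
  "atlas A \<Longrightarrow> c \<in> A \<Longrightarrow> d \<in> A \<Longrightarrow> open (snd c ` (fst c \<inter> fst d))"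
  "atlas A \<Longrightarrow> c \<in> A \<Longrightarrow> d \<in> A \<Longrightarrow> smooth_on (snd c ` (fst c \<inter> fst d)) (snd d \<circ> chart_inv c)"
  by (auto simp: atlas_def)

lemma atlas_prod:
  assumes A: "atlas A" and B: "atlas B"
  shows "atlas (prod_atlas A B)"
  unfolding atlas_def
proof (intro conjI ballI)
  fix e assume "e \<in> prod_atlas A B"
  then obtain c d where e: "e = prod_chart c d" "c \<in> A" "d \<in> B" unfolding prod_atlas_prod_chart by blast
  show "inj_on (snd e) (fst e)"
    using e atlas_chartD(1)[OF A] atlas_chartD(1)[OF B] by (simp add: prod_chart_def map_prod_inj_on)
  show "open (snd e ` fst e)"
    unfolding e fst_prod_chart snd_prod_chart_image
    by (intro open_Times atlas_chartD(2)[OF A] atlas_chartD(2)[OF B] e)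
  fix e' assume "e' \<in> prod_atlas A B"
  then obtain c' d' where e': "e' = prod_chart c' d'" "c' \<in> A" "d' \<in> B" unfolding prod_atlas_prod_chart by blast
  have I: "snd e ` (fst e \<inter> fst e') = (snd c ` (fst c \<inter> fst c')) \<times> (snd d ` (fst d \<inter> fst d'))"
    unfolding e e' fst_prod_chart Times_Int_Times snd_prod_chart_image ..
  show o: "open (snd e ` (fst e \<inter> fst e'))"
    unfolding I by (intro open_Times atlas_transD(1)[OF A] atlas_transD(1)[OF B] e e')
  show "smooth_on (snd e ` (fst e \<inter> fst e')) (snd e' \<circ> chart_inv e)"
    unfolding smooth_on_iff_smooth_at[OF o]
  proof
    fix z assume z: "z \<in> snd e ` (fst e \<inter> fst e')"
    obtain x y where xy: "z = (x, y)" "x \<in> snd c ` (fst c \<inter> fst c')" "y \<in> snd d ` (fst d \<inter> fst d')"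
      using z unfolding I by auto
    have "smooth_at (snd c' \<circ> chart_inv c) x" "smooth_at (snd d' \<circ> chart_inv d) y"
      using xy(2,3) smooth_on_iff_smooth_at[OF atlas_transD(1)[OF A e(2) e'(2)], THEN iffD1, OF atlas_transD(2)[OF A e(2) e'(2)]]
        smooth_on_iff_smooth_at[OF atlas_transD(1)[OF B e(3) e'(3)], THEN iffD1, OF atlas_transD(2)[OF B e(3) e'(3)]]
      by blast+
    then have "smooth_at (\<lambda>z. ((snd c' \<circ> chart_inv c) (fst z), (snd d' \<circ> chart_inv d) (snd z))) z"
      using smooth_at_compose[of fst z "snd c' \<circ> chart_inv c"] smooth_at_compose[of snd z "snd d' \<circ> chart_inv d"]
      by (intro smooth_at_Pair) (simp_all add: xy(1) smooth_at_bounded_linear bounded_linear_fst bounded_linear_snd)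
    moreover have "\<forall>\<^sub>F w in nhds z. ((snd c' \<circ> chart_inv c) (fst w), (snd d' \<circ> chart_inv d) (snd w)) = (snd e' \<circ> chart_inv e) w"
      using eventually_nhds_in_open[OF o z]
    proof eventually_elim
      case (elim w)
      then have "fst w \<in> snd c ` fst c" "snd w \<in> snd d ` fst d" unfolding I by auto
      from chart_inv_prod[OF atlas_chartD(1)[OF A e(2)] atlas_chartD(1)[OF B e(3)] this]
      show ?case by (simp add: e e')
    qed
    ultimately show "smooth_at (snd e' \<circ> chart_inv e) z" by (rule smooth_at_cong[THEN iffD1, rotated])
  qed
qed

lemma eventually_chart_inv_prod:
  assumes A: "atlas A" and B: "atlas B" and c: "c \<in> charts_at A p" and d: "d \<in> charts_at B q"
  shows "\<forall>\<^sub>F z in nhds (snd c p, snd d q).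
    chart_inv (prod_chart c d) z = (chart_inv c (fst z), chart_inv d (snd z))"
proof -
  have "open ((snd c ` fst c) \<times> (snd d ` fst d))" "(snd c p, snd d q) \<in> (snd c ` fst c) \<times> (snd d ` fst d)"
    using atlas_chartD(2)[OF A charts_atD(1)[OF c]] atlas_chartD(2)[OF B charts_atD(1)[OF d]]
      charts_atD(2)[OF c] charts_atD(2)[OF d] by (auto intro: open_Times)
  from eventually_nhds_in_open[OF this] show ?thesis
  proof eventually_elim
    case (elim z)
    then have "fst z \<in> snd c ` fst c" "snd z \<in> snd d ` fst d" by auto
    from chart_inv_prod[OF atlas_chartD(1)[OF A charts_atD(1)[OF c]] atlas_chartD(1)[OF B charts_atD(1)[OF d]] this]
    show ?case by simp
  qed
qed

lemma smooth_fun_at_prod_chart: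
  assumes A: "atlas A" and B: "atlas B" and c: "c \<in> charts_at A p" and d: "d \<in> charts_at B q"
  shows "smooth_fun_at (prod_atlas A B) f (p, q) \<longleftrightarrow>
    smooth_at (\<lambda>z. f (chart_inv c (fst z), chart_inv d (snd z))) (snd c p, snd d q)"
proof -
  have "smooth_fun_at (prod_atlas A B) f (p, q) \<longleftrightarrow> smooth_at (\<lambda>z. f (chart_inv (prod_chart c d) z)) (snd c p, snd d q)"
    using smooth_fun_at_chart[OF atlas_prod[OF A B] charts_at_prodI[OF c d], of f] by simp
  also have "\<dots> \<longleftrightarrow> smooth_at (\<lambda>z. f (chart_inv c (fst z), chart_inv d (snd z))) (snd c p, snd d q)"
    by (rule smooth_at_cong) (use eventually_chart_inv_prod[OF A B c d] in eventually_elim, simp)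
  finally show ?thesis .
qed

lemma
  assumes A: "atlas A" and B: "atlas B" and p: "p \<in> mcarrier A" and q: "q \<in> mcarrier B"
  shows smooth_map_at_fst: "smooth_map_at (prod_atlas A B) A fst (p, q)" and smooth_map_at_snd: "smooth_map_at (prod_atlas A B) B snd (p, q)"
proof -
  note c = chart_at_in[OF p] and d = chart_at_in[OF q]
  note AB = atlas_prod[OF A B]
  have ev: "\<forall>\<^sub>F z in mnhds (prod_atlas A B) (p, q). prod_chart (chart_at A p) (chart_at B q) \<in> charts_at (prod_atlas A B) z"
    by (rule eventually_mnhds_in_chart[OF AB charts_at_prodI[OF c d]])
  show "smooth_map_at (prod_atlas A B) A fst (p, q)"
  proof (rule smooth_map_atI[OF AB A, where d = "chart_at A p"])
    show "chart_at A p \<in> charts_at A (fst (p, q))" using c by simp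
    show "\<forall>\<^sub>F z in mnhds (prod_atlas A B) (p, q). fst z \<in> fst (chart_at A p)"
      using ev by eventually_elim (auto dest: charts_atD(2))
    show "smooth_fun_at (prod_atlas A B) (\<lambda>z. snd (chart_at A p) (fst z)) (p, q)"
      unfolding smooth_fun_at_prod_chart[OF A B c d]
      using smooth_at_compose[of fst "(snd (chart_at A p) p, snd (chart_at B q) q)"
          "\<lambda>x. snd (chart_at A p) (chart_inv (chart_at A p) x)"] smooth_at_transition[OF A c c]
      by (simp add: smooth_at_bounded_linear bounded_linear_fst)
  qed
  show "smooth_map_at (prod_atlas A B) B snd (p, q)"
  proof (rule smooth_map_atI[OF AB B, where d = "chart_at B q"])
    show "chart_at B q \<in> charts_at B (snd (p, q))" using d by simp
    show "\<forall>\<^sub>F z in mnhds (prod_atlas A B) (p, q). snd z \<in> fst (chart_at B q)"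
      using ev by eventually_elim (auto dest: charts_atD(2))
    show "smooth_fun_at (prod_atlas A B) (\<lambda>z. snd (chart_at B q) (snd z)) (p, q)"
      unfolding smooth_fun_at_prod_chart[OF A B c d]
      using smooth_at_compose[of snd "(snd (chart_at A p) p, snd (chart_at B q) q)"
          "\<lambda>x. snd (chart_at B q) (chart_inv (chart_at B q) x)"] smooth_at_transition[OF B d d]
      by (simp add: smooth_at_bounded_linear bounded_linear_snd)
  qed
qed

lemma smooth_map_at_Pair:
  assumes M: "atlas M" and A: "atlas A" and B: "atlas B" and F: "smooth_map_at M A F p" and G: "smooth_map_at M B G p"
  shows "smooth_map_at M (prod_atlas A B) (\<lambda>q. (F q, G q)) p"
proof -
  let ?c = "chart_at A (F p)" and ?d = "chart_at B (G p)"
  note c = chart_at_in[OF smooth_map_at_mcarrier(2)[OF F]] and d = chart_at_in[OF smooth_map_at_mcarrier(2)[OF G]]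
  show ?thesis
  proof (rule smooth_map_atI[OF M atlas_prod[OF A B], where d = "prod_chart ?c ?d"])
    show "prod_chart ?c ?d \<in> charts_at (prod_atlas A B) (F p, G p)" by (rule charts_at_prodI[OF c d])
    show "\<forall>\<^sub>F q in mnhds M p. (F q, G q) \<in> fst (prod_chart ?c ?d)"
      using eventually_smooth_map_at[OF F eventually_mnhds_in_chart[OF A c]] eventually_smooth_map_at[OF G eventually_mnhds_in_chart[OF B d]]
      by eventually_elim (auto dest: charts_atD(2))
    show "smooth_fun_at M (\<lambda>q. snd (prod_chart ?c ?d) (F q, G q)) p"
      using smooth_fun_at_Pair[OF smooth_fun_at_comp[OF M A smooth_fun_at_coord[OF A c] F] smooth_fun_at_comp[OF M B smooth_fun_at_coord[OF B d] G]] by simp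
  qed
qed

lemma
  fixes f :: "'a \<Rightarrow> 'b \<Rightarrow> 'v::euclidean_space"
  assumes A: "atlas A" and B: "atlas B" and f: "smooth_fun_at (prod_atlas A B) (\<lambda>z. f (fst z) (snd z)) (p, q)"
  shows smooth_fun_at_slice_fst: "smooth_fun_at A (\<lambda>a. f a q) p" and smooth_fun_at_slice_snd: "smooth_fun_at B (f p) q"
proof -
  have p: "p \<in> mcarrier A" and q: "q \<in> mcarrier B" using smooth_fun_at_mcarrier[OF f] by (auto simp: mcarrier_prod)
  have "smooth_map_at A (prod_atlas A B) (\<lambda>a. (a, q)) p"
    by (intro smooth_map_at_Pair smooth_map_at_ident smooth_map_at_const A B p q)
  from smooth_fun_at_comp[OF A atlas_prod[OF A B] f this] show "smooth_fun_at A (\<lambda>a. f a q) p" by simp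
  have "smooth_map_at B (prod_atlas A B) (\<lambda>b. (p, b)) q"
    by (intro smooth_map_at_Pair smooth_map_at_ident smooth_map_at_const A B p q)
  from smooth_fun_at_comp[OF B atlas_prod[OF A B] f this] show "smooth_fun_at B (f p) q" by simp
qed

text \<open>
  In a chart this is joint smoothness of the total derivative, applied to the direction \<open>(0, V)\<close>. It gives the
  smoothness of left-invariant fields, of the trivialization of the tangent bundle, and of \<open>Ad\<close>.
\<close>

lemma smooth_fun_at_partial_derivative:
  fixes f :: "'a \<Rightarrow> 'b \<Rightarrow> 'v::euclidean_space"
  assumes M: "atlas M" and B: "atlas B"
    and f: "smooth_fun_at (prod_atlas M B) (\<lambda>z. f (fst z) (snd z)) (p, Q p)" and Q: "smooth_map_at M B Q p"
    and V: "\<forall>\<^sub>F m in mnhds M p. V m \<in> tangent_space B (Q m)"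
    and d: "d \<in> charts_at B (Q p)" and Vs: "smooth_fun_at M (\<lambda>m. V m d) p"
  shows "smooth_fun_at M (\<lambda>m. dderiv B (Q m) (f m) (V m)) p"
proof -
  let ?c = "chart_at M p"
  note p = smooth_map_at_mcarrier(1)[OF Q]
  note c = chart_at_in[OF p]
  define F where "F x y = f (chart_inv ?c x) (chart_inv d y)" for x y
  define y where "y x = snd d (Q (chart_inv ?c x))" for x
  have y0: "y (snd ?c p) = snd d (Q p)" by (simp add: y_def chart_inv_snd_at[OF M c])
  have F: "smooth_at (\<lambda>z. F (fst z) (snd z)) (snd ?c p, snd d (Q p))"
    using smooth_fun_at_prod_chart[OF M B c d, THEN iffD1, OF f] by (simp add: F_def)
  have ys: "smooth_at y (snd ?c p)"
    unfolding y_def by (rule smooth_fun_at_chart[OF M c, THEN iffD1, OF smooth_fun_at_comp[OF M B smooth_fun_at_coord[OF B d] Q]])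
  have Vs': "smooth_at (\<lambda>x. V (chart_inv ?c x) d) (snd ?c p)"
    by (rule smooth_fun_at_chart[OF M c, THEN iffD1, OF Vs])
  have g: "smooth_at (\<lambda>x. fderiv (\<lambda>z. F (fst z) (snd z)) (x, y x) (0, V (chart_inv ?c x) d)) (snd ?c p)"
    by (rule smooth_at_derivative_joint) (use F in \<open>simp_all add: y0 smooth_at_Pair ys Vs'\<close>)
  have "\<forall>\<^sub>F m in mnhds M p. smooth_fun_at (prod_atlas M B) (\<lambda>z. f (fst z) (snd z)) (m, Q m)"
    by (rule eventually_smooth_map_at[OF smooth_map_at_Pair[OF M M B smooth_map_at_ident[OF M p] Q]])
       (rule eventually_smooth_fun_at[OF atlas_prod[OF M B] f])
  moreover have "\<forall>\<^sub>F m in mnhds M p. d \<in> charts_at B (Q m)"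
    by (rule eventually_smooth_map_at[OF Q eventually_mnhds_in_chart[OF B d]])
  ultimately have "\<forall>\<^sub>F m in mnhds M p. dderiv B (Q m) (f m) (V m) =
      fderiv (\<lambda>z. F (fst z) (snd z)) (snd ?c m, y (snd ?c m)) (0, V m d)"
    using V eventually_mnhds_in_chart[OF M c]
  proof eventually_elim
    case (elim m)
    have "dderiv B (Q m) (f m) (V m) = fderiv (\<lambda>x. f m (chart_inv d x)) (snd d (Q m)) (V m d)"
      by (rule dderiv_chart[OF B elim(2,3) smooth_fun_at_slice_snd[OF M B elim(1)]])
    also have "\<dots> = fderiv (F (snd ?c m)) (y (snd ?c m)) (V m d)"
      using elim by (simp add: F_def[abs_def] y_def chart_inv_snd_at[OF M])
    also have "\<dots> = fderiv (\<lambda>z. F (fst z) (snd z)) (snd ?c m, y (snd ?c m)) (0, V m d)"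
      by (rule frechet_derivative_partial_snd)
         (use smooth_fun_at_prod_chart[OF M B elim(4,2), THEN iffD1, OF elim(1)] elim in
           \<open>simp add: F_def y_def chart_inv_snd_at[OF M]\<close>)
    finally show ?case .
  qed
  then have ev: "\<forall>\<^sub>F x in nhds (snd ?c p). fderiv (\<lambda>z. F (fst z) (snd z)) (x, y x) (0, V (chart_inv ?c x) d) =
      dderiv B (Q (chart_inv ?c x)) (f (chart_inv ?c x)) (V (chart_inv ?c x))"
    unfolding eventually_mnhds_chart[OF M c]
    using eventually_in_charts[OF M c c] by eventually_elim simp
  show ?thesis
    unfolding smooth_fun_at_chart[OF M c] by (rule smooth_at_cong[THEN iffD1, OF ev g])
qed

text \<open>
  The symmetry of the second derivative in a product chart, for the directions \<open>(v, 0)\<close> and \<open>(0, w)\<close>.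
\<close>

lemma dderiv_mixed_partials:
  fixes f :: "'a \<Rightarrow> 'b \<Rightarrow> 'v::euclidean_space"
  assumes A: "atlas A" and B: "atlas B" and f: "smooth_fun_at (prod_atlas A B) (\<lambda>z. f (fst z) (snd z)) (p, q)"
    and v: "v \<in> tangent_space A p" and w: "w \<in> tangent_space B q"
  shows "dderiv A p (\<lambda>a. dderiv B q (f a) w) v = dderiv B q (\<lambda>b. dderiv A p (\<lambda>a. f a b) v) w"
proof -
  have p: "p \<in> mcarrier A" and q: "q \<in> mcarrier B" using smooth_fun_at_mcarrier[OF f] by (auto simp: mcarrier_prod)
  let ?c = "chart_at A p" and ?d = "chart_at B q"
  note c = chart_at_in[OF p] and d = chart_at_in[OF q]
  define F where "F x y = f (chart_inv ?c x) (chart_inv ?d y)" for x y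
  let ?F = "\<lambda>z. F (fst z) (snd z)"
  let ?x = "snd ?c p" and ?y = "snd ?d q"
  have F: "smooth_at ?F (?x, ?y)"
    using smooth_fun_at_prod_chart[OF A B c d, THEN iffD1, OF f] by (simp add: F_def)
  have "filterlim (\<lambda>x. (x, ?y)) (nhds (?x, ?y)) (nhds ?x)" "filterlim (\<lambda>y. (?x, y)) (nhds (?x, ?y)) (nhds ?y)"
    by (intro tendsto_Pair tendsto_const tendsto_ident_at filterlim_ident)+
  from eventually_compose_filterlim[OF eventually_smooth_at[OF F] this(1)]
    eventually_compose_filterlim[OF eventually_smooth_at[OF F] this(2)]
  have e1: "\<forall>\<^sub>F x in nhds ?x. smooth_at ?F (x, ?y)" and e2: "\<forall>\<^sub>F y in nhds ?y. smooth_at ?F (?x, y)" .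
  have "dderiv A p (\<lambda>a. dderiv B q (f a) w) v = fderiv (\<lambda>x. fderiv (F x) ?y (w ?d)) ?x (v ?c)"
    by (simp add: dderiv_def F_def[abs_def])
  also have "fderiv (\<lambda>x. fderiv (F x) ?y (w ?d)) ?x =
      fderiv (\<lambda>x. fderiv ?F (x, ?y) (0, w ?d)) ?x"
    by (rule frechet_derivative_cong) (use e1 in eventually_elim, rule frechet_derivative_partial_snd)
  also have "\<dots> (v ?c) = fderiv (\<lambda>z. fderiv ?F z (0, w ?d)) (?x, ?y) (v ?c, 0)"
    using frechet_derivative_partial_fst[of "\<lambda>x y. fderiv ?F (x, y) (0, w ?d)" ?x ?y "v ?c"]
      smooth_at_derivative[OF F, of "(0, w ?d)"] by simp
  also have "\<dots> = fderiv (\<lambda>z. fderiv ?F z (v ?c, 0)) (?x, ?y) (0, w ?d)"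
    by (rule symmetric_second_derivative[OF F])
  also have "\<dots> = fderiv (\<lambda>y. fderiv ?F (?x, y) (v ?c, 0)) ?y (w ?d)"
    using frechet_derivative_partial_snd[of "\<lambda>x y. fderiv ?F (x, y) (v ?c, 0)" ?x ?y "w ?d"]
      smooth_at_derivative[OF F, of "(v ?c, 0)"] by simp
  also have "fderiv (\<lambda>y. fderiv ?F (?x, y) (v ?c, 0)) ?y =
      fderiv (\<lambda>y. fderiv (\<lambda>x. F x y) ?x (v ?c)) ?y"
    by (rule frechet_derivative_cong) (use e2 in eventually_elim, rule frechet_derivative_partial_fst[symmetric])
  also have "\<dots> (w ?d) = dderiv B q (\<lambda>b. dderiv A p (\<lambda>a. f a b) v) w"
    by (simp add: dderiv_def F_def[abs_def])
  finally show ?thesis .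
qed

lemma dderiv_prod:
  fixes f :: "'a \<Rightarrow> 'b \<Rightarrow> 'v::euclidean_space"
  assumes A: "atlas A" and B: "atlas B" and f: "smooth_fun_at (prod_atlas A B) (\<lambda>z. f (fst z) (snd z)) (p, q)"
    and c: "c \<in> charts_at A p" and d: "d \<in> charts_at B q"
    and u: "u \<in> tangent_space (prod_atlas A B) (p, q)"
    and v: "v \<in> tangent_space A p" and w: "w \<in> tangent_space B q"
    and uvw: "u (prod_chart c d) = (v c, w d)"
  shows "dderiv (prod_atlas A B) (p, q) (\<lambda>z. f (fst z) (snd z)) u = dderiv A p (\<lambda>a. f a q) v + dderiv B q (f p) w"
proof -
  note AB = atlas_prod[OF A B]
  define F where "F x y = f (chart_inv c x) (chart_inv d y)" for x y
  let ?F = "\<lambda>z. F (fst z) (snd z)"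
  let ?x = "snd c p" and ?y = "snd d q"
  have F: "smooth_at ?F (?x, ?y)"
    using smooth_fun_at_prod_chart[OF A B c d, THEN iffD1, OF f] by (simp add: F_def)
  have ev: "\<forall>\<^sub>F z in nhds (?x, ?y). f (fst (chart_inv (prod_chart c d) z)) (snd (chart_inv (prod_chart c d) z)) = ?F z"
    using eventually_chart_inv_prod[OF A B c d] by eventually_elim (simp add: F_def)
  have "dderiv (prod_atlas A B) (p, q) (\<lambda>z. f (fst z) (snd z)) u = fderiv ?F (?x, ?y) (v c, w d)"
    using dderiv_chart[OF AB charts_at_prodI[OF c d] u f] frechet_derivative_cong[OF ev] by (simp add: uvw)
  also have "\<dots> = fderiv ?F (?x, ?y) ((v c, 0) + (0, w d))" by simp
  also have "\<dots> = fderiv ?F (?x, ?y) (v c, 0) + fderiv ?F (?x, ?y) (0, w d)"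
    by (rule linear_add[OF linear_frechet_derivative[OF smooth_at_differentiable[OF F]]])
  also have "fderiv ?F (?x, ?y) (v c, 0) = fderiv (\<lambda>x. F x ?y) ?x (v c)"
    by (rule frechet_derivative_partial_fst[OF F, symmetric])
  also have "\<dots> = dderiv A p (\<lambda>a. f a q) v"
    using dderiv_chart[OF A c v smooth_fun_at_slice_fst[OF A B f]] by (simp add: F_def[abs_def] chart_inv_snd_at[OF B d])
  also have "fderiv ?F (?x, ?y) (0, w d) = fderiv (F ?x) ?y (w d)"
    by (rule frechet_derivative_partial_snd[OF F, symmetric])
  also have "\<dots> = dderiv B q (f p) w"
    using dderiv_chart[OF B d w smooth_fun_at_slice_snd[OF A B f]] by (simp add: F_def[abs_def] chart_inv_snd_at[OF A c])
  finally show ?thesis .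
qed

section \<open>Left trivialization of a Lie group\<close>

lemma scaleR_fun_apply: "(r *\<^sub>R f) x = r *\<^sub>R f x"
  by (simp add: scaleR_fun_def)

lemma dderiv_sum:
  assumes p: "p \<in> mcarrier A" and f: "\<And>i. i \<in> I \<Longrightarrow> smooth_fun_at A (f i) p"
  shows "dderiv A p (\<lambda>q. \<Sum>i\<in>I. f i q) v = (\<Sum>i\<in>I. dderiv A p (f i) v)"
  using f
proof (induction I rule: infinite_finite_induct)
  case (insert i I)
  then show ?case by (simp add: dderiv_add smooth_fun_at_sum[OF p])
qed simp_all

locale lie_group_chart =
  fixes G :: "('a, 'm) monoid_scheme" (structure)
    and A :: "('a, 'e::euclidean_space) chart set"
    and c0 :: "('a, 'e) chart"
  assumes lie: "lie_group G A" and c0: "c0 \<in> charts_at A \<one>"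

sublocale lie_group_chart \<subseteq> group G
  using lie by (simp add: lie_group_def)

context lie_group_chart
begin

lemma A: "atlas A" and mcarrier: "mcarrier A = carrier G"
  using lie by (auto simp: lie_group_def smooth_manifold_iff_atlas)

lemma AA: "atlas (prod_atlas A A)"
  by (rule atlas_prod[OF A A])

lemma smooth_map_at_mult:
  assumes "p \<in> carrier G" "q \<in> carrier G"
  shows "smooth_map_at (prod_atlas A A) A (\<lambda>z. fst z \<otimes> snd z) (p, q)"
proof -
  have "smooth_map (prod_atlas A A) A (\<lambda>(a, b). a \<otimes> b)" using lie by (simp add: lie_group_def)
  then show ?thesis
    unfolding smooth_map_iff[OF AA A] using assms by (auto simp: mcarrier_prod mcarrier case_prod_unfold)
qed

lemma smooth_map_at_inv: "p \<in> carrier G \<Longrightarrow> smooth_map_at A A (\<lambda>a. inv a) p"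
  using lie unfolding lie_group_def smooth_map_iff[OF A A] mcarrier by blast

lemma smooth_map_at_mult_fun:
  assumes M: "atlas M" and F: "smooth_map_at M A F p" and H: "smooth_map_at M A H p"
  shows "smooth_map_at M A (\<lambda>q. F q \<otimes> H q) p"
proof -
  have "smooth_map_at (prod_atlas A A) A (\<lambda>z. fst z \<otimes> snd z) (F p, H p)"
    using smooth_map_at_mult smooth_map_at_mcarrier(2)[OF F] smooth_map_at_mcarrier(2)[OF H] by (simp add: mcarrier)
  from smooth_map_at_compose[OF M AA A smooth_map_at_Pair[OF M A A F H] this] show ?thesis by simp
qed

lemma smooth_map_at_inv_fun:
  assumes M: "atlas M" and F: "smooth_map_at M A F p"
  shows "smooth_map_at M A (\<lambda>q. inv (F q)) p"
  using smooth_map_at_compose[OF M A A F smooth_map_at_inv] smooth_map_at_mcarrier(2)[OF F] by (simp add: mcarrier)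

lemma smooth_map_at_lmult: "a \<in> carrier G \<Longrightarrow> p \<in> carrier G \<Longrightarrow> smooth_map_at A A (\<lambda>x. a \<otimes> x) p"
  by (intro smooth_map_at_mult_fun A smooth_map_at_const smooth_map_at_ident) (simp_all add: mcarrier)

lemma eventually_carrier: "p \<in> carrier G \<Longrightarrow> \<forall>\<^sub>F q in mnhds A p. q \<in> carrier G"
  using eventually_mnhds_mcarrier[OF A] by (simp add: mcarrier)

abbreviation ltr where "ltr \<equiv> ltrans G A"

lemma ltr_tangent:
  "a \<in> carrier G \<Longrightarrow> p \<in> carrier G \<Longrightarrow> ltr a p v \<in> tangent_space A (a \<otimes> p)"
  unfolding ltrans_def by (rule differential_tangent[OF A A smooth_map_at_lmult])

lemma dderiv_ltr:
  "a \<in> carrier G \<Longrightarrow> p \<in> carrier G \<Longrightarrow> smooth_fun_at A f (a \<otimes> p) \<Longrightarrow>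
    dderiv A (a \<otimes> p) f (ltr a p v) = dderiv A p (\<lambda>x. f (a \<otimes> x)) v"
  unfolding ltrans_def by (rule dderiv_differential[OF A A smooth_map_at_lmult])

lemma ltr_ltr:
  assumes "a \<in> carrier G" "b \<in> carrier G" "p \<in> carrier G"
  shows "ltr a (b \<otimes> p) (ltr b p v) = ltr (a \<otimes> b) p v"
proof -
  have "ltr a (b \<otimes> p) (ltr b p v) = differential A A (\<lambda>x. a \<otimes> (b \<otimes> x)) p v"
    unfolding ltrans_def using assms
    by (intro differential_compose[OF A A A, where F = "\<lambda>x. b \<otimes> x" and G = "\<lambda>x. a \<otimes> x"] smooth_map_at_lmult) simp_all
  also have "\<dots> = ltr (a \<otimes> b) p v"
    unfolding ltrans_def
    by (rule differential_cong[OF A])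
       (use assms in \<open>simp add: mcarrier\<close>,
        use eventually_carrier[OF assms(3)] in eventually_elim, use assms in \<open>simp add: m_assoc\<close>)
  finally show ?thesis .
qed

lemma ltr_one:
  assumes "p \<in> carrier G" "v \<in> tangent_space A p"
  shows "ltr \<one> p v = v"
proof -
  have "ltr \<one> p v = differential A A (\<lambda>x. x) p v"
    unfolding ltrans_def
    by (rule differential_cong[OF A])
       (use assms in \<open>simp add: mcarrier\<close>, use eventually_carrier[OF assms(1)] in eventually_elim, simp)
  then show ?thesis using differential_ident[OF A assms(2)] by simp
qed

lemma ltr_add: "a \<in> carrier G \<Longrightarrow> p \<in> carrier G \<Longrightarrow> ltr a p (v + w) = ltr a p v + ltr a p w"
  unfolding ltrans_def by (rule differential_add[OF A A smooth_map_at_lmult])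

lemma ltr_scaleR: "a \<in> carrier G \<Longrightarrow> p \<in> carrier G \<Longrightarrow> ltr a p (r *\<^sub>R v) = r *\<^sub>R ltr a p v"
  unfolding ltrans_def by (rule differential_scaleR[OF A A smooth_map_at_lmult])

text \<open>
  Coordinates in the chart \<open>c0\<close> identify the Lie algebra with \<open>'e\<close>. Then \<open>L x\<close> is the
  left-invariant vector field through \<open>x\<close>, and \<open>th\<close> is the Maurer-Cartan form, its inverse.
\<close>

definition L :: "'e \<Rightarrow> ('a, 'e) vfield" where
  "L x p = ltr p \<one> (tvec_of A \<one> c0 x)"

definition th :: "'a \<Rightarrow> ('a, 'e) tvec \<Rightarrow> 'e" where
  "th p v = ltr (inv p) p v c0"

abbreviation unit_vec :: "'e \<Rightarrow> ('a, 'e) tvec" where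
  "unit_vec \<equiv> tvec_of A \<one> c0"

lemma unit_vec_tangent: "unit_vec x \<in> tangent_space A \<one>"
  by (rule tvec_of_tangent[OF A c0])

lemma unit_vec_c0 [simp]: "unit_vec x c0 = x"
  by (rule tvec_of_chart[OF A c0])

lemma unit_vec_eq: "v \<in> tangent_space A \<one> \<Longrightarrow> unit_vec (v c0) = v"
  using tangent_eq_tvec_of[OF _ c0] by metis

lemma unit_vec_add: "unit_vec (x + y) = unit_vec x + unit_vec y"
  by (rule tangent_eqI[OF _ _ c0]) (simp_all add: unit_vec_tangent tangent_add[OF A])

lemma unit_vec_scaleR: "unit_vec (r *\<^sub>R x) = r *\<^sub>R unit_vec x"
  by (rule tangent_eqI[OF _ _ c0]) (simp_all add: unit_vec_tangent tangent_scaleR[OF A] scaleR_fun_apply)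

lemma L_tangent: "p \<in> carrier G \<Longrightarrow> L x p \<in> tangent_space A p"
  using ltr_tangent[of p \<one>] by (simp add: L_def)

lemma L_one: "L x \<one> = unit_vec x"
  by (simp add: L_def ltr_one unit_vec_tangent)

lemma ltr_L: "a \<in> carrier G \<Longrightarrow> p \<in> carrier G \<Longrightarrow> ltr a p (L x p) = L x (a \<otimes> p)"
  using ltr_ltr[of a p \<one>] by (simp add: L_def)

lemma th_ltr:
  assumes "a \<in> carrier G" "p \<in> carrier G"
  shows "th (a \<otimes> p) (ltr a p v) = th p v"
  using ltr_ltr[of "inv (a \<otimes> p)" a p v] assms by (simp add: th_def inv_mult_group m_assoc)

lemma th_L: "p \<in> carrier G \<Longrightarrow> th p (L x p) = x"
  using ltr_L[of "inv p" p x] by (simp add: th_def L_one)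

lemma L_th:
  assumes "p \<in> carrier G" "v \<in> tangent_space A p"
  shows "L (th p v) p = v"
proof -
  have "ltr (inv p) p v \<in> tangent_space A \<one>" using ltr_tangent[of "inv p" p v] assms by simp
  then have "L (th p v) p = ltr p (inv p \<otimes> p) (ltr (inv p) p v)"
    using assms by (simp add: L_def th_def unit_vec_eq)
  also have "\<dots> = ltr (p \<otimes> inv p) p v" using assms by (intro ltr_ltr) simp_all
  also have "\<dots> = v" using assms by (simp add: ltr_one)
  finally show ?thesis .
qed

lemma th_one: "v \<in> tangent_space A \<one> \<Longrightarrow> th \<one> v = v c0"
  by (simp add: th_def ltr_one)

lemma L_add: "p \<in> carrier G \<Longrightarrow> L (x + y) p = L x p + L y p"
  by (simp add: L_def unit_vec_add ltr_add)

lemma L_scaleR: "p \<in> carrier G \<Longrightarrow> L (r *\<^sub>R x) p = r *\<^sub>R L x p"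
  by (simp add: L_def unit_vec_scaleR ltr_scaleR)

lemma L_zero: "p \<in> carrier G \<Longrightarrow> L 0 p = 0"
  using L_scaleR[of p 0 0] by (simp add: scaleR_fun_def zero_fun_def)

lemma L_uminus: "p \<in> carrier G \<Longrightarrow> L (- x) p = - L x p"
  using L_scaleR[of p "-1" x] by simp

lemma L_diff: "p \<in> carrier G \<Longrightarrow> L (x - y) p = L x p - L y p"
  using L_add[of p x "- y"] L_uminus[of p y] by simp

lemma th_add: "p \<in> carrier G \<Longrightarrow> th p (v + w) = th p v + th p w"
  by (simp add: th_def ltr_add)

lemma th_scaleR: "p \<in> carrier G \<Longrightarrow> th p (r *\<^sub>R v) = r *\<^sub>R th p v"
  by (simp add: th_def ltr_scaleR scaleR_fun_apply)

lemma L_linear: "p \<in> carrier G \<Longrightarrow> linear (\<lambda>x. L x p c)"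
  by (rule linearI) (simp_all add: L_add L_scaleR scaleR_fun_apply)

lemma L_chart:
  assumes c: "c \<in> charts_at A p"
  shows "L x p c = dderiv A \<one> (\<lambda>y. snd c (p \<otimes> y)) (unit_vec x)"
proof -
  have p: "p \<in> carrier G" using charts_atD(3)[OF c] by (simp add: mcarrier)
  then show ?thesis
    unfolding L_def ltrans_def using c by (intro differential_dderiv) simp
qed

text \<open>
  In a chart, \<open>L x\<close> is the derivative of the multiplication \<open>(p, y) \<mapsto> p y\<close> in the second factor at the
  unit, which depends smoothly on \<open>p\<close>.
\<close>

lemma L_vector_field: "vector_field A (L x)"
  unfolding vector_field_iff[OF A]
proof (intro ballI conjI)
  fix p assume "p \<in> mcarrier A"
  then have p: "p \<in> carrier G" by (simp add: mcarrier)
  show "L x p \<in> tangent_space A p" by (rule L_tangent[OF p])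
  fix c assume c: "c \<in> charts_at A p"
  have "smooth_map_at (prod_atlas A A) A (\<lambda>z. fst z \<otimes> snd z) (p, \<one>)" by (rule smooth_map_at_mult) (simp_all add: p)
  from smooth_fun_at_comp[OF AA A _ this, of "snd c"]
  have "smooth_fun_at (prod_atlas A A) (\<lambda>z. snd c (fst z \<otimes> snd z)) (p, \<one>)"
    using smooth_fun_at_coord[OF A c] p by simp
  then have "smooth_fun_at A (\<lambda>m. dderiv A \<one> (\<lambda>y. snd c (m \<otimes> y)) (unit_vec x)) p"
    by (rule smooth_fun_at_partial_derivative[OF A A, where Q = "\<lambda>m. \<one>" and d = c0])
       (simp_all add: c0 smooth_map_at_const A p mcarrier unit_vec_tangent smooth_fun_at_const)
  then show "smooth_fun_at A (\<lambda>q. L x q c) p"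
    by (rule smooth_fun_at_transform[OF A])
       (use eventually_mnhds_in_chart[OF A c] in eventually_elim, simp add: L_chart)
qed

lemma L_expand:
  "p \<in> carrier G \<Longrightarrow> L w p c = (\<Sum>i\<in>Basis. (w \<bullet> i) *\<^sub>R L i p c)"
  by (rule has_derivative_basis_expansion[OF L_linear])

lemma smooth_fun_at_L:
  assumes c: "c \<in> charts_at A p" and w: "smooth_fun_at A w p"
  shows "smooth_fun_at A (\<lambda>q. L (w q) q c) p"
proof -
  have p: "p \<in> carrier G" using charts_atD(3)[OF c] by (simp add: mcarrier)
  have "smooth_fun_at A (\<lambda>q. \<Sum>i\<in>Basis. (w q \<bullet> i) *\<^sub>R L i q c) p"
    using p by (intro smooth_fun_at_sum smooth_fun_at_bilinear[OF bounded_bilinear_scaleR] smooth_fun_at_bilinear[OF bounded_bilinear_inner] w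
        smooth_fun_at_const vector_fieldD(2)[OF A L_vector_field c]) (simp_all add: mcarrier)
  then show ?thesis
    by (rule smooth_fun_at_transform[OF A]) (use eventually_carrier[OF p] in eventually_elim, rule L_expand[symmetric])
qed

text \<open>
  The product rule in the frame of the fields \<open>L i\<close>, where \<open>i\<close> runs through the basis.
\<close>

lemma dderiv_L:
  assumes c: "c \<in> charts_at A p" and w: "smooth_fun_at A w p"
  shows "dderiv A p (\<lambda>q. L (w q) q c) v = L (dderiv A p w v) p c + dderiv A p (\<lambda>q. L (w p) q c) v"
proof -
  have p: "p \<in> carrier G" using charts_atD(3)[OF c] by (simp add: mcarrier)
  then have pm: "p \<in> mcarrier A" by (simp add: mcarrier)
  note Ls = vector_fieldD(2)[OF A L_vector_field c]
  have wi: "smooth_fun_at A (\<lambda>q. w q \<bullet> i) p" for i by (intro smooth_fun_at_linear[OF bounded_linear_inner_left] w)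
  have *: "dderiv A p (\<lambda>q. L (u q) q c) v = dderiv A p (\<lambda>q. \<Sum>i\<in>Basis. (u q \<bullet> i) *\<^sub>R L i q c) v" for u
    by (rule dderiv_cong[OF A pm]) (use eventually_carrier[OF p] in eventually_elim, rule L_expand)
  have 1: "dderiv A p (\<lambda>q. L (w q) q c) v =
      (\<Sum>i\<in>Basis. (w p \<bullet> i) *\<^sub>R dderiv A p (\<lambda>q. L i q c) v + (dderiv A p w v \<bullet> i) *\<^sub>R L i p c)"
    unfolding *[of w]
    by (subst dderiv_sum[OF pm])
       (simp_all add: smooth_fun_at_bilinear[OF bounded_bilinear_scaleR] wi Ls
          dderiv_bilinear[OF bounded_bilinear_scaleR wi Ls A] dderiv_linear_comp[OF bounded_linear_inner_left w])
  have 2: "dderiv A p (\<lambda>q. L (w p) q c) v = (\<Sum>i\<in>Basis. (w p \<bullet> i) *\<^sub>R dderiv A p (\<lambda>q. L i q c) v)"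
    unfolding *[of "\<lambda>_. w p"]
    by (subst dderiv_sum[OF pm])
       (simp_all add: smooth_fun_at_linear[OF bounded_linear_scaleR_right] Ls dderiv_linear_comp[OF bounded_linear_scaleR_right Ls])
  show ?thesis
    unfolding 1 2 L_expand[OF p, of "dderiv A p w v" c] by (simp add: sum.distrib)
qed

lemma L_field:
  assumes "\<And>p. p \<in> carrier G \<Longrightarrow> smooth_fun_at A w p"
  shows "vector_field A (\<lambda>q. L (w q) q)"
  unfolding vector_field_iff[OF A] using assms by (auto simp: mcarrier intro!: L_tangent smooth_fun_at_L)

text \<open>
  \<open>th\<close> is the derivative of \<open>(p, y) \<mapsto> p\<^sup>-\<^sup>1 y\<close> in the second factor at \<open>y = p\<close>; so its smoothness
  comes from the smoothness of the group operations.
\<close>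

lemma smooth_fun_at_th:
  assumes X: "vector_field A X" and p: "p \<in> carrier G"
  shows "smooth_fun_at A (\<lambda>q. th q (X q)) p"
proof -
  have pm: "p \<in> mcarrier A" using p by (simp add: mcarrier)
  have c0p: "c0 \<in> charts_at A (inv p \<otimes> p)" using c0 p by simp
  have "smooth_map_at (prod_atlas A A) A (\<lambda>z. inv (fst z) \<otimes> snd z) (p, p)"
    by (intro smooth_map_at_mult_fun smooth_map_at_inv_fun smooth_map_at_fst smooth_map_at_snd AA A pm)
  from smooth_fun_at_comp[OF AA A _ this, of "snd c0"]
  have "smooth_fun_at (prod_atlas A A) (\<lambda>z. snd c0 (inv (fst z) \<otimes> snd z)) (p, p)"
    using smooth_fun_at_coord[OF A c0p] by simp
  then have "smooth_fun_at A (\<lambda>m. dderiv A m (\<lambda>y. snd c0 (inv m \<otimes> y)) (X m)) p"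
    by (rule smooth_fun_at_partial_derivative[OF A A, where Q = "\<lambda>m. m" and d = "chart_at A p"])
       (simp_all add: smooth_map_at_ident A pm eventually_vector_field[OF A X] chart_at_in vector_fieldD(2)[OF A X chart_at_in])
  then show ?thesis
  proof (rule smooth_fun_at_transform[OF A])
    show "\<forall>\<^sub>F q in mnhds A p. dderiv A q (\<lambda>y. snd c0 (inv q \<otimes> y)) (X q) = th q (X q)"
      using eventually_carrier[OF p]
    proof eventually_elim
      case (elim q)
      then have "c0 \<in> charts_at A (inv q \<otimes> q)" using c0 by simp
      from differential_dderiv[of c0 A "\<lambda>y. inv q \<otimes> y" q A "X q", OF this]
      show ?case by (simp add: th_def ltrans_def)
    qed
  qed
qed

lemma eventually_L_th:
  assumes "vector_field A X" "p \<in> carrier G"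
  shows "\<forall>\<^sub>F q in mnhds A p. L (th q (X q)) q = X q"
  using eventually_carrier[OF assms(2)]
  by eventually_elim (rule L_th, simp_all add: vector_fieldD(1)[OF A assms(1)] mcarrier)

text \<open>The structure constants of the Lie algebra, read in the chart \<open>c0\<close>.\<close>

definition br :: "'e \<Rightarrow> 'e \<Rightarrow> 'e" where
  "br x y = bracket A (L x) (L y) \<one> c0"

lemma br_dderiv: "br x y = dderiv A \<one> (\<lambda>q. L y q c0) (unit_vec x) - dderiv A \<one> (\<lambda>q. L x q c0) (unit_vec y)"
  unfolding br_def bracket_dderiv[OF A c0 L_vector_field L_vector_field] by (simp add: L_one)

lemma br_antisym: "br x y = - br y x"
  by (simp add: br_dderiv)

text \<open>
  Left translation by \<open>p\<close> carries the fields \<open>L x\<close> to themselves. Hence the derivations along them at \<open>p\<close>,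
  applied to \<open>F\<close>, are those at the unit, applied to \<open>y \<mapsto> F (p y)\<close>; the same holds for commutators.
\<close>

lemma bracket_L:
  assumes p: "p \<in> carrier G"
  shows "bracket A (L x) (L y) p = L (br x y) p"
proof -
  have pm: "p \<in> mcarrier A" and om: "\<one> \<in> mcarrier A" using p by (simp_all add: mcarrier)
  let ?c = "chart_at A p"
  note c = chart_at_in[OF pm]
  then have c1: "?c \<in> charts_at A (p \<otimes> \<one>)" using p by simp
  note LL = L_vector_field
  let ?F = "\<lambda>z. snd ?c (p \<otimes> z)"
  have F: "smooth_fun_at A ?F \<one>" by (rule smooth_fun_at_comp[OF A A smooth_fun_at_coord[OF A c1] smooth_map_at_lmult]) (simp_all add: p)
  have ev: "\<forall>\<^sub>F q in mnhds A \<one>. dderiv A q ?F (L y q) = L y (p \<otimes> q) ?c" for y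
    using eventually_carrier[OF one_closed] eventually_smooth_map_at[OF smooth_map_at_lmult[OF p one_closed] eventually_mnhds_in_chart[OF A c1]]
  proof eventually_elim
    case (elim q)
    have "dderiv A q ?F (L y q) = dderiv A (p \<otimes> q) (snd ?c) (ltr p q (L y q))"
      by (rule dderiv_ltr[symmetric]) (use elim p smooth_fun_at_coord[OF A] in auto)
    also have "\<dots> = L y (p \<otimes> q) ?c"
      using dderiv_coord[OF A L_tangent elim(2)] elim p by (simp add: ltr_L)
    finally show ?case .
  qed
  have iter: "dderiv A \<one> (\<lambda>q. dderiv A q ?F (L y q)) (L x \<one>) = dderiv A p (\<lambda>q. L y q ?c) (L x p)" for x y
  proof -
    have "dderiv A \<one> (\<lambda>q. dderiv A q ?F (L y q)) (L x \<one>) = dderiv A \<one> (\<lambda>q. L y (p \<otimes> q) ?c) (L x \<one>)"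
      by (rule dderiv_cong[OF A om ev])
    also have "\<dots> = dderiv A (p \<otimes> \<one>) (\<lambda>q. L y q ?c) (ltr p \<one> (L x \<one>))"
      by (rule dderiv_ltr[symmetric]) (use p vector_fieldD(2)[OF A LL c] in simp_all)
    finally show ?thesis using p by (simp add: ltr_L)
  qed
  have "bracket A (L x) (L y) p ?c = dderiv A p (\<lambda>q. L y q ?c) (L x p) - dderiv A p (\<lambda>q. L x q ?c) (L y p)"
    by (rule bracket_dderiv[OF A c LL LL])
  also have "\<dots> = dderiv A \<one> ?F (bracket A (L x) (L y) \<one>)"
    unfolding dderiv_bracket[OF A F LL LL] iter ..
  also have "\<dots> = L (br x y) p ?c"
    unfolding L_chart[OF c] br_def unit_vec_eq[OF bracket_tangent[OF A om LL LL]] ..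
  finally show ?thesis
    by (rule tangent_eqI[OF bracket_tangent[OF A pm LL LL] L_tangent[OF p] c])
qed

text \<open>
  The product rule splits off the derivatives of the coefficients. What remains depends only on the
  values at \<open>p\<close>, and is the bracket of the left-invariant fields with these values.
\<close>

theorem bracket_trivialized:
  assumes X: "vector_field A X" and Y: "vector_field A Y" and p: "p \<in> carrier G"
  shows "bracket A X Y p =
    L (dderiv A p (\<lambda>q. th q (Y q)) (X p) - dderiv A p (\<lambda>q. th q (X q)) (Y p) + br (th p (X p)) (th p (Y p))) p"
proof -
  have pm: "p \<in> mcarrier A" using p by (simp_all add: mcarrier)
  let ?c = "chart_at A p"
  note c = chart_at_in[OF pm]
  note LL = L_vector_field
  have d: "dderiv A p (\<lambda>q. Y q ?c) v = L (dderiv A p (\<lambda>q. th q (Y q)) v) p ?c + dderiv A p (\<lambda>q. L (th p (Y p)) q ?c) v"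
    if Y: "vector_field A Y" for Y v
  proof -
    have "dderiv A p (\<lambda>q. Y q ?c) v = dderiv A p (\<lambda>q. L (th q (Y q)) q ?c) v"
      by (rule dderiv_cong[OF A pm]) (use eventually_L_th[OF Y p] in eventually_elim, simp)
    then show ?thesis using dderiv_L[OF c smooth_fun_at_th[OF Y p]] by simp
  qed
  have e: "X p = L (th p (X p)) p" "Y p = L (th p (Y p)) p"
    using L_th[OF p] vector_fieldD(1)[OF A X pm] vector_fieldD(1)[OF A Y pm] by simp_all
  have "dderiv A p (\<lambda>q. L (th p (Y p)) q ?c) (X p) - dderiv A p (\<lambda>q. L (th p (X p)) q ?c) (Y p) =
      dderiv A p (\<lambda>q. L (th p (Y p)) q ?c) (L (th p (X p)) p) - dderiv A p (\<lambda>q. L (th p (X p)) q ?c) (L (th p (Y p)) p)"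
    using e by simp
  also have "\<dots> = L (br (th p (X p)) (th p (Y p))) p ?c"
    unfolding bracket_dderiv[OF A c LL LL, symmetric] bracket_L[OF p] ..
  finally have "bracket A X Y p ?c =
      L (dderiv A p (\<lambda>q. th q (Y q)) (X p) - dderiv A p (\<lambda>q. th q (X q)) (Y p) + br (th p (X p)) (th p (Y p))) p ?c"
    unfolding bracket_dderiv[OF A c X Y] d[OF X] d[OF Y] L_add[OF p] L_diff[OF p] by simp
  then show ?thesis
    by (rule tangent_eqI[OF bracket_tangent[OF A pm X Y] L_tangent[OF p] c])
qed

end

section \<open>Left-invariant structures and their linear algebra\<close>

lemma vector_field_cong:
  assumes A: "atlas A" and X: "vector_field A X" and eq: "\<And>p. p \<in> mcarrier A \<Longrightarrow> X p = Y p"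
  shows "vector_field A Y"
  unfolding vector_field_iff[OF A]
proof (intro ballI conjI)
  fix p assume p: "p \<in> mcarrier A"
  show "Y p \<in> tangent_space A p" using vector_fieldD(1)[OF A X p] eq[OF p] by simp
  fix c assume c: "c \<in> charts_at A p"
  show "smooth_fun_at A (\<lambda>q. Y q c) p"
    by (rule smooth_fun_at_transform[OF A vector_fieldD(2)[OF A X c]])
       (use eventually_mnhds_mcarrier[OF A p] in eventually_elim, simp add: eq)
qed

lemma vector_field_add:
  assumes A: "atlas A" and X: "vector_field A X" and Y: "vector_field A Y"
  shows "vector_field A (\<lambda>q. X q + Y q)"
  unfolding vector_field_iff[OF A]
  using vector_fieldD[OF A X] vector_fieldD[OF A Y] by (simp add: tangent_add[OF A] smooth_fun_at_add)

lemma vector_field_scaleR: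
  assumes A: "atlas A" and X: "vector_field A X" and f: "smooth_fun A f"
  shows "vector_field A (\<lambda>q. f q *\<^sub>R X q)"
  unfolding vector_field_iff[OF A]
  using vector_fieldD[OF A X] f[unfolded smooth_fun_iff[OF A]]
  by (simp add: tangent_scaleR[OF A] smooth_fun_at_bilinear[OF bounded_bilinear_scaleR] scaleR_fun_apply)

text \<open>
  A connection sees only the values of the fields on the manifold: multiplying by the
  indicator function of \<open>mcarrier A\<close> forgets all other values.
\<close>

lemma smooth_fun_indicator:
  assumes A: "atlas A"
  shows "smooth_fun A (\<lambda>q. if q \<in> mcarrier A then 1 else 0)"
  unfolding smooth_fun_iff[OF A]
proof
  fix p assume p: "p \<in> mcarrier A"
  show "smooth_fun_at A (\<lambda>q. if q \<in> mcarrier A then 1 else 0 :: real) p"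
    by (rule smooth_fun_at_transform[OF A smooth_fun_at_const[OF p, of 1]])
       (use eventually_mnhds_mcarrier[OF A p] in eventually_elim, simp)
qed

lemma connectionD:
  assumes "connection A D" "vector_field A X" "vector_field A Y" "vector_field A Z" "smooth_fun A f" "p \<in> mcarrier A"
  shows "D (\<lambda>q. X q + Y q) Z p = D X Z p + D Y Z p"
    and "D (\<lambda>q. f q *\<^sub>R X q) Z p = f p *\<^sub>R D X Z p"
    and "D X (\<lambda>q. Y q + Z q) p = D X Y p + D X Z p"
    and "D X (\<lambda>q. f q *\<^sub>R Y q) p = f p *\<^sub>R D X Y p + vf_deriv A X f p *\<^sub>R Y p"
  using assms unfolding connection_def by blast+

lemma connection_cong:
  assumes A: "atlas A" and D: "connection A D"
    and X: "vector_field A X" "vector_field A X'" and Y: "vector_field A Y" "vector_field A Y'"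
    and eq: "\<And>p. p \<in> mcarrier A \<Longrightarrow> X p = X' p" "\<And>p. p \<in> mcarrier A \<Longrightarrow> Y p = Y' p"
    and p: "p \<in> mcarrier A"
  shows "D X Y p = D X' Y' p"
proof -
  define f :: "'a \<Rightarrow> real" where "f = (\<lambda>q. if q \<in> mcarrier A then 1 else 0)"
  have f: "smooth_fun A f" unfolding f_def by (rule smooth_fun_indicator[OF A])
  have fp: "f p = 1" using p by (simp add: f_def)
  have "dderiv A p f (X' p) = dderiv A p (\<lambda>q. 1) (X' p)"
    by (rule dderiv_cong[OF A p]) (use eventually_mnhds_mcarrier[OF A p] in eventually_elim, simp add: f_def)
  then have fd: "vf_deriv A X' f p = 0" by (simp add: vf_deriv_def dir_deriv_dderiv)
  have e1: "(\<lambda>q. f q *\<^sub>R X q) = (\<lambda>q. f q *\<^sub>R X' q)" and e2: "(\<lambda>q. f q *\<^sub>R Y q) = (\<lambda>q. f q *\<^sub>R Y' q)"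
    by (simp_all add: fun_eq_iff f_def eq scaleR_fun_def)
  have "D X Y p = D (\<lambda>q. f q *\<^sub>R X q) Y p" using connectionD(2)[OF D X(1) Y(1) Y(1) f p] fp by simp
  also have "\<dots> = D X' Y p" unfolding e1 using connectionD(2)[OF D X(2) Y(1) Y(1) f p] fp by simp
  also have "\<dots> = D X' (\<lambda>q. f q *\<^sub>R Y q) p"
    using connectionD(4)[OF D X(2) Y(1) Y(1) f p] fp fd by (simp add: scaleR_fun_def zero_fun_def plus_fun_def)
  also have "\<dots> = D X' Y' p"
    unfolding e2 using connectionD(4)[OF D X(2) Y(2) Y(2) f p] fp fd
    by (simp add: scaleR_fun_def zero_fun_def plus_fun_def)
  finally show ?thesis .
qed

text \<open>
  A left-invariant structure described by linear algebra on the model space. There are two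
  instances: \<open>G\<close> with the values of the structure at the unit, and the tangent group
  with their extension to pairs.
\<close>

locale invariant_hermitian = lie_group_chart G A c0
  for G :: "('a, 'm) monoid_scheme" (structure)
    and A :: "('a, 'e::euclidean_space) chart set" and c0 +
  fixes g :: "('a, 'e) metric_field" and J :: "('a, 'e) endo_field"
    and gam :: "'e \<Rightarrow> 'e \<Rightarrow> real" and j :: "'e \<Rightarrow> 'e"
  assumes gam: "bounded_bilinear gam" and j: "bounded_linear j"
    and gam_sym: "gam x y = gam y x"
    and gam_nondeg: "(\<And>y. gam x y = 0) \<Longrightarrow> x = 0"
    and jj: "j (j x) = - x"
    and gam_j: "gam (j x) (j y) = gam x y"
    and g_eq: "p \<in> carrier G \<Longrightarrow> u \<in> tangent_space A p \<Longrightarrow> v \<in> tangent_space A p \<Longrightarrow>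
      g p u v = gam (th p u) (th p v)"
    and J_eq: "p \<in> carrier G \<Longrightarrow> u \<in> tangent_space A p \<Longrightarrow> J p u = L (j (th p u)) p"
begin

lemma linear_j: "linear j"
  using j by (rule bounded_linear.linear)

lemmas gam_add = bounded_bilinear.add_left[OF gam] bounded_bilinear.add_right[OF gam]
lemmas gam_diff = bounded_bilinear.diff_left[OF gam] bounded_bilinear.diff_right[OF gam]
lemmas gam_scaleR = bounded_bilinear.scaleR_left[OF gam] bounded_bilinear.scaleR_right[OF gam]
lemmas gam_minus = bounded_bilinear.minus_left[OF gam] bounded_bilinear.minus_right[OF gam]
lemmas j_simps = linear_add[OF linear_j] linear_diff[OF linear_j] linear_neg[OF linear_j] linear_cmul[OF linear_j] jj

lemma J_tangent: "p \<in> carrier G \<Longrightarrow> u \<in> tangent_space A p \<Longrightarrow> J p u \<in> tangent_space A p"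
  by (simp add: J_eq L_tangent)

lemma th_J: "p \<in> carrier G \<Longrightarrow> u \<in> tangent_space A p \<Longrightarrow> th p (J p u) = j (th p u)"
  by (simp add: J_eq th_L)

lemma J_L: "p \<in> carrier G \<Longrightarrow> J p (L x p) = L (j x) p"
  by (simp add: J_eq L_tangent th_L)

lemma vf_tangent: "vector_field A X \<Longrightarrow> p \<in> carrier G \<Longrightarrow> X p \<in> tangent_space A p"
  using vector_fieldD(1)[OF A] by (simp add: mcarrier)

lemma J_vector_field:
  assumes X: "vector_field A X"
  shows "vector_field A (\<lambda>q. J q (X q))"
proof (rule vector_field_cong[OF A])
  show "vector_field A (\<lambda>q. L (j (th q (X q))) q)"
    by (intro L_field smooth_fun_at_linear[OF j] smooth_fun_at_th[OF X])
qed (simp add: J_eq mcarrier vf_tangent[OF X])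

lemma pseudo_metric_g: "pseudo_metric A g"
  unfolding pseudo_metric_def mcarrier
proof (intro conjI ballI allI impI)
  fix p u v w r
  assume p: "p \<in> carrier G" and u: "u \<in> tangent_space A p" and v: "v \<in> tangent_space A p"
  show "g p u v = g p v u" using p u v by (simp add: g_eq gam_sym)
  assume w: "w \<in> tangent_space A p"
  show "g p (r *\<^sub>R u + v) w = r * g p u w + g p v w"
    using p u v w by (simp add: g_eq tangent_add[OF A] tangent_scaleR[OF A] th_add th_scaleR gam_add gam_scaleR)
next
  fix p u
  assume p: "p \<in> carrier G" and u: "u \<in> tangent_space A p" and *: "\<forall>v\<in>tangent_space A p. g p u v = 0"
  have "gam (th p u) y = 0" for y
    using *[rule_format, OF L_tangent[OF p, of y]] p u by (simp add: g_eq L_tangent th_L)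
  then have "th p u = 0" by (rule gam_nondeg)
  then show "u = 0" using L_th[OF p u] L_zero[OF p] by simp
next
  fix X Y assume X: "vector_field A X" and Y: "vector_field A Y"
  show "smooth_fun A (\<lambda>p. g p (X p) (Y p))"
    unfolding smooth_fun_iff[OF A] mcarrier
  proof
    fix p assume p: "p \<in> carrier G"
    have "smooth_fun_at A (\<lambda>q. gam (th q (X q)) (th q (Y q))) p"
      by (intro smooth_fun_at_bilinear[OF gam] smooth_fun_at_th X Y p)
    then show "smooth_fun_at A (\<lambda>p. g p (X p) (Y p)) p"
      by (rule smooth_fun_at_transform[OF A])
         (use eventually_carrier[OF p] in eventually_elim, simp add: g_eq vf_tangent X Y)
  qed
qed

lemma almost_complex_J: "almost_complex A J"
  unfolding almost_complex_def mcarrier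
  using J_vector_field
  by (auto simp: J_tangent J_eq th_L L_tangent jj L_uminus L_th th_add th_scaleR L_add L_scaleR j_simps
      tangent_add[OF A] tangent_scaleR[OF A])

lemma almost_pseudo_hermitian_gJ: "almost_pseudo_hermitian A g J"
  unfolding almost_pseudo_hermitian_def mcarrier
  using pseudo_metric_g almost_complex_J by (auto simp: J_tangent g_eq th_J gam_j)

lemma left_invariant_gJ: "left_invariant_aph G A g J"
  unfolding left_invariant_aph_def left_invariant_metric_def left_invariant_endo_def
  using almost_pseudo_hermitian_gJ by (auto simp: g_eq J_eq ltr_tangent th_ltr ltr_L)

text \<open>
  In the trivialization, an invariant connection is the sum of the flat derivative and of a bilinear map
  \<open>B\<close> on the Lie algebra; it is the Levi-Civita connection when \<open>B\<close> satisfies the two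
  conditions of \<open>algebraic_levi_civita\<close>.
\<close>

definition invariant_connection :: "('e \<Rightarrow> 'e \<Rightarrow> 'e) \<Rightarrow> ('a, 'e) vfield \<Rightarrow> ('a, 'e) vfield \<Rightarrow> ('a, 'e) vfield" where
  "invariant_connection B X Y p =
     L (dderiv A p (\<lambda>q. th q (Y q)) (X p) + B (th p (X p)) (th p (Y p))) p"

definition algebraic_levi_civita :: "('e \<Rightarrow> 'e \<Rightarrow> 'e) \<Rightarrow> bool" where
  "algebraic_levi_civita B \<longleftrightarrow> bounded_bilinear B \<and> (\<forall>x y. B x y - B y x = br x y) \<and>
     (\<forall>x y z. gam (B x y) z + gam y (B x z) = 0)"

lemma connection_invariant:
  assumes B: "bounded_bilinear B"
  shows "connection A (invariant_connection B)"
  unfolding connection_def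
proof (intro conjI allI impI ballI)
  fix X Y assume X: "vector_field A X" and Y: "vector_field A Y"
  show "vector_field A (invariant_connection B X Y)"
    unfolding invariant_connection_def[abs_def]
    by (intro L_field smooth_fun_at_add smooth_fun_at_bilinear[OF B] smooth_fun_at_dderiv_vector_field[OF A] smooth_fun_at_th X Y)
next
  fix X Y Z f p
  assume X: "vector_field A X" and Y: "vector_field A Y" and Z: "vector_field A Z" and f: "smooth_fun A f"
    and pm: "p \<in> mcarrier A"
  have p: "p \<in> carrier G" using pm by (simp add: mcarrier)
  have fp: "smooth_fun_at A f p" using f pm by (simp add: smooth_fun_iff[OF A])
  note B_simps = bounded_bilinear.add_left[OF B] bounded_bilinear.add_right[OF B]
    bounded_bilinear.scaleR_left[OF B] bounded_bilinear.scaleR_right[OF B]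
  show "invariant_connection B (\<lambda>q. X q + Y q) Z p = invariant_connection B X Z p + invariant_connection B Y Z p"
    by (simp add: invariant_connection_def dderiv_add_vec[OF smooth_fun_at_th[OF Z p]] th_add[OF p] B_simps L_add[OF p, symmetric]
        algebra_simps)
  show "invariant_connection B (\<lambda>q. f q *\<^sub>R X q) Z p = f p *\<^sub>R invariant_connection B X Z p"
    by (simp add: invariant_connection_def dderiv_scaleR_vec[OF smooth_fun_at_th[OF Z p]] th_scaleR[OF p] B_simps
        L_scaleR[OF p, symmetric] scaleR_add_right)
  have "dderiv A p (\<lambda>q. th q (Y q + Z q)) (X p) = dderiv A p (\<lambda>q. th q (Y q) + th q (Z q)) (X p)"
    by (rule dderiv_cong[OF A pm]) (use eventually_carrier[OF p] in eventually_elim, rule th_add)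
  then show "invariant_connection B X (\<lambda>q. Y q + Z q) p = invariant_connection B X Y p + invariant_connection B X Z p"
    by (simp add: invariant_connection_def dderiv_add[OF smooth_fun_at_th[OF Y p] smooth_fun_at_th[OF Z p]] th_add[OF p] B_simps
        L_add[OF p, symmetric] algebra_simps)
  have "dderiv A p (\<lambda>q. th q (f q *\<^sub>R Y q)) (X p) = dderiv A p (\<lambda>q. f q *\<^sub>R th q (Y q)) (X p)"
    by (rule dderiv_cong[OF A pm]) (use eventually_carrier[OF p] in eventually_elim, rule th_scaleR)
  also have "\<dots> = f p *\<^sub>R dderiv A p (\<lambda>q. th q (Y q)) (X p) + dderiv A p f (X p) *\<^sub>R th p (Y p)"
    by (rule dderiv_bilinear[OF bounded_bilinear_scaleR fp smooth_fun_at_th[OF Y p] A])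
  finally have "invariant_connection B X (\<lambda>q. f q *\<^sub>R Y q) p =
      L (f p *\<^sub>R (dderiv A p (\<lambda>q. th q (Y q)) (X p) + B (th p (X p)) (th p (Y p))) + dderiv A p f (X p) *\<^sub>R th p (Y p)) p"
    by (simp add: invariant_connection_def th_scaleR[OF p] B_simps algebra_simps)
  then show "invariant_connection B X (\<lambda>q. f q *\<^sub>R Y q) p =
      f p *\<^sub>R invariant_connection B X Y p + vf_deriv A X f p *\<^sub>R Y p"
    by (simp add: L_add[OF p] L_scaleR[OF p] invariant_connection_def vf_deriv_def dir_deriv_dderiv
        L_th[OF p vf_tangent[OF Y p]])
qed

lemma levi_civita_invariant:
  assumes "algebraic_levi_civita B"
  shows "levi_civita A g (invariant_connection B)"
proof -
  have B: "bounded_bilinear B" and tor: "\<And>x y. B x y - B y x = br x y"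
    and met: "\<And>x y z. gam (B x y) z + gam y (B x z) = 0"
    using assms by (auto simp: algebraic_levi_civita_def)
  show ?thesis
    unfolding levi_civita_def mcarrier
  proof (intro conjI allI impI ballI connection_invariant B)
    fix X Y p assume X: "vector_field A X" and Y: "vector_field A Y" and p: "p \<in> carrier G"
    show "invariant_connection B X Y p - invariant_connection B Y X p = bracket A X Y p"
      by (simp add: invariant_connection_def bracket_trivialized[OF X Y p] L_diff[OF p, symmetric] tor[symmetric]
          algebra_simps)
  next
    fix X Y Z p
    assume X: "vector_field A X" and Y: "vector_field A Y" and Z: "vector_field A Z" and p: "p \<in> carrier G"
    have "dderiv A p (\<lambda>q. g q (Y q) (Z q)) (X p) = dderiv A p (\<lambda>q. gam (th q (Y q)) (th q (Z q))) (X p)"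
      using p by (intro dderiv_cong[OF A])
         (simp add: mcarrier, use eventually_carrier[OF p] in eventually_elim, simp add: g_eq vf_tangent Y Z)
    also have "\<dots> = gam (th p (Y p)) (dderiv A p (\<lambda>q. th q (Z q)) (X p)) + gam (dderiv A p (\<lambda>q. th q (Y q)) (X p)) (th p (Z p))"
      by (rule dderiv_bilinear[OF gam smooth_fun_at_th[OF Y p] smooth_fun_at_th[OF Z p] A])
    finally show "vf_deriv A X (\<lambda>q. g q (Y q) (Z q)) p =
        g p (invariant_connection B X Y p) (Z p) + g p (Y p) (invariant_connection B X Z p)"
      using met[of "th p (X p)" "th p (Y p)" "th p (Z p)"]
      by (simp add: vf_deriv_def dir_deriv_dderiv invariant_connection_def g_eq p L_tangent vf_tangent X Y Z th_L gam_add)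
  qed
qed

lemma dderiv_th_J:
  assumes X: "vector_field A X" and p: "p \<in> carrier G"
  shows "dderiv A p (\<lambda>q. th q (J q (X q))) v = j (dderiv A p (\<lambda>q. th q (X q)) v)"
proof -
  have "dderiv A p (\<lambda>q. th q (J q (X q))) v = dderiv A p (\<lambda>q. j (th q (X q))) v"
    using p by (intro dderiv_cong[OF A])
       (simp add: mcarrier, use eventually_carrier[OF p] in eventually_elim, simp add: th_J vf_tangent X)
  then show ?thesis using dderiv_linear_comp[OF j smooth_fun_at_th[OF X p]] by simp
qed

lemma nearly_pseudo_kahlerI:
  assumes B: "algebraic_levi_civita B" and n: "\<And>x. B x (j x) = j (B x x)"
  shows "nearly_pseudo_kahler A g J"
  unfolding nearly_pseudo_kahler_def mcarrier
proof (intro conjI exI[of _ "invariant_connection B"] almost_pseudo_hermitian_gJ levi_civita_invariant B allI impI ballI)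
  fix X p assume X: "vector_field A X" and p: "p \<in> carrier G"
  show "covariant_deriv_endo (invariant_connection B) J X X p = 0"
    by (simp add: covariant_deriv_endo_def invariant_connection_def dderiv_th_J[OF X p] th_J p vf_tangent X n J_L[OF p]
        j_simps)
qed

text \<open>
  \<open>B\<close> is the given connection on left-invariant fields at the unit. Since \<open>g\<close> is constant on
  such fields and \<open>J\<close> maps them to such fields, the conditions on the connection lose their derivative terms.
\<close>

lemma nearly_pseudo_kahlerE:
  assumes "nearly_pseudo_kahler A g J"
  obtains B where "algebraic_levi_civita B" "\<And>x. B x (j x) = j (B x x)"
proof -
  obtain D where D: "levi_civita A g D"
    and nk: "\<And>X p. vector_field A X \<Longrightarrow> p \<in> mcarrier A \<Longrightarrow> covariant_deriv_endo D J X X p = 0"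
    using assms unfolding nearly_pseudo_kahler_def by blast
  have con: "connection A D" using D by (simp add: levi_civita_def)
  have om: "\<one> \<in> mcarrier A" by (simp add: mcarrier)
  define B where "B x y = th \<one> (D (L x) (L y) \<one>)" for x y
  note LL = L_vector_field
  have Dt: "D (L x) (L y) \<one> \<in> tangent_space A \<one>" for x y
    by (rule vector_fieldD(1)[OF A _ om]) (use con LL in \<open>simp add: connection_def\<close>)
  have cs: "smooth_fun A (\<lambda>q. r)" for r by (simp add: smooth_fun_iff[OF A] smooth_fun_at_const)
  have add1: "B (x + x') y = B x y + B x' y" for x x' y
  proof -
    have "D (L (x + x')) (L y) \<one> = D (\<lambda>q. L x q + L x' q) (L y) \<one>"
      by (rule connection_cong[OF A con LL vector_field_add[OF A LL LL] LL LL]) (simp_all add: mcarrier L_add)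
    then show ?thesis
      using connectionD(1)[OF con LL LL LL cs om] by (simp add: B_def th_add)
  qed
  have add2: "B y (x + x') = B y x + B y x'" for x x' y
  proof -
    have "D (L y) (L (x + x')) \<one> = D (L y) (\<lambda>q. L x q + L x' q) \<one>"
      by (rule connection_cong[OF A con LL LL LL vector_field_add[OF A LL LL]]) (simp_all add: mcarrier L_add)
    then show ?thesis
      using connectionD(3)[OF con LL LL LL cs om] by (simp add: B_def th_add)
  qed
  have sc1: "B (r *\<^sub>R x) y = r *\<^sub>R B x y" for r x y
  proof -
    have "D (L (r *\<^sub>R x)) (L y) \<one> = D (\<lambda>q. r *\<^sub>R L x q) (L y) \<one>"
      by (rule connection_cong[OF A con LL vector_field_scaleR[OF A LL cs] LL LL]) (simp_all add: mcarrier L_scaleR)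
    also have "\<dots> = r *\<^sub>R D (L x) (L y) \<one>"
      by (rule connectionD(2)[OF con LL LL LL cs om])
    finally show ?thesis by (simp add: B_def th_scaleR)
  qed
  have sc2: "B y (r *\<^sub>R x) = r *\<^sub>R B y x" for r x y
  proof -
    have "D (L y) (L (r *\<^sub>R x)) \<one> = D (L y) (\<lambda>q. r *\<^sub>R L x q) \<one>"
      by (rule connection_cong[OF A con LL LL LL vector_field_scaleR[OF A LL cs]]) (simp_all add: mcarrier L_scaleR)
    also have "\<dots> = r *\<^sub>R D (L y) (L x) \<one> + vf_deriv A (L y) (\<lambda>q. r) \<one> *\<^sub>R L x \<one>"
      by (rule connectionD(4)[OF con LL LL LL cs om])
    also have "vf_deriv A (L y) (\<lambda>q. r) \<one> = 0" by (simp add: vf_deriv_def dir_deriv_dderiv)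
    finally show ?thesis by (simp add: B_def th_add th_scaleR)
  qed
  have "bilinear B" unfolding bilinear_def by (auto intro!: linearI simp: add1 add2 sc1 sc2)
  then have bil: "bounded_bilinear B" by (simp add: bilinear_conv_bounded_bilinear)
  have tor: "B x y - B y x = br x y" for x y
  proof -
    have "D (L x) (L y) \<one> - D (L y) (L x) \<one> = bracket A (L x) (L y) \<one>"
      using D LL om unfolding levi_civita_def by blast
    then have "D (L x) (L y) \<one> = D (L y) (L x) \<one> + bracket A (L x) (L y) \<one>" by (metis diff_add_cancel add.commute)
    then show ?thesis by (simp add: B_def th_add bracket_L th_L)
  qed
  have met: "gam (B x y) z + gam y (B x z) = 0" for x y z
  proof -
    have "vf_deriv A (L x) (\<lambda>q. g q (L y q) (L z q)) \<one> = g \<one> (D (L x) (L y) \<one>) (L z \<one>) + g \<one> (L y \<one>) (D (L x) (L z) \<one>)"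
      using D LL om unfolding levi_civita_def by blast
    moreover have "dderiv A \<one> (\<lambda>q. g q (L y q) (L z q)) (L x \<one>) = dderiv A \<one> (\<lambda>q. gam y z) (L x \<one>)"
      by (rule dderiv_cong[OF A om])
         (use eventually_carrier[OF one_closed] in eventually_elim, simp add: g_eq L_tangent th_L)
    ultimately show ?thesis
      by (simp add: vf_deriv_def dir_deriv_dderiv g_eq Dt L_tangent th_L B_def)
  qed
  have near: "B x (j x) = j (B x x)" for x
  proof -
    have "D (L x) (L (j x)) \<one> = D (L x) (\<lambda>q. J q (L x q)) \<one>"
      by (rule connection_cong[OF A con LL LL LL J_vector_field[OF LL]]) (simp_all add: mcarrier J_L)
    also have "\<dots> = J \<one> (D (L x) (L x) \<one>)"
      using nk[OF LL om, of x] by (simp add: covariant_deriv_endo_def)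
    finally show ?thesis using th_J[OF one_closed Dt] by (simp add: B_def)
  qed
  have "algebraic_levi_civita B" unfolding algebraic_levi_civita_def using bil tor met by blast
  then show ?thesis by (rule that) (rule near)
qed

definition algebraic_nijenhuis :: "'e \<Rightarrow> 'e \<Rightarrow> 'e" where
  "algebraic_nijenhuis x y = j (br (j x) y) + j (br x (j y)) + br x y - br (j x) (j y)"

text \<open>
  Since \<open>j\<close> is constant in the trivialization and \<open>j\<^sup>2 = -1\<close>, the derivatives of the coefficients along
  \<open>X\<close>, \<open>Y\<close>, \<open>J X\<close> and \<open>J Y\<close> cancel in pairs.
\<close>

lemma nijenhuis_trivialized:
  assumes X: "vector_field A X" and Y: "vector_field A Y" and p: "p \<in> carrier G"
  shows "nijenhuis A J X Y p = L (algebraic_nijenhuis (th p (X p)) (th p (Y p))) p"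
proof -
  note JX = J_vector_field[OF X] and JY = J_vector_field[OF Y]
  have simps: "th p (J p (X p)) = j (th p (X p))" "th p (J p (Y p)) = j (th p (Y p))"
    using p by (simp_all add: th_J vf_tangent X Y)
  show ?thesis
    unfolding nijenhuis_def bracket_trivialized[OF JX Y p] bracket_trivialized[OF X JY p]
      bracket_trivialized[OF X Y p] bracket_trivialized[OF JX JY p] J_L[OF p]
      L_add[OF p, symmetric] L_diff[OF p, symmetric] dderiv_th_J[OF X p] dderiv_th_J[OF Y p] simps
    by (rule arg_cong[of _ _ "\<lambda>z. L z p"]) (simp add: algebraic_nijenhuis_def j_simps)
qed

lemma integrable_iff: "integrable_complex A J \<longleftrightarrow> (\<forall>x y. algebraic_nijenhuis x y = 0)"
proof
  assume I: "integrable_complex A J"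
  show "\<forall>x y. algebraic_nijenhuis x y = 0"
  proof (intro allI)
    fix x y
    have "nijenhuis A J (L x) (L y) \<one> = 0"
      using I L_vector_field one_closed unfolding integrable_complex_def mcarrier by blast
    then have "th \<one> (L (algebraic_nijenhuis x y) \<one>) = th \<one> (L 0 \<one>)"
      by (simp add: nijenhuis_trivialized[OF L_vector_field L_vector_field one_closed] th_L L_zero)
    then show "algebraic_nijenhuis x y = 0" by (simp add: th_L)
  qed
next
  assume "\<forall>x y. algebraic_nijenhuis x y = 0"
  then show "integrable_complex A J"
    unfolding integrable_complex_def mcarrier by (simp add: nijenhuis_trivialized L_zero)
qed

definition algebraic_d_omega :: "'e \<Rightarrow> 'e \<Rightarrow> 'e \<Rightarrow> real" where
  "algebraic_d_omega x y z = - gam (j (br x y)) z + gam (j (br x z)) y - gam (j (br y z)) x"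

lemma omega_antisym: "gam (j x) y = - gam (j y) x"
proof -
  have "gam (j x) y = gam (j (j x)) (j y)" by (simp add: gam_j)
  then show ?thesis by (simp add: jj gam_minus gam_sym[of x])
qed

text \<open>
  Each derivative of a coefficient occurs once in a differentiated value of \<open>\<omega>\<close> and once in a bracket;
  the two terms cancel, some of them by the antisymmetry of \<open>\<omega>\<close>.
\<close>

lemma ext_deriv2_trivialized:
  assumes X: "vector_field A X" and Y: "vector_field A Y" and Z: "vector_field A Z" and p: "p \<in> carrier G"
  shows "ext_deriv2 A (fundamental_form g J) X Y Z p =
    algebraic_d_omega (th p (X p)) (th p (Y p)) (th p (Z p))"
proof -
  have om: "fundamental_form g J q u v = gam (j (th q u)) (th q v)"
    if "q \<in> carrier G" "u \<in> tangent_space A q" "v \<in> tangent_space A q" for q u v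
    using that by (simp add: fundamental_form_def g_eq J_tangent th_J)
  have d: "vf_deriv A X (\<lambda>q. fundamental_form g J q (Y q) (Z q)) p =
      gam (j (th p (Y p))) (dderiv A p (\<lambda>q. th q (Z q)) (X p)) + gam (j (dderiv A p (\<lambda>q. th q (Y q)) (X p))) (th p (Z p))"
    if Y: "vector_field A Y" and Z: "vector_field A Z" for X Y Z
  proof -
    have "dderiv A p (\<lambda>q. fundamental_form g J q (Y q) (Z q)) (X p) = dderiv A p (\<lambda>q. gam (j (th q (Y q))) (th q (Z q))) (X p)"
      using p by (intro dderiv_cong[OF A])
         (simp add: mcarrier, use eventually_carrier[OF p] in eventually_elim, simp add: om vf_tangent Y Z)
    also have "\<dots> = gam (j (th p (Y p))) (dderiv A p (\<lambda>q. th q (Z q)) (X p)) +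
        gam (dderiv A p (\<lambda>q. j (th q (Y q))) (X p)) (th p (Z p))"
      by (rule dderiv_bilinear[OF gam smooth_fun_at_linear[OF j smooth_fun_at_th[OF Y p]] smooth_fun_at_th[OF Z p] A])
    finally show ?thesis by (simp add: vf_deriv_def dir_deriv_dderiv dderiv_linear_comp[OF j smooth_fun_at_th[OF Y p]])
  qed
  define a b c where "a v = dderiv A p (\<lambda>q. th q (X q)) v" and "b v = dderiv A p (\<lambda>q. th q (Y q)) v"
    and "c v = dderiv A p (\<lambda>q. th q (Z q)) v" for v
  show ?thesis
    unfolding ext_deriv2_def d[OF Y Z] d[OF X Z] d[OF X Y]
      bracket_trivialized[OF X Y p] bracket_trivialized[OF X Z p] bracket_trivialized[OF Y Z p]
      om[OF p L_tangent[OF p] vf_tangent[OF X p]] om[OF p L_tangent[OF p] vf_tangent[OF Y p]]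
      om[OF p L_tangent[OF p] vf_tangent[OF Z p]] th_L[OF p]
      a_def[symmetric] b_def[symmetric] c_def[symmetric] algebraic_d_omega_def
    using omega_antisym[of "c (X p)" "th p (Y p)"] omega_antisym[of "c (Y p)" "th p (X p)"]
      omega_antisym[of "b (Z p)" "th p (X p)"]
    by (simp add: j_simps gam_add gam_diff)
qed

lemma closed_iff: "closed_form2 A (fundamental_form g J) \<longleftrightarrow> (\<forall>x y z. algebraic_d_omega x y z = 0)"
proof
  assume C: "closed_form2 A (fundamental_form g J)"
  show "\<forall>x y z. algebraic_d_omega x y z = 0"
  proof (intro allI)
    fix x y z
    have "ext_deriv2 A (fundamental_form g J) (L x) (L y) (L z) \<one> = 0"
      using C L_vector_field one_closed unfolding closed_form2_def mcarrier by blast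
    then show "algebraic_d_omega x y z = 0"
      by (simp add: ext_deriv2_trivialized L_vector_field th_L)
  qed
next
  assume "\<forall>x y z. algebraic_d_omega x y z = 0"
  then show "closed_form2 A (fundamental_form g J)"
    unfolding closed_form2_def mcarrier by (simp add: ext_deriv2_trivialized)
qed

end

lemma pseudo_metricD:
  assumes "pseudo_metric A g" "p \<in> mcarrier A"
  shows "u \<in> tangent_space A p \<Longrightarrow> v \<in> tangent_space A p \<Longrightarrow> g p u v = g p v u"
    and "u \<in> tangent_space A p \<Longrightarrow> v \<in> tangent_space A p \<Longrightarrow> w \<in> tangent_space A p \<Longrightarrow>
      g p (r *\<^sub>R u + v) w = r * g p u w + g p v w"
    and "u \<in> tangent_space A p \<Longrightarrow> (\<And>v. v \<in> tangent_space A p \<Longrightarrow> g p u v = 0) \<Longrightarrow> u = 0"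
  using assms unfolding pseudo_metric_def by simp_all

lemma almost_complexD:
  assumes "almost_complex A J" "p \<in> mcarrier A"
  shows "u \<in> tangent_space A p \<Longrightarrow> J p u \<in> tangent_space A p"
    and "u \<in> tangent_space A p \<Longrightarrow> J p (J p u) = - u"
    and "u \<in> tangent_space A p \<Longrightarrow> v \<in> tangent_space A p \<Longrightarrow> J p (r *\<^sub>R u + v) = r *\<^sub>R J p u + J p v"
  using assms unfolding almost_complex_def by simp_all

text \<open>
  Every tangent vector is a left translate of one at the unit, so the linear algebra at the unit describes the
  whole structure.
\<close>

lemma (in lie_group_chart) invariant_hermitian_at_unit:
  assumes "left_invariant_aph G A g J"
  shows "invariant_hermitian G A c0 g J (\<lambda>x y. g \<one> (unit_vec x) (unit_vec y)) (\<lambda>x. J \<one> (unit_vec x) c0)"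
proof -
  have om: "\<one> \<in> mcarrier A" by (simp add: mcarrier)
  have aph: "almost_pseudo_hermitian A g J" and gi: "left_invariant_metric G A g" and Ji: "left_invariant_endo G A J"
    using assms by (simp_all only: left_invariant_aph_def)
  have pm: "pseudo_metric A g" and ac: "almost_complex A J"
    using aph by (simp_all only: almost_pseudo_hermitian_def)
  have cmp: "g \<one> (J \<one> u) (J \<one> v) = g \<one> u v" if "u \<in> tangent_space A \<one>" "v \<in> tangent_space A \<one>" for u v
    using aph om that unfolding almost_pseudo_hermitian_def by simp
  note ut = unit_vec_tangent
  have sym: "g \<one> (unit_vec x) (unit_vec y) = g \<one> (unit_vec y) (unit_vec x)" for x y
    by (rule pseudo_metricD(1)[OF pm om ut ut])
  have lin: "g \<one> (unit_vec (r *\<^sub>R x + y)) (unit_vec z) = r * g \<one> (unit_vec x) (unit_vec z) + g \<one> (unit_vec y) (unit_vec z)" for r x y z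
    unfolding unit_vec_add unit_vec_scaleR by (rule pseudo_metricD(2)[OF pm om ut ut ut])
  have jt: "J \<one> (unit_vec x) \<in> tangent_space A \<one>" and jj: "J \<one> (J \<one> (unit_vec x)) = - unit_vec x" for x
    by (rule almost_complexD[OF ac om ut])+
  have jlin: "J \<one> (unit_vec (r *\<^sub>R x + y)) = r *\<^sub>R J \<one> (unit_vec x) + J \<one> (unit_vec y)" for r x y
    unfolding unit_vec_add unit_vec_scaleR by (rule almost_complexD(3)[OF ac om ut ut])
  have ju: "unit_vec (J \<one> (unit_vec x) c0) = J \<one> (unit_vec x)" for x by (rule unit_vec_eq[OF jt])
  have lin2: "linear (\<lambda>x. g \<one> (unit_vec x) (unit_vec z))" for z
  proof (rule linearI)
    show "g \<one> (unit_vec (x + y)) (unit_vec z) = g \<one> (unit_vec x) (unit_vec z) + g \<one> (unit_vec y) (unit_vec z)" for x y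
      using lin[of 1 x y z] by simp
    have "g \<one> (unit_vec 0) (unit_vec z) = 0" using lin[of 1 0 0 z] by simp
    then show "g \<one> (unit_vec (r *\<^sub>R x)) (unit_vec z) = r *\<^sub>R g \<one> (unit_vec x) (unit_vec z)" for r x
      using lin[of r x 0 z] by simp
  qed
  have bil: "bounded_bilinear (\<lambda>x y. g \<one> (unit_vec x) (unit_vec y))"
    unfolding bilinear_conv_bounded_bilinear[symmetric] bilinear_def
  proof (intro conjI allI lin2)
    show "linear (\<lambda>y. g \<one> (unit_vec x) (unit_vec y))" for x
      using lin2[of x] by (simp add: sym[of x])
  qed
  have "linear (\<lambda>x. J \<one> (unit_vec x) c0)"
  proof (rule linearI)
    show "J \<one> (unit_vec (x + y)) c0 = J \<one> (unit_vec x) c0 + J \<one> (unit_vec y) c0" for x y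
      using jlin[of 1 x y] by simp
    have "J \<one> (unit_vec 0) c0 = 0" using fun_cong[OF jlin[of 1 0 0], of c0] by simp
    then show "J \<one> (unit_vec (r *\<^sub>R x)) c0 = r *\<^sub>R J \<one> (unit_vec x) c0" for r x
      using jlin[of r x 0] by (simp add: scaleR_fun_apply)
  qed
  then have jl: "bounded_linear (\<lambda>x. J \<one> (unit_vec x) c0)" by (simp add: linear_conv_bounded_linear)
  show ?thesis
  proof (intro invariant_hermitian.intro lie_group_chart_axioms invariant_hermitian_axioms.intro bil jl sym)
    fix x assume "\<And>y. g \<one> (unit_vec x) (unit_vec y) = 0"
    then have "g \<one> (unit_vec x) v = 0" if "v \<in> tangent_space A \<one>" for v using unit_vec_eq[OF that] by metis
    then have "unit_vec x = 0" by (rule pseudo_metricD(3)[OF pm om ut])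
    then have "unit_vec x c0 = 0" by (simp add: zero_fun_def)
    then show "x = 0" by simp
  next
    fix x show "J \<one> (unit_vec (J \<one> (unit_vec x) c0)) c0 = - x" by (simp add: ju jj)
  next
    fix x y show "g \<one> (unit_vec (J \<one> (unit_vec x) c0)) (unit_vec (J \<one> (unit_vec y) c0)) = g \<one> (unit_vec x) (unit_vec y)"
      by (simp add: ju cmp ut)
  next
    fix p u v assume p: "p \<in> carrier G" and u: "u \<in> tangent_space A p" and v: "v \<in> tangent_space A p"
    have "g (p \<otimes> \<one>) (ltr p \<one> (unit_vec (th p u))) (ltr p \<one> (unit_vec (th p v))) = g \<one> (unit_vec (th p u)) (unit_vec (th p v))"
      by (rule gi[unfolded left_invariant_metric_def, rule_format, OF p one_closed ut ut])
    then show "g p u v = g \<one> (unit_vec (th p u)) (unit_vec (th p v))"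
      using L_th[OF p u] L_th[OF p v] p by (simp add: L_def)
  next
    fix p u assume p: "p \<in> carrier G" and u: "u \<in> tangent_space A p"
    have "J (p \<otimes> \<one>) (ltr p \<one> (unit_vec (th p u))) = ltr p \<one> (J \<one> (unit_vec (th p u)))"
      by (rule Ji[unfolded left_invariant_endo_def, rule_format, OF p one_closed ut])
    then show "J p u = L (J \<one> (unit_vec (th p u)) c0) p"
      using L_th[OF p u] p by (simp add: L_def ju)
  qed
qed

section \<open>The topology of a product manifold\<close>

lemma topspace_mtopology: "topspace (mtopology A) = mcarrier A"
proof -
  have "fst c \<subseteq> \<Union> {fst c \<inter> snd c -` W | c W. c \<in> A \<and> open W}" if "c \<in> A" for c
  proof -
    have "fst c = fst c \<inter> snd c -` UNIV" by simp
    then show ?thesis using that open_UNIV by blast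
  qed
  then show ?thesis
    unfolding mtopology_def topology_generated_by_topspace mcarrier_def by blast
qed

lemma openin_mtopology_chart: "c \<in> A \<Longrightarrow> open W \<Longrightarrow> openin (mtopology A) (fst c \<inter> snd c -` W)"
  unfolding mtopology_def by (rule topology_generated_by_Basis) blast

lemma continuous_map_into_mtopology:
  assumes "\<And>c W. c \<in> A \<Longrightarrow> open W \<Longrightarrow> openin T (f -` (fst c \<inter> snd c -` W) \<inter> topspace T)"
    and "f ` topspace T \<subseteq> mcarrier A"
  shows "continuous_map T (mtopology A) f"
  unfolding mtopology_def
proof (rule continuous_on_generated_topo)
  show "f ` topspace T \<subseteq> \<Union> {fst c \<inter> snd c -` W | c W. c \<in> A \<and> open W}"
    using assms(2) topspace_mtopology[of A] unfolding mtopology_def topology_generated_by_topspace by simp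
qed (use assms(1) in blast)

text \<open>
  In one direction, the projections are continuous for the topology of the product atlas; in the other, an
  open set of the model space is a union of boxes, so a generating set of that topology is a union of products of
  generating sets.
\<close>

lemma mtopology_prod_homeomorphic:
  fixes A :: "('a, 'b::euclidean_space) chart set" and B :: "('c, 'd::euclidean_space) chart set"
  shows "mtopology (prod_atlas A B) homeomorphic_space prod_topology (mtopology A) (mtopology B)"
proof -
  let ?T = "mtopology (prod_atlas A B)" and ?P = "prod_topology (mtopology A) (mtopology B)"
  have fst: "continuous_map ?T (mtopology A) fst"
  proof (rule continuous_map_into_mtopology)
    fix c W assume c: "c \<in> A" and W: "open (W :: 'b set)"
    have "fst -` (fst c \<inter> snd c -` W) \<inter> topspace ?T =
        (\<Union>d\<in>B. fst (prod_chart c d) \<inter> snd (prod_chart c d) -` (W \<times> UNIV))"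
      unfolding topspace_mtopology mcarrier_prod using c by (auto simp: mcarrier_def prod_chart_def)
    also have "openin ?T \<dots>"
    proof (rule openin_Union, clarify)
      fix d assume d: "d \<in> B"
      have "prod_chart c d \<in> prod_atlas A B" unfolding prod_atlas_prod_chart using c d by blast
      moreover have "open (W \<times> (UNIV :: 'd set))" by (intro open_Times W open_UNIV)
      ultimately show "openin ?T (fst (prod_chart c d) \<inter> snd (prod_chart c d) -` (W \<times> UNIV))"
        by (rule openin_mtopology_chart)
    qed
    finally show "openin ?T (fst -` (fst c \<inter> snd c -` W) \<inter> topspace ?T)" .
  qed (auto simp: topspace_mtopology mcarrier_prod)
  have snd: "continuous_map ?T (mtopology B) snd"
  proof (rule continuous_map_into_mtopology)
    fix d W assume d: "d \<in> B" and W: "open (W :: 'd set)"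
    have "snd -` (fst d \<inter> snd d -` W) \<inter> topspace ?T =
        (\<Union>c\<in>A. fst (prod_chart c d) \<inter> snd (prod_chart c d) -` (UNIV \<times> W))"
      unfolding topspace_mtopology mcarrier_prod using d by (auto simp: mcarrier_def prod_chart_def)
    also have "openin ?T \<dots>"
    proof (rule openin_Union, clarify)
      fix c assume c: "c \<in> A"
      have "prod_chart c d \<in> prod_atlas A B" unfolding prod_atlas_prod_chart using c d by blast
      moreover have "open ((UNIV :: 'b set) \<times> W)" by (intro open_Times W open_UNIV)
      ultimately show "openin ?T (fst (prod_chart c d) \<inter> snd (prod_chart c d) -` (UNIV \<times> W))"
        by (rule openin_mtopology_chart)
    qed
    finally show "openin ?T (snd -` (fst d \<inter> snd d -` W) \<inter> topspace ?T)" .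
  qed (auto simp: topspace_mtopology mcarrier_prod)
  have 1: "continuous_map ?T ?P (\<lambda>z. z)"
    unfolding continuous_map_pairwise using fst snd by (simp add: o_def)
  have 2: "continuous_map ?P ?T (\<lambda>z. z)"
  proof (rule continuous_map_into_mtopology)
    fix e W assume e: "e \<in> prod_atlas A B" and W: "open (W :: ('b \<times> 'd) set)"
    then obtain c d where c: "c \<in> A" and d: "d \<in> B" and e: "e = prod_chart c d"
      unfolding prod_atlas_prod_chart by blast
    have "openin ?P (fst e \<inter> snd e -` W)"
      unfolding openin_prod_topology_alt
    proof (intro allI impI)
      fix p q assume "(p, q) \<in> fst e \<inter> snd e -` W"
      then have pq: "p \<in> fst c" "q \<in> fst d" "(snd c p, snd d q) \<in> W" by (auto simp: e prod_chart_def)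
      obtain U V where UV: "open U" "open V" "(snd c p, snd d q) \<in> U \<times> V" "U \<times> V \<subseteq> W"
        using open_prod_elim[OF W pq(3)] by blast
      have "openin (mtopology A) (fst c \<inter> snd c -` U)" "openin (mtopology B) (fst d \<inter> snd d -` V)"
        by (intro openin_mtopology_chart c d UV)+
      moreover have "p \<in> fst c \<inter> snd c -` U" "q \<in> fst d \<inter> snd d -` V" using pq UV by auto
      moreover have "(fst c \<inter> snd c -` U) \<times> (fst d \<inter> snd d -` V) \<subseteq> fst e \<inter> snd e -` W"
        using UV(4) by (auto simp: e prod_chart_def)
      ultimately show "\<exists>U V. openin (mtopology A) U \<and> openin (mtopology B) V \<and> p \<in> U \<and> q \<in> V \<and> U \<times> V \<subseteq> fst e \<inter> snd e -` W"
        by blast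
    qed
    moreover have "fst e \<subseteq> topspace ?P"
      using c d by (auto simp: e topspace_mtopology mcarrier_def)
    moreover have "(\<lambda>z. z) -` (fst e \<inter> snd e -` W) \<inter> topspace ?P = fst e \<inter> snd e -` W"
      using calculation(2) by blast
    ultimately show "openin ?P ((\<lambda>z. z) -` (fst e \<inter> snd e -` W) \<inter> topspace ?P)" by simp
  qed (simp add: topspace_mtopology mcarrier_prod)
  have "homeomorphic_maps ?T ?P (\<lambda>z. z) (\<lambda>z. z)"
    unfolding homeomorphic_maps_def using 1 2 by simp
  then show ?thesis by (rule homeomorphic_maps_imp_homeomorphic_space)
qed

lemma second_countable_prod_topology:
  assumes "second_countable X" "second_countable Y"
  shows "second_countable (prod_topology X Y)"
proof -
  obtain \<B> where B: "countable \<B>" "\<forall>V\<in>\<B>. openin X V"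
      "\<forall>U x. openin X U \<and> x \<in> U \<longrightarrow> (\<exists>V\<in>\<B>. x \<in> V \<and> V \<subseteq> U)"
    using assms(1) unfolding second_countable_def by (elim exE conjE)
  obtain \<C> where C: "countable \<C>" "\<forall>V\<in>\<C>. openin Y V"
      "\<forall>U x. openin Y U \<and> x \<in> U \<longrightarrow> (\<exists>V\<in>\<C>. x \<in> V \<and> V \<subseteq> U)"
    using assms(2) unfolding second_countable_def by (elim exE conjE)
  let ?D = "(\<lambda>(U, V). U \<times> V) ` (\<B> \<times> \<C>)"
  have c1: "countable ?D" using B(1) C(1) by (intro countable_image countable_SIGMA)
  have c2: "openin (prod_topology X Y) W" if "W \<in> ?D" for W
    using that B(2) C(2) by (auto simp: openin_prod_Times_iff)
  have c3: "\<exists>W\<in>?D. z \<in> W \<and> W \<subseteq> S" if S: "openin (prod_topology X Y) S" and z: "z \<in> S" for S z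
  proof -
    obtain x y where xy: "z = (x, y)" by (cases z)
    obtain U V where UV: "openin X U" "openin Y V" "x \<in> U" "y \<in> V" "U \<times> V \<subseteq> S"
      using S[unfolded openin_prod_topology_alt, rule_format, OF z[unfolded xy]] by (elim exE conjE)
    obtain U' where U': "U' \<in> \<B>" "x \<in> U'" "U' \<subseteq> U" using B(3) UV(1,3) by meson
    obtain V' where V': "V' \<in> \<C>" "y \<in> V'" "V' \<subseteq> V" using C(3) UV(2,4) by meson
    have "U' \<times> V' \<in> ?D" using U'(1) V'(1) by blast
    moreover have "z \<in> U' \<times> V'" "U' \<times> V' \<subseteq> S" using U' V' UV(5) xy by auto
    ultimately show ?thesis by blast
  qed
  show ?thesis unfolding second_countable_def
  proof (intro exI[of _ ?D] conjI ballI allI impI c1)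
    show "openin (prod_topology X Y) W" if "W \<in> ?D" for W by (rule c2[OF that])
    show "\<exists>W\<in>?D. z \<in> W \<and> W \<subseteq> S" if "openin (prod_topology X Y) S \<and> z \<in> S" for S z
      using c3 that by simp
  qed
qed

lemma second_countable_euclidean: "second_countable (euclidean :: 'a::second_countable_topology topology)"
proof -
  obtain B :: "'a set set" where B: "countable B" "topological_basis B"
    using ex_countable_basis[where ?'a = 'a] by blast
  show ?thesis
    unfolding second_countable_def
  proof (intro exI[of _ B] conjI ballI allI impI B(1))
    show "openin euclidean V" if "V \<in> B" for V using topological_basis_open[OF B(2) that] by simp
    show "\<exists>V\<in>B. x \<in> V \<and> V \<subseteq> U" if "openin euclidean U \<and> x \<in> U" for U x
      using topological_basisE[OF B(2), of U x] that by (metis open_openin)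
  qed
qed

lemma smooth_manifold_prod:
  assumes A: "smooth_manifold A" and B: "smooth_manifold B"
  shows "smooth_manifold (prod_atlas A B)"
  using assms unfolding smooth_manifold_iff_atlas
  by (simp add: atlas_prod second_countable_prod_topology Hausdorff_space_prod_topology
      homeomorphic_Hausdorff_space[OF mtopology_prod_homeomorphic]
      homeomorphic_space_second_countability[OF mtopology_prod_homeomorphic])

section \<open>The Lie algebra as a manifold\<close>

context lie_group_chart
begin

abbreviation LA where "LA \<equiv> lie_alg_atlas G A"

definition lin_chart :: "('a, 'e) chart \<Rightarrow> (('a, 'e) tvec, 'e) chart" where
  "lin_chart c = (lie_alg G A, \<lambda>X. X c)"

lemma lin_chart_simps [simp]: "fst (lin_chart c) = lie_alg G A" "snd (lin_chart c) X = X c"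
  by (simp_all add: lin_chart_def)

lemma LA_eq: "LA = lin_chart ` charts_at A \<one>"
  by (auto simp: lie_alg_atlas_def lin_chart_def)

lemma lin_chart_inv:
  assumes c: "c \<in> charts_at A \<one>"
  shows "chart_inv (lin_chart c) x = tvec_of A \<one> c x"
  unfolding chart_inv_def
proof (rule inv_into_f_eq)
  show "inj_on (snd (lin_chart c)) (fst (lin_chart c))"
    by (rule inj_onI) (use tangent_eqI[OF _ _ c] in \<open>simp add: lie_alg_def\<close>)
qed (simp_all add: lie_alg_def tvec_of_tangent[OF A c] tvec_of_chart[OF A c])

lemma lin_chart_image:
  assumes c: "c \<in> charts_at A \<one>"
  shows "snd (lin_chart c) ` lie_alg G A = UNIV"
proof -
  have "x \<in> snd (lin_chart c) ` lie_alg G A" for x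
    by (rule image_eqI[of _ _ "tvec_of A \<one> c x"]) (simp_all add: lie_alg_def tvec_of_tangent[OF A c] tvec_of_chart[OF A c])
  then show ?thesis by blast
qed

lemma bounded_linear_tvec_of:
  assumes c: "c \<in> charts_at A \<one>"
  shows "bounded_linear (\<lambda>x. tvec_of A \<one> c x d)"
proof (cases "d \<in> charts_at A \<one>")
  case True
  then show ?thesis
    using linear_transition[OF A c True] by (simp add: tvec_of_def linear_conv_bounded_linear)
qed (simp add: tvec_of_def bounded_linear_zero)

lemma atlas_LA: "atlas LA"
  unfolding atlas_def LA_eq
proof (intro conjI ballI; elim imageE; hypsubst)
  fix c assume c: "c \<in> charts_at A \<one>"
  show "inj_on (snd (lin_chart c)) (fst (lin_chart c))"
    by (rule inj_onI) (use tangent_eqI[OF _ _ c] in \<open>simp add: lie_alg_def\<close>)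
  show "open (snd (lin_chart c) ` fst (lin_chart c))" by (simp only: lin_chart_simps lin_chart_image[OF c] open_UNIV)
  fix d assume d: "d \<in> charts_at A \<one>"
  show "open (snd (lin_chart c) ` (fst (lin_chart c) \<inter> fst (lin_chart d)))"
    by (simp only: lin_chart_simps Int_absorb lin_chart_image[OF c] open_UNIV)
  have "snd (lin_chart d) \<circ> chart_inv (lin_chart c) = (\<lambda>x. tvec_of A \<one> c x d)"
    by (simp add: fun_eq_iff lin_chart_inv[OF c])
  then show "smooth_on (snd (lin_chart c) ` (fst (lin_chart c) \<inter> fst (lin_chart d))) (snd (lin_chart d) \<circ> chart_inv (lin_chart c))"
    unfolding lin_chart_simps Int_absorb lin_chart_image[OF c]
    by (simp add: smooth_on_iff_smooth_at smooth_at_bounded_linear[OF bounded_linear_tvec_of[OF c]])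
qed

lemma mcarrier_LA: "mcarrier LA = lie_alg G A"
  unfolding mcarrier_def LA_eq using c0 by auto

lemma lin_chart_at: "c \<in> charts_at A \<one> \<Longrightarrow> X \<in> lie_alg G A \<Longrightarrow> lin_chart c \<in> charts_at LA X"
  by (simp add: charts_at_def LA_eq)

lemma LA_homeomorphic: "mtopology LA homeomorphic_space (euclidean :: 'e topology)"
proof -
  have 1: "continuous_map (mtopology LA) euclidean (\<lambda>X. X c0)"
    unfolding continuous_map_alt
  proof (intro conjI allI impI)
    fix W :: "'e set" assume "openin euclidean W"
    then have "openin (mtopology LA) (fst (lin_chart c0) \<inter> snd (lin_chart c0) -` W)"
      using c0 by (intro openin_mtopology_chart) (simp_all add: LA_eq)
    moreover have "fst (lin_chart c0) \<inter> snd (lin_chart c0) -` W = (\<lambda>X. X c0) -` W \<inter> topspace (mtopology LA)"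
      by (auto simp: topspace_mtopology mcarrier_LA)
    ultimately show "openin (mtopology LA) ((\<lambda>X. X c0) -` W \<inter> topspace (mtopology LA))" by simp
  qed simp
  have 2: "continuous_map euclidean (mtopology LA) unit_vec"
  proof (rule continuous_map_into_mtopology)
    fix e W assume e: "e \<in> LA" and W: "open (W :: 'e set)"
    obtain c where c: "c \<in> charts_at A \<one>" "e = lin_chart c" using e LA_eq by blast
    have "unit_vec -` (fst e \<inter> snd e -` W) = (\<lambda>x. unit_vec x c) -` W"
      by (auto simp: c(2) lie_alg_def unit_vec_tangent)
    moreover have "open ((\<lambda>x. unit_vec x c) -` W)"
      using W linear_continuous_on[OF bounded_linear_tvec_of[OF c0], of UNIV c]
      by (simp add: continuous_on_open_vimage)
    ultimately show "openin euclidean (unit_vec -` (fst e \<inter> snd e -` W) \<inter> topspace euclidean)" by simp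
  qed (auto simp: mcarrier_LA lie_alg_def unit_vec_tangent)
  have "homeomorphic_maps (mtopology LA) euclidean (\<lambda>X. X c0) unit_vec"
    unfolding homeomorphic_maps_def using 1 2
    by (simp add: topspace_mtopology mcarrier_LA lie_alg_def unit_vec_eq)
  then show ?thesis by (rule homeomorphic_maps_imp_homeomorphic_space)
qed

lemma smooth_manifold_LA: "smooth_manifold LA"
  unfolding smooth_manifold_iff_atlas
  using atlas_LA homeomorphic_Hausdorff_space[OF LA_homeomorphic]
    homeomorphic_space_second_countability[OF LA_homeomorphic] second_countable_euclidean
  by simp

lemma smooth_map_at_LA:
  assumes M: "atlas M" and X: "\<And>q. q \<in> mcarrier M \<Longrightarrow> X q \<in> lie_alg G A" and s: "smooth_fun_at M (\<lambda>q. X q c0) p"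
  shows "smooth_map_at M LA X p"
proof (rule smooth_map_atI[OF M atlas_LA, where d = "lin_chart c0"])
  note p = smooth_fun_at_mcarrier[OF s]
  show "lin_chart c0 \<in> charts_at LA (X p)" by (rule lin_chart_at[OF c0 X[OF p]])
  show "\<forall>\<^sub>F q in mnhds M p. X q \<in> fst (lin_chart c0)"
    using eventually_mnhds_mcarrier[OF M p] by eventually_elim (simp add: X)
qed (use s in simp)

lemma smooth_fun_at_eval:
  assumes M: "atlas M" and X: "smooth_map_at M LA X p"
  shows "smooth_fun_at M (\<lambda>q. X q c0) p"
proof -
  have "lin_chart c0 \<in> charts_at LA (X p)"
    using lin_chart_at[OF c0] smooth_map_at_mcarrier(2)[OF X] by (simp add: mcarrier_LA)
  from smooth_fun_at_comp[OF M atlas_LA smooth_fun_at_coord[OF atlas_LA this] X] show ?thesis by simp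
qed

section \<open>The tangent group is a Lie group\<close>

abbreviation AdG where "AdG \<equiv> Ad G A"

lemma smooth_map_at_conj_fun:
  assumes M: "atlas M" and F: "smooth_map_at M A F p" and H: "smooth_map_at M A H p"
  shows "smooth_map_at M A (\<lambda>q. F q \<otimes> H q \<otimes> inv (F q)) p"
  by (intro smooth_map_at_mult_fun smooth_map_at_inv_fun M F H)

lemma smooth_map_at_conj: "b \<in> carrier G \<Longrightarrow> p \<in> carrier G \<Longrightarrow> smooth_map_at A A (\<lambda>x. b \<otimes> x \<otimes> inv b) p"
  using smooth_map_at_conj_fun[OF A smooth_map_at_const[OF A A] smooth_map_at_ident[OF A]] by (simp add: mcarrier)

lemma Ad_tangent: "b \<in> carrier G \<Longrightarrow> AdG b X \<in> lie_alg G A"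
  using differential_tangent[OF A A smooth_map_at_conj[OF _ one_closed], of b X] by (simp add: Ad_def lie_alg_def)

lemma Ad_add: "b \<in> carrier G \<Longrightarrow> AdG b (X + Y) = AdG b X + AdG b Y"
  unfolding Ad_def by (rule differential_add[OF A A smooth_map_at_conj[OF _ one_closed]])

lemma Ad_scaleR: "b \<in> carrier G \<Longrightarrow> AdG b (r *\<^sub>R X) = r *\<^sub>R AdG b X"
  unfolding Ad_def by (rule differential_scaleR[OF A A smooth_map_at_conj[OF _ one_closed]])

lemma Ad_zero: "b \<in> carrier G \<Longrightarrow> AdG b 0 = 0"
  using Ad_scaleR[of b 0 0] by (simp add: scaleR_fun_def zero_fun_def)

lemma Ad_uminus: "b \<in> carrier G \<Longrightarrow> AdG b (- X) = - AdG b X"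
  using Ad_scaleR[of b "-1" X] by simp

lemma Ad_Ad:
  assumes a: "a \<in> carrier G" and b: "b \<in> carrier G"
  shows "AdG a (AdG b X) = AdG (a \<otimes> b) X"
proof -
  have om: "\<one> \<in> mcarrier A" by (simp add: mcarrier)
  have b1: "b \<otimes> \<one> \<otimes> inv b = \<one>" using b by simp
  have "differential A A (\<lambda>x. a \<otimes> x \<otimes> inv a) (b \<otimes> \<one> \<otimes> inv b) (differential A A (\<lambda>x. b \<otimes> x \<otimes> inv b) \<one> X)
      = differential A A (\<lambda>x. a \<otimes> (b \<otimes> x \<otimes> inv b) \<otimes> inv a) \<one> X"
    by (rule differential_compose[OF A A A, where F = "\<lambda>x. b \<otimes> x \<otimes> inv b" and G = "\<lambda>x. a \<otimes> x \<otimes> inv a"])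
       (use a b in \<open>simp_all add: smooth_map_at_conj\<close>)
  also have "\<dots> = differential A A (\<lambda>x. (a \<otimes> b) \<otimes> x \<otimes> inv (a \<otimes> b)) \<one> X"
    by (rule differential_cong[OF A om])
       (use eventually_carrier[OF one_closed] in eventually_elim, use a b in \<open>simp add: inv_mult_group m_assoc\<close>)
  finally show ?thesis unfolding Ad_def b1 .
qed

lemma Ad_one:
  assumes "X \<in> lie_alg G A"
  shows "AdG \<one> X = X"
proof -
  have "AdG \<one> X = differential A A (\<lambda>x. x) \<one> X"
    unfolding Ad_def
    by (rule differential_cong[OF A])
       (simp add: mcarrier, use eventually_carrier[OF one_closed] in eventually_elim, simp)
  then show ?thesis using differential_ident[OF A] assms by (simp add: lie_alg_def)
qed

lemma Ad_chart:
  "b \<in> carrier G \<Longrightarrow> c \<in> charts_at A \<one> \<Longrightarrow> AdG b X c = dderiv A \<one> (\<lambda>y. snd c (b \<otimes> y \<otimes> inv b)) X"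
  unfolding Ad_def by (rule differential_dderiv) simp

text \<open>
  \<open>Ad\<^bsub>b\<^esub> X\<close> is the derivative of \<open>(b, y) \<mapsto> b y b\<^sup>-\<^sup>1\<close> in the second factor at the unit, which is
  smooth in all data.
\<close>

lemma smooth_fun_at_Ad:
  assumes M: "atlas M" and F: "smooth_map_at M A F p" and X: "smooth_map_at M LA X p"
  shows "smooth_fun_at M (\<lambda>q. AdG (F q) (X q) c0) p"
proof -
  note p = smooth_map_at_mcarrier(1)[OF F]
  have om: "\<one> \<in> mcarrier A" by (simp add: mcarrier)
  have Fp: "F p \<in> carrier G" using smooth_map_at_mcarrier(2)[OF F] by (simp add: mcarrier)
  note MA = atlas_prod[OF M A]
  have F1: "smooth_map_at (prod_atlas M A) A (\<lambda>z. F (fst z)) (p, \<one>)"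
    by (rule smooth_map_at_compose[OF MA M A smooth_map_at_fst[OF M A p om]]) (simp add: F)
  have "smooth_map_at (prod_atlas M A) A (\<lambda>z. F (fst z) \<otimes> snd z \<otimes> inv (F (fst z))) (p, \<one>)"
    by (rule smooth_map_at_conj_fun[OF MA F1 smooth_map_at_snd[OF M A p om]])
  from smooth_fun_at_comp[OF MA A _ this, of "snd c0"]
  have f: "smooth_fun_at (prod_atlas M A) (\<lambda>z. snd c0 (F (fst z) \<otimes> snd z \<otimes> inv (F (fst z)))) (p, \<one>)"
    using smooth_fun_at_coord[OF A c0] Fp by simp
  have ev: "\<forall>\<^sub>F q in mnhds M p. X q \<in> tangent_space A \<one>"
    using eventually_smooth_map_at[OF X eventually_mnhds_mcarrier[OF atlas_LA smooth_map_at_mcarrier(2)[OF X]]]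
    by (simp add: mcarrier_LA lie_alg_def)
  have "smooth_fun_at M (\<lambda>m. dderiv A \<one> (\<lambda>y. snd c0 (F m \<otimes> y \<otimes> inv (F m))) (X m)) p"
    by (rule smooth_fun_at_partial_derivative[OF M A f smooth_map_at_const[OF M A p om] ev c0 smooth_fun_at_eval[OF M X]])
  moreover have "\<forall>\<^sub>F m in mnhds M p. dderiv A \<one> (\<lambda>y. snd c0 (F m \<otimes> y \<otimes> inv (F m))) (X m) = AdG (F m) (X m) c0"
    using eventually_smooth_map_at[OF F eventually_mnhds_mcarrier[OF A smooth_map_at_mcarrier(2)[OF F]]]
    by eventually_elim (simp add: Ad_chart[OF _ c0] mcarrier)
  ultimately show ?thesis by (rule smooth_fun_at_transform[OF M])
qed

abbreviation TG where "TG \<equiv> tangent_group G A"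
abbreviation TA where "TA \<equiv> tangent_atlas G A"

lemma TG_simps [simp]:
  "carrier TG = carrier G \<times> lie_alg G A"
  "(a, X) \<otimes>\<^bsub>TG\<^esub> (b, Y) = (a \<otimes> b, AdG (inv b) X + Y)"
  "\<one>\<^bsub>TG\<^esub> = (\<one>, 0)"
  by (simp_all add: tangent_group_def)

lemma lie_alg_closed:
  "0 \<in> lie_alg G A" "X \<in> lie_alg G A \<Longrightarrow> Y \<in> lie_alg G A \<Longrightarrow> X + Y \<in> lie_alg G A"
  "X \<in> lie_alg G A \<Longrightarrow> - X \<in> lie_alg G A" "X \<in> lie_alg G A \<Longrightarrow> r *\<^sub>R X \<in> lie_alg G A"
  by (simp_all add: lie_alg_def tangent_zero[OF A] tangent_add[OF A] tangent_uminus[OF A] tangent_scaleR[OF A])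

lemma TG_group: "group TG"
proof (rule groupI)
  fix x y assume "x \<in> carrier TG" "y \<in> carrier TG"
  then show "x \<otimes>\<^bsub>TG\<^esub> y \<in> carrier TG"
    by (cases x; cases y) (simp add: Ad_tangent lie_alg_closed)
next
  show "\<one>\<^bsub>TG\<^esub> \<in> carrier TG" by (simp add: lie_alg_closed)
next
  fix x y z assume "x \<in> carrier TG" "y \<in> carrier TG" "z \<in> carrier TG"
  then show "x \<otimes>\<^bsub>TG\<^esub> y \<otimes>\<^bsub>TG\<^esub> z = x \<otimes>\<^bsub>TG\<^esub> (y \<otimes>\<^bsub>TG\<^esub> z)"
    by (cases x; cases y; cases z) (simp add: m_assoc Ad_add Ad_Ad inv_mult_group add.assoc)
next
  fix x assume "x \<in> carrier TG"
  then show "\<one>\<^bsub>TG\<^esub> \<otimes>\<^bsub>TG\<^esub> x = x" by (cases x) (simp add: Ad_zero)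
next
  fix x assume x: "x \<in> carrier TG"
  then obtain a X where aX: "x = (a, X)" "a \<in> carrier G" "X \<in> lie_alg G A" by (cases x) simp
  have "(inv a, - AdG a X) \<otimes>\<^bsub>TG\<^esub> x = \<one>\<^bsub>TG\<^esub>"
    using aX by (simp add: Ad_uminus Ad_Ad Ad_one)
  moreover have "(inv a, - AdG a X) \<in> carrier TG" using aX by (simp add: Ad_tangent lie_alg_closed)
  ultimately show "\<exists>y\<in>carrier TG. y \<otimes>\<^bsub>TG\<^esub> x = \<one>\<^bsub>TG\<^esub>" by blast
qed

lemma TG_inv:
  assumes "a \<in> carrier G" "X \<in> lie_alg G A"
  shows "inv\<^bsub>TG\<^esub> (a, X) = (inv a, - AdG a X)"
  using assms by (intro group.inv_equality[OF TG_group]) (simp_all add: Ad_uminus Ad_Ad Ad_one Ad_tangent lie_alg_closed)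

lemma TA_eq: "TA = prod_atlas A LA"
  by (simp add: tangent_atlas_def)

lemma atlas_TA: "atlas TA"
  unfolding TA_eq by (rule atlas_prod[OF A atlas_LA])

lemma mcarrier_TA: "mcarrier TA = carrier TG"
  by (simp add: TA_eq mcarrier_prod mcarrier mcarrier_LA)

lemma smooth_map_at_TG_pair:
  assumes M: "atlas M" and F: "smooth_map_at M A F p" and X: "smooth_map_at M LA X p"
  shows "smooth_map_at M TA (\<lambda>q. (F q, X q)) p"
  unfolding TA_eq by (rule smooth_map_at_Pair[OF M A atlas_LA F X])

lemma smooth_map_at_TG_parts:
  assumes M: "atlas M" and U: "smooth_map_at M TA U p"
  shows "smooth_map_at M A (\<lambda>q. fst (U q)) p" "smooth_map_at M LA (\<lambda>q. snd (U q)) p"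
proof -
  have m: "fst (U p) \<in> mcarrier A" "snd (U p) \<in> mcarrier LA"
    using smooth_map_at_mcarrier(2)[OF U] by (auto simp: TA_eq mcarrier_prod)
  have "smooth_map_at TA A fst (U p)" "smooth_map_at TA LA snd (U p)"
    using smooth_map_at_fst[OF A atlas_LA m] smooth_map_at_snd[OF A atlas_LA m] by (simp_all add: TA_eq)
  then show "smooth_map_at M A (\<lambda>q. fst (U q)) p" "smooth_map_at M LA (\<lambda>q. snd (U q)) p"
    using smooth_map_at_compose[OF M atlas_TA A U] smooth_map_at_compose[OF M atlas_TA atlas_LA U] by simp_all
qed

lemma TG_mult_smooth: "smooth_map (prod_atlas TA TA) TA (\<lambda>(x, y). x \<otimes>\<^bsub>TG\<^esub> y)"
proof -
  note TT = atlas_prod[OF atlas_TA atlas_TA]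
  have "smooth_map_at (prod_atlas TA TA) TA (\<lambda>(x, y). x \<otimes>\<^bsub>TG\<^esub> y) (x, y)" if x: "x \<in> mcarrier TA" and y: "y \<in> mcarrier TA" for x y
  proof -
    let ?M = "prod_atlas TA TA"
    note f = smooth_map_at_TG_parts[OF TT smooth_map_at_fst[OF atlas_TA atlas_TA x y]]
      and s = smooth_map_at_TG_parts[OF TT smooth_map_at_snd[OF atlas_TA atlas_TA x y]]
    have "smooth_map_at ?M LA (\<lambda>z. AdG (inv (fst (snd z))) (snd (fst z)) + snd (snd z)) (x, y)"
    proof (rule smooth_map_at_LA[OF TT])
      show "AdG (inv (fst (snd z))) (snd (fst z)) + snd (snd z) \<in> lie_alg G A" if "z \<in> mcarrier ?M" for z
        using that by (auto simp: mcarrier_prod mcarrier_TA Ad_tangent lie_alg_closed)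
      have "smooth_fun_at ?M (\<lambda>z. AdG (inv (fst (snd z))) (snd (fst z)) c0 + snd (snd z) c0) (x, y)"
        by (intro smooth_fun_at_add smooth_fun_at_Ad[OF TT] smooth_map_at_inv_fun TT f s smooth_fun_at_eval[OF TT])
      then show "smooth_fun_at ?M (\<lambda>z. (AdG (inv (fst (snd z))) (snd (fst z)) + snd (snd z)) c0) (x, y)" by simp
    qed
    from smooth_map_at_TG_pair[OF TT smooth_map_at_mult_fun[OF TT f(1) s(1)] this]
    show ?thesis by (simp add: case_prod_unfold tangent_group_def)
  qed
  then show ?thesis unfolding smooth_map_iff[OF TT atlas_TA] by (auto simp: mcarrier_prod)
qed

lemma TG_inv_smooth: "smooth_map TA TA (\<lambda>x. inv\<^bsub>TG\<^esub> x)"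
proof -
  have "smooth_map_at TA TA (\<lambda>x. inv\<^bsub>TG\<^esub> x) x" if x: "x \<in> mcarrier TA" for x
  proof -
    note i = smooth_map_at_TG_parts[OF atlas_TA smooth_map_at_ident[OF atlas_TA x]]
    have "smooth_map_at TA LA (\<lambda>z. - AdG (fst z) (snd z)) x"
    proof (rule smooth_map_at_LA[OF atlas_TA])
      show "- AdG (fst z) (snd z) \<in> lie_alg G A" if "z \<in> mcarrier TA" for z
        using that by (auto simp: mcarrier_TA Ad_tangent lie_alg_closed)
      have "smooth_fun_at TA (\<lambda>z. - (AdG (fst z) (snd z) c0)) x"
        by (rule smooth_fun_at_linear[OF bounded_linear_minus[OF bounded_linear_ident]]) (rule smooth_fun_at_Ad[OF atlas_TA i])
      then show "smooth_fun_at TA (\<lambda>z. (- AdG (fst z) (snd z)) c0) x" by simp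
    qed
    from smooth_map_at_TG_pair[OF atlas_TA smooth_map_at_inv_fun[OF atlas_TA i(1)] this]
    have m: "smooth_map_at TA TA (\<lambda>z. (inv (fst z), - AdG (fst z) (snd z))) x" .
    have "\<forall>\<^sub>F z in mnhds TA x. (inv (fst z), - AdG (fst z) (snd z)) = inv\<^bsub>TG\<^esub> z"
      using eventually_mnhds_mcarrier[OF atlas_TA x]
      by eventually_elim (auto simp: mcarrier_TA TG_inv)
    from smooth_map_at_cong[OF atlas_TA this x, THEN iffD1, OF m] show ?thesis .
  qed
  then show ?thesis unfolding smooth_map_iff[OF atlas_TA atlas_TA] by blast
qed

theorem lie_group_TG: "lie_group TG TA"
  unfolding lie_group_def
proof (intro conjI TG_group TG_mult_smooth TG_inv_smooth mcarrier_TA)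
  show "smooth_manifold TA"
    unfolding TA_eq using lie smooth_manifold_LA by (intro smooth_manifold_prod) (auto simp: lie_group_def)
qed

end

section \<open>The Lie algebra of the tangent group\<close>

lemma dderiv_Pair:
  assumes "smooth_fun_at A f p" "smooth_fun_at A h p"
  shows "dderiv A p (\<lambda>q. (f q, h q)) v = (dderiv A p f v, dderiv A p h v)"
  unfolding dderiv_def
  using fun_cong[OF frechet_derivative_eqI[OF has_derivative_Pair[OF smooth_fun_at_dderiv_has_derivative[OF assms(1)] smooth_fun_at_dderiv_has_derivative[OF assms(2)]]]]
  by simp

context lie_group_chart
begin

lemma br_add_left: "br (x + x') y = br x y + br x' y"
proof -
  have om: "\<one> \<in> mcarrier A" by (simp add: mcarrier)
  have "dderiv A \<one> (\<lambda>q. L (x + x') q c0) (unit_vec y) = dderiv A \<one> (\<lambda>q. L x q c0 + L x' q c0) (unit_vec y)"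
    by (rule dderiv_cong[OF A om]) (use eventually_carrier[OF one_closed] in eventually_elim, simp add: L_add)
  then show ?thesis
    by (simp add: br_dderiv unit_vec_add dderiv_add dderiv_add_vec vector_fieldD(2)[OF A L_vector_field c0])
qed

lemma br_scaleR_left: "br (r *\<^sub>R x) y = r *\<^sub>R br x y"
proof -
  have om: "\<one> \<in> mcarrier A" by (simp add: mcarrier)
  have "dderiv A \<one> (\<lambda>q. L (r *\<^sub>R x) q c0) (unit_vec y) = dderiv A \<one> (\<lambda>q. r *\<^sub>R L x q c0) (unit_vec y)"
    by (rule dderiv_cong[OF A om])
       (use eventually_carrier[OF one_closed] in eventually_elim, simp add: L_scaleR scaleR_fun_apply)
  then show ?thesis
    by (simp add: br_dderiv unit_vec_scaleR dderiv_linear_comp[OF bounded_linear_scaleR_right] dderiv_scaleR_vec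
        vector_fieldD(2)[OF A L_vector_field c0] scaleR_diff_right)
qed

lemma br_zero_left: "br 0 y = 0"
  using br_scaleR_left[of 0 0 y] by simp

lemma bounded_linear_br: "bounded_linear (\<lambda>x. br x y)"
  unfolding linear_conv_bounded_linear[symmetric] by (rule linearI) (simp_all add: br_add_left br_scaleR_left)

text \<open>
  Differentiating
  \<open>s b = b (b\<^sup>-\<^sup>1 s b)\<close> in \<open>s\<close> expresses the right-invariant field through the left-invariant fields and
  \<open>Ad\<^bsub>b\<^sup>-\<^sup>1\<^esub> X\<close>; differentiating in \<open>b\<close> afterwards, the order of the two derivatives may be exchanged on
  the left-hand side.
\<close>

lemma dderiv_Ad_inv:
  assumes X: "X \<in> lie_alg G A"
  shows "dderiv A \<one> (\<lambda>b. AdG (inv b) X c0) (unit_vec x) = br (X c0) x"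
proof -
  have om: "\<one> \<in> mcarrier A" by (simp add: mcarrier)
  have XT: "X \<in> tangent_space A \<one>" using X by (simp add: lie_alg_def)
  note ut = unit_vec_tangent
  have "smooth_map_at (prod_atlas A A) A (\<lambda>z. fst z \<otimes> snd z) (\<one>, \<one>)" by (rule smooth_map_at_mult) simp_all
  from smooth_fun_at_comp[OF AA A _ this, of "snd c0"]
  have mult: "smooth_fun_at (prod_atlas A A) (\<lambda>z. snd c0 (fst z \<otimes> snd z)) (\<one>, \<one>)" using smooth_fun_at_coord[OF A c0] by simp
  have "smooth_map_at (prod_atlas A A) A (\<lambda>z. snd z \<otimes> fst z) (\<one>, \<one>)"
    by (intro smooth_map_at_mult_fun AA smooth_map_at_fst smooth_map_at_snd A om)
  from smooth_fun_at_comp[OF AA A _ this, of "snd c0"]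
  have mult': "smooth_fun_at (prod_atlas A A) (\<lambda>z. snd c0 (snd z \<otimes> fst z)) (\<one>, \<one>)" using smooth_fun_at_coord[OF A c0] by simp
  have Xm: "smooth_map_at A LA (\<lambda>b. X) \<one>"
    by (rule smooth_map_at_const[OF A atlas_LA om]) (simp add: mcarrier_LA X)
  have Ads: "smooth_fun_at A (\<lambda>b. AdG (inv b) X c0) \<one>"
    by (rule smooth_fun_at_Ad[OF A smooth_map_at_inv[OF one_closed] Xm])
  have R: "dderiv A \<one> (\<lambda>s. snd c0 (s \<otimes> b)) X = L (AdG (inv b) X c0) b c0" if b: "c0 \<in> charts_at A b" for b
  proof -
    have bG: "b \<in> carrier G" using charts_atD(3)[OF b] by (simp add: mcarrier)
    then have i1: "inv b \<otimes> \<one> \<otimes> inv (inv b) = \<one>" by simp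
    have f: "smooth_fun_at A (\<lambda>y. snd c0 (b \<otimes> y)) \<one>"
      using smooth_fun_at_comp[OF A A _ smooth_map_at_lmult[OF bG one_closed], of "snd c0"] smooth_fun_at_coord[OF A b] bG by simp
    have "L (AdG (inv b) X c0) b c0 = dderiv A \<one> (\<lambda>y. snd c0 (b \<otimes> y)) (AdG (inv b) X)"
      unfolding L_chart[OF b] using Ad_tangent[of "inv b" X] bG by (simp add: unit_vec_eq lie_alg_def)
    also have "\<dots> = dderiv A \<one> (\<lambda>s. snd c0 (b \<otimes> (inv b \<otimes> s \<otimes> inv (inv b)))) X"
      unfolding Ad_def
      using dderiv_differential[OF A A smooth_map_at_conj[OF inv_closed[OF bG] one_closed], of "\<lambda>y. snd c0 (b \<otimes> y)" X] f bG
      by simp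
    also have "\<dots> = dderiv A \<one> (\<lambda>s. snd c0 (s \<otimes> b)) X"
      by (rule dderiv_cong[OF A om])
         (use eventually_carrier[OF one_closed] in eventually_elim, use bG in \<open>simp add: m_assoc[symmetric]\<close>)
    finally show ?thesis ..
  qed
  have "dderiv A \<one> (\<lambda>b. dderiv A \<one> (\<lambda>s. snd c0 (s \<otimes> b)) X) (unit_vec x) =
      dderiv A \<one> (\<lambda>b. L (AdG (inv b) X c0) b c0) (unit_vec x)"
    by (rule dderiv_cong[OF A om]) (use eventually_mnhds_in_chart[OF A c0] in eventually_elim, rule R)
  also have "\<dots> = dderiv A \<one> (\<lambda>b. AdG (inv b) X c0) (unit_vec x) + dderiv A \<one> (\<lambda>b. L (X c0) b c0) (unit_vec x)"
    using dderiv_L[OF c0 Ads] by (simp add: Ad_one[OF X] L_one)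
  finally have 1: "dderiv A \<one> (\<lambda>b. dderiv A \<one> (\<lambda>s. snd c0 (s \<otimes> b)) X) (unit_vec x) =
      dderiv A \<one> (\<lambda>b. AdG (inv b) X c0) (unit_vec x) + dderiv A \<one> (\<lambda>b. L (X c0) b c0) (unit_vec x)" .
  have "dderiv A \<one> (\<lambda>b. dderiv A \<one> (\<lambda>s. snd c0 (s \<otimes> b)) X) (unit_vec x) =
      dderiv A \<one> (\<lambda>s. dderiv A \<one> (\<lambda>b. snd c0 (s \<otimes> b)) (unit_vec x)) X"
    by (rule dderiv_mixed_partials[OF A A mult' ut XT])
  also have "\<dots> = dderiv A \<one> (\<lambda>s. L x s c0) X"
    by (rule dderiv_cong[OF A om]) (use eventually_mnhds_in_chart[OF A c0] in eventually_elim, simp add: L_chart)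
  finally show ?thesis
    using 1 by (simp add: br_dderiv unit_vec_eq[OF XT] eq_diff_eq)
qed

text \<open>
  The chart of the tangent group at its unit that turns coordinates of \<open>X\<^sup>c + Y\<^sup>v\<close> into pairs of
  coordinates of \<open>X\<close> and \<open>Y\<close>.
\<close>

abbreviation hc0 where "hc0 \<equiv> prod_chart c0 (lin_chart c0)"

lemma hc0_at: "c0 \<in> charts_at A a \<Longrightarrow> X \<in> lie_alg G A \<Longrightarrow> hc0 \<in> charts_at TA (a, X)"
  unfolding TA_eq by (intro charts_at_prodI lin_chart_at c0)

lemma lie_group_chart_TG: "lie_group_chart TG TA hc0"
  by (rule lie_group_chart.intro[OF lie_group_TG]) (simp add: hc0_at c0 lie_alg_closed)

interpretation T: lie_group_chart TG TA hc0
  by (rule lie_group_chart_TG)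

lemma
  shows unit_mcarrier: "\<one> \<in> mcarrier A" and zero_mcarrier: "0 \<in> mcarrier LA"
    and TG_unit_mcarrier: "(\<one>, 0) \<in> mcarrier TA"
    and lin_chart_zero: "lin_chart c0 \<in> charts_at LA 0"
  by (simp_all add: mcarrier mcarrier_LA mcarrier_TA lie_alg_closed lin_chart_at c0)

lemma smooth_eval_zero: "smooth_fun_at LA (\<lambda>Y. Y c0) 0"
  using smooth_fun_at_coord[OF atlas_LA lin_chart_zero] by (simp add: lin_chart_def)

lemma smooth_TG_parts: "smooth_map_at TA A fst (\<one>, 0)" "smooth_map_at TA LA snd (\<one>, 0)"
  using smooth_map_at_fst[OF A atlas_LA unit_mcarrier zero_mcarrier]
    smooth_map_at_snd[OF A atlas_LA unit_mcarrier zero_mcarrier] by (simp_all add: TA_eq)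

abbreviation lin_vec where "lin_vec \<equiv> tvec_of LA 0 (lin_chart c0)"

lemma dderiv_eval: "dderiv LA 0 (\<lambda>Y. Y c0) (lin_vec y) = y"
  using dderiv_coord[OF atlas_LA tvec_of_tangent[OF atlas_LA lin_chart_zero] lin_chart_zero, of y]
    tvec_of_chart[OF atlas_LA lin_chart_zero, of y] by (simp add: lin_chart_def)

lemma dderiv_TG_unit:
  fixes f :: "'a \<Rightarrow> ('a, 'e) tvec \<Rightarrow> 'v::euclidean_space"
  assumes F: "smooth_fun_at TA (\<lambda>z. f (fst z) (snd z)) (\<one>, 0)"
  shows "dderiv TA (\<one>, 0) (\<lambda>z. f (fst z) (snd z)) (T.unit_vec (x, y)) =
    dderiv A \<one> (\<lambda>b. f b 0) (unit_vec x) + dderiv LA 0 (f \<one>) (lin_vec y)"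
  unfolding TA_eq
proof (rule dderiv_prod[OF A atlas_LA _ c0 lin_chart_zero _ unit_vec_tangent tvec_of_tangent[OF atlas_LA lin_chart_zero]])
  show "smooth_fun_at (prod_atlas A LA) (\<lambda>z. f (fst z) (snd z)) (\<one>, 0)" using F by (simp add: TA_eq)
  show "tvec_of (prod_atlas A LA) \<one>\<^bsub>TG\<^esub> hc0 (x, y) \<in> tangent_space (prod_atlas A LA) (\<one>, 0)"
    using T.unit_vec_tangent by (simp add: TA_eq)
  show "tvec_of (prod_atlas A LA) \<one>\<^bsub>TG\<^esub> hc0 (x, y) hc0 = (unit_vec x c0, lin_vec y (lin_chart c0))"
    using T.unit_vec_c0 by (simp add: TA_eq tvec_of_chart[OF atlas_LA lin_chart_zero])
qed

text \<open>
  The product \<open>(a, X) (b, Y)\<close> depends on \<open>b\<close> through left multiplication by \<open>a\<close> and through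
  \<open>Ad\<^bsub>b\<^sup>-\<^sup>1\<^esub> X\<close>, and on \<open>Y\<close> by a translation. The derivative of \<open>Ad\<close> is the bracket.
\<close>

lemma T_L_chart:
  assumes a: "c0 \<in> charts_at A a" and X: "X \<in> lie_alg G A"
  shows "T.L (x, y) (a, X) hc0 = (L x a c0, br (X c0) x + y)"
proof -
  have aG: "a \<in> carrier G" using charts_atD(3)[OF a] by (simp add: mcarrier)
  let ?f = "\<lambda>b Y. (snd c0 (a \<otimes> b), AdG (inv b) X c0 + Y c0)"
  note const = smooth_fun_at_const[OF zero_mcarrier]
  have fsm: "smooth_fun_at A (\<lambda>b. snd c0 (a \<otimes> b)) \<one>"
    using smooth_fun_at_comp[OF A A _ smooth_map_at_lmult[OF aG one_closed], of "snd c0"] smooth_fun_at_coord[OF A a] aG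
    by simp
  have Xm: "smooth_map_at A LA (\<lambda>b. X) \<one>"
    by (rule smooth_map_at_const[OF A atlas_LA unit_mcarrier]) (simp add: mcarrier_LA X)
  have Ads: "smooth_fun_at A (\<lambda>b. AdG (inv b) X c0) \<one>"
    by (rule smooth_fun_at_Ad[OF A smooth_map_at_inv[OF one_closed] Xm])
  have F: "smooth_fun_at TA (\<lambda>z. ?f (fst z) (snd z)) (\<one>, 0)"
    by (intro smooth_fun_at_Pair smooth_fun_at_add smooth_fun_at_eval[OF atlas_TA] smooth_TG_parts
        smooth_fun_at_comp[OF atlas_TA A _ smooth_TG_parts(1), of "\<lambda>b. snd c0 (a \<otimes> b)"]
        smooth_fun_at_comp[OF atlas_TA A _ smooth_TG_parts(1), of "\<lambda>b. AdG (inv b) X c0"]) (simp_all add: fsm Ads)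
  have "T.L (x, y) (a, X) hc0 = dderiv TA (\<one>, 0) (\<lambda>w. snd hc0 ((a, X) \<otimes>\<^bsub>TG\<^esub> w)) (T.unit_vec (x, y))"
    using T.L_chart[OF hc0_at[OF a X]] by simp
  also have "(\<lambda>w. snd hc0 ((a, X) \<otimes>\<^bsub>TG\<^esub> w)) = (\<lambda>z. ?f (fst z) (snd z))"
    by (simp add: fun_eq_iff tangent_group_def case_prod_unfold)
  also note dderiv_TG_unit[OF F]
  also have "dderiv A \<one> (\<lambda>b. ?f b 0) (unit_vec x) = (L x a c0, br (X c0) x)"
    using dderiv_Pair[OF fsm Ads] by (simp add: L_chart[OF a] dderiv_Ad_inv[OF X])
  also have "dderiv LA 0 (?f \<one>) (lin_vec y) = (0, y)"
    by (simp add: dderiv_Pair[OF const smooth_fun_at_add[OF const smooth_eval_zero]]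
        dderiv_add[OF const smooth_eval_zero] dderiv_eval)
  finally show ?thesis by simp
qed

text \<open>
  By \<open>T_L_chart\<close> the left-invariant fields are affine in \<open>X\<close>, so differentiating them at the unit yields
  the bracket of \<open>G\<close> in the first component and two mixed terms in the second.
\<close>

theorem T_br: "T.br (x, y) (x', y') = (br x x', br x y' + br y x')"
proof -
  have d: "dderiv TA (\<one>, 0) (\<lambda>q. T.L (x', y') q hc0) (T.unit_vec (x, y)) =
      (dderiv A \<one> (\<lambda>q. L x' q c0) (unit_vec x), br y x')" for x y x' y'
  proof -
    let ?f = "\<lambda>b Y. (L x' b c0, br (Y c0) x' + y')"
    note const = smooth_fun_at_const[OF zero_mcarrier]
    have bs: "smooth_fun_at LA (\<lambda>Y. br (Y c0) x') 0"
      by (rule smooth_fun_at_linear[OF bounded_linear_br smooth_eval_zero])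
    have Ls: "smooth_fun_at A (\<lambda>b. L x' b c0) \<one>" by (rule vector_fieldD(2)[OF A L_vector_field c0])
    have F: "smooth_fun_at TA (\<lambda>z. ?f (fst z) (snd z)) (\<one>, 0)"
      by (intro smooth_fun_at_Pair smooth_fun_at_add smooth_fun_at_linear[OF bounded_linear_br]
          smooth_fun_at_eval[OF atlas_TA] smooth_TG_parts smooth_fun_at_const TG_unit_mcarrier
          smooth_fun_at_comp[OF atlas_TA A _ smooth_TG_parts(1), of "\<lambda>b. L x' b c0"]) (simp add: Ls)
    have "\<forall>\<^sub>F q in mnhds TA (\<one>, 0). c0 \<in> charts_at A (fst q)"
      by (rule eventually_smooth_map_at[OF smooth_TG_parts(1)]) (simp add: eventually_mnhds_in_chart[OF A c0])
    then have "\<forall>\<^sub>F q in mnhds TA (\<one>, 0). T.L (x', y') q hc0 = ?f (fst q) (snd q)"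
      using eventually_mnhds_mcarrier[OF atlas_TA TG_unit_mcarrier]
      by eventually_elim (auto simp: mcarrier_TA T_L_chart)
    from dderiv_cong[OF atlas_TA TG_unit_mcarrier this]
    have "dderiv TA (\<one>, 0) (\<lambda>q. T.L (x', y') q hc0) (T.unit_vec (x, y)) =
        dderiv TA (\<one>, 0) (\<lambda>z. ?f (fst z) (snd z)) (T.unit_vec (x, y))" .
    also note dderiv_TG_unit[OF F]
    also have "dderiv A \<one> (\<lambda>b. ?f b 0) (unit_vec x) = (dderiv A \<one> (\<lambda>q. L x' q c0) (unit_vec x), 0)"
      using dderiv_Pair[OF Ls smooth_fun_at_const[OF unit_mcarrier]] by (simp add: br_zero_left)
    also have "dderiv LA 0 (?f \<one>) (lin_vec y) = (0, br y x')"
      by (simp add: dderiv_Pair[OF const smooth_fun_at_add[OF bs const]] dderiv_add[OF bs const]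
          dderiv_linear_comp[OF bounded_linear_br smooth_eval_zero] dderiv_eval)
    also have "(dderiv A \<one> (\<lambda>q. L x' q c0) (unit_vec x), 0) + (0, br y x') =
        (dderiv A \<one> (\<lambda>q. L x' q c0) (unit_vec x), br y x')" by simp
    finally show ?thesis .
  qed
  have "T.br (x, y) (x', y') = dderiv TA (\<one>, 0) (\<lambda>q. T.L (x', y') q hc0) (T.unit_vec (x, y)) -
      dderiv TA (\<one>, 0) (\<lambda>q. T.L (x, y) q hc0) (T.unit_vec (x', y'))"
    using T.br_dderiv by simp
  also have "\<dots> = (br x x', br x y' + br y x')"
    unfolding d using br_antisym[of y' x] by (simp add: br_dderiv[of x x'])
  finally show ?thesis .
qed

section \<open>The induced structure\<close>

lemma c_lift_eq:
  assumes X: "X \<in> lie_alg G A"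
  shows "c_lift G A X = T.unit_vec (X c0, 0)"
proof -
  have om: "\<one> \<in> mcarrier A" by (simp add: mcarrier)
  have XT: "X \<in> tangent_space A \<one>" using X by (simp add: lie_alg_def)
  have zm: "0 \<in> mcarrier LA" by (simp add: mcarrier_LA lie_alg_closed)
  have m: "smooth_map_at A TA (\<lambda>a. (a, 0)) \<one>"
    by (rule smooth_map_at_TG_pair[OF A smooth_map_at_ident[OF A om] smooth_map_at_const[OF A atlas_LA om zm]])
  have h: "hc0 \<in> charts_at TA (\<one>, 0)" by (rule hc0_at[OF c0 lie_alg_closed(1)])
  have "c_lift G A X hc0 = dderiv A \<one> (\<lambda>a. snd hc0 (a, 0)) X"
    unfolding c_lift_def by (rule differential_dderiv) (rule h)
  also have "\<dots> = (X c0, 0)"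
    by (simp add: dderiv_Pair[OF smooth_fun_at_coord[OF A c0] smooth_fun_at_const[OF om]] dderiv_coord[OF A XT c0])
  finally have "c_lift G A X hc0 = T.unit_vec (X c0, 0) hc0" using T.unit_vec_c0 by simp
  moreover have "c_lift G A X \<in> tangent_space TA (\<one>, 0)"
    unfolding c_lift_def by (rule differential_tangent[OF A atlas_TA m])
  moreover have "T.unit_vec (X c0, 0) \<in> tangent_space TA (\<one>, 0)" using T.unit_vec_tangent by simp
  ultimately show ?thesis using tangent_eqI[OF _ _ h] by blast
qed

lemma v_lift_eq:
  assumes X: "X \<in> lie_alg G A"
  shows "v_lift G A X = T.unit_vec (0, X c0)"
proof
  fix e
  have h: "hc0 \<in> charts_at TA (\<one>, 0)" by (rule hc0_at[OF c0 lie_alg_closed(1)])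
  show "v_lift G A X e = T.unit_vec (0, X c0) e"
  proof (cases "e \<in> charts_at TA (\<one>, 0)")
    case e: True
    let ?F = "\<lambda>z. snd e (chart_inv hc0 z)"
    let ?l = "\<lambda>t. (snd c0 \<one>, t *\<^sub>R X c0)"
    have inv: "chart_inv hc0 (?l t) = (\<one>, t *\<^sub>R X)" for t
    proof -
      have "(\<one>, t *\<^sub>R X) \<in> fst hc0" "hc0 \<in> TA"
        using charts_atD[OF c0] charts_atD(1)[OF h] X by (simp_all add: lie_alg_closed)
      from chart_inv_snd[OF atlas_TA this(2,1)] show ?thesis by (simp add: scaleR_fun_apply)
    qed
    have 1: "(?l has_derivative (\<lambda>t. t *\<^sub>R (0, X c0))) (at 0)"
      by (auto intro!: derivative_eq_intros)
    have x0: "snd hc0 (\<one>, 0) = ?l 0" by simp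
    have 2: "(?F has_derivative fderiv ?F (?l 0)) (at (?l 0))"
      using smooth_at_has_derivative[OF smooth_at_transition[OF atlas_TA h e]] unfolding x0 .
    have lin: "linear (fderiv ?F (?l 0))" by (rule has_derivative_linear[OF 2])
    have "((\<lambda>t. snd e (\<one>, t *\<^sub>R X)) has_derivative (\<lambda>t. fderiv ?F (?l 0) (t *\<^sub>R (0, X c0)))) (at 0)"
      using diff_chain_at[OF 1 2] unfolding o_def inv .
    then have "((\<lambda>t. snd e (\<one>, t *\<^sub>R X)) has_vector_derivative fderiv ?F (?l 0) (0, X c0)) (at 0)"
      unfolding has_vector_derivative_def linear_cmul[OF lin] .
    then have "v_lift G A X e = fderiv ?F (?l 0) (0, X c0)"
      using e by (simp add: v_lift_def vector_derivative_at)
    also have "\<dots> = T.unit_vec (0, X c0) e"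
      using e by (simp add: tvec_of_def)
    finally show ?thesis .
  qed (simp add: v_lift_def tvec_of_def)
qed

lemma lift_sum:
  assumes "X \<in> lie_alg G A" "Y \<in> lie_alg G A"
  shows "c_lift G A X + v_lift G A Y = T.unit_vec (X c0, Y c0)"
  using T.unit_vec_add[of "(X c0, 0)" "(0, Y c0)"] by (simp add: c_lift_eq v_lift_eq assms)

lemma cv_parts_unit_vec: "cv_parts G A (T.unit_vec (x, y)) = (unit_vec x, unit_vec y)"
  unfolding cv_parts_def
proof (rule the_equality)
  show "fst (unit_vec x, unit_vec y) \<in> lie_alg G A \<and> snd (unit_vec x, unit_vec y) \<in> lie_alg G A \<and>
      T.unit_vec (x, y) = c_lift G A (fst (unit_vec x, unit_vec y)) + v_lift G A (snd (unit_vec x, unit_vec y))"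
    by (simp add: lie_alg_def unit_vec_tangent lift_sum)
next
  fix P
  assume P: "fst P \<in> lie_alg G A \<and> snd P \<in> lie_alg G A \<and> T.unit_vec (x, y) = c_lift G A (fst P) + v_lift G A (snd P)"
  then have "T.unit_vec (x, y) hc0 = T.unit_vec (fst P c0, snd P c0) hc0" by (simp add: lift_sum)
  then have "x = fst P c0" "y = snd P c0" unfolding T.unit_vec_c0 by simp_all
  then show "P = (unit_vec x, unit_vec y)"
    using P by (simp add: prod_eq_iff unit_vec_eq lie_alg_def)
qed

lemma T_ltr_unit:
  assumes q: "q \<in> carrier TG"
  shows "ltrans TG TA (inv\<^bsub>TG\<^esub> q) q u = T.unit_vec (T.th q u)"
proof -
  have "ltrans TG TA (inv\<^bsub>TG\<^esub> q) q u \<in> tangent_space TA \<one>\<^bsub>TG\<^esub>"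
    using T.ltr_tangent[OF T.inv_closed[OF q] q, of u] T.l_inv[OF q] by simp
  from T.unit_vec_eq[OF this] show ?thesis unfolding T.th_def by simp
qed

end

context invariant_hermitian
begin

interpretation T: lie_group_chart TG TA hc0
  by (rule lie_group_chart_TG)

text \<open>
  On pairs, read as elements \<open>x + \<epsilon> y\<close> over the dual numbers, the induced \<open>J\<close> is the extension of \<open>j\<close>
  and the induced metric is the \<open>\<epsilon>\<close>-part of the extension of \<open>gam\<close>.
\<close>

definition dual_gam :: "'e \<times> 'e \<Rightarrow> 'e \<times> 'e \<Rightarrow> real" where
  "dual_gam u w = gam (fst u) (snd w) + gam (fst w) (snd u)"

definition dual_j :: "'e \<times> 'e \<Rightarrow> 'e \<times> 'e" where
  "dual_j u = (j (fst u), j (snd u))"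

definition dual_bilinear :: "('e \<Rightarrow> 'e \<Rightarrow> 'e) \<Rightarrow> 'e \<times> 'e \<Rightarrow> 'e \<times> 'e \<Rightarrow> 'e \<times> 'e" where
  "dual_bilinear B u w = (B (fst u) (fst w), B (fst u) (snd w) + B (snd u) (fst w))"

lemma T_br_dual: "T.br u w = dual_bilinear br u w"
  using T_br[of "fst u" "snd u" "fst w" "snd w"] by (simp add: dual_bilinear_def)

lemma g_unit: "g \<one> (unit_vec x) (unit_vec y) = gam x y"
  by (simp add: g_eq unit_vec_tangent th_one)

lemma J_unit: "J \<one> (unit_vec x) = unit_vec (j x)"
  by (simp add: J_eq unit_vec_tangent th_one L_one)

lemma hat_g_eq:
  assumes q: "q \<in> carrier TG"
  shows "hat_g G A g q u w = dual_gam (T.th q u) (T.th q w)"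
proof -
  obtain x y x' y' where "T.th q u = (x, y)" "T.th q w = (x', y')" by fastforce
  then show ?thesis
    by (simp add: hat_g_def hat_g_unit_def Let_def T_ltr_unit[OF q] cv_parts_unit_vec dual_gam_def g_unit del: TG_simps)
qed

lemma hat_J_eq:
  assumes q: "q \<in> carrier TG"
  shows "hat_J G A J q u = T.L (dual_j (T.th q u)) q"
proof -
  obtain x y where "T.th q u = (x, y)" by fastforce
  then show ?thesis
    by (simp add: hat_J_def hat_J_unit_def Let_def T_ltr_unit[OF q] cv_parts_unit_vec dual_j_def J_unit
        lift_sum lie_alg_def unit_vec_tangent T.L_def del: TG_simps)
qed

lemma bounded_bilinear_dual_gam: "bounded_bilinear dual_gam"
  unfolding bilinear_conv_bounded_bilinear[symmetric] bilinear_def dual_gam_def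
  by (auto intro!: linearI simp: gam_add gam_scaleR algebra_simps)

lemma bounded_bilinear_dual:
  assumes B: "bounded_bilinear B"
  shows "bounded_bilinear (dual_bilinear B)"
  unfolding bilinear_conv_bounded_bilinear[symmetric] bilinear_def dual_bilinear_def
  by (auto intro!: linearI simp: bounded_bilinear.add_left[OF B] bounded_bilinear.add_right[OF B]
      bounded_bilinear.scaleR_left[OF B] bounded_bilinear.scaleR_right[OF B] algebra_simps)

lemma bounded_linear_dual_j: "bounded_linear dual_j"
  unfolding linear_conv_bounded_linear[symmetric] dual_j_def
  by (rule linearI) (simp_all add: j_simps)

theorem invariant_hermitian_hat:
  "invariant_hermitian TG TA hc0 (hat_g G A g) (hat_J G A J) dual_gam dual_j"
proof (intro invariant_hermitian.intro lie_group_chart_TG invariant_hermitian_axioms.intro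
    bounded_bilinear_dual_gam bounded_linear_dual_j hat_g_eq hat_J_eq)
  fix x y :: "'e \<times> 'e"
  show "dual_gam x y = dual_gam y x" by (simp add: dual_gam_def)
  show "dual_j (dual_j x) = - x" by (simp add: dual_j_def jj prod_eq_iff)
  show "dual_gam (dual_j x) (dual_j y) = dual_gam x y" by (simp add: dual_gam_def dual_j_def gam_j)
next
  fix x :: "'e \<times> 'e" assume *: "\<And>y. dual_gam x y = 0"
  have z: "gam 0 y = 0" "gam y 0 = 0" for y
    using bounded_bilinear.zero_left[OF gam] bounded_bilinear.zero_right[OF gam] by auto
  have "gam (fst x) y = 0" for y using *[of "(0, y)"] by (simp add: dual_gam_def z)
  then have "fst x = 0" by (rule gam_nondeg)
  moreover have "gam (snd x) y = 0" for y using *[of "(y, 0)"] by (simp add: dual_gam_def z gam_sym[of y])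
  then have "snd x = 0" by (rule gam_nondeg)
  ultimately show "x = 0" by (simp add: prod_eq_iff)
qed

interpretation H: invariant_hermitian TG TA hc0 "hat_g G A g" "hat_J G A J" dual_gam dual_j
  by (rule invariant_hermitian_hat)

text \<open>
  Both conditions are multilinear identities, so the extension of \<open>B\<close> to dual numbers satisfies them
  together with \<open>B\<close>.
\<close>

lemma hat_levi_civita:
  assumes "algebraic_levi_civita B"
  shows "H.algebraic_levi_civita (dual_bilinear B)"
proof -
  have B: "bounded_bilinear B" and tor: "\<And>x y. br x y = B x y - B y x"
    and met: "\<And>x y z. gam (B x y) z = - gam y (B x z)"
    using assms by (auto simp: algebraic_levi_civita_def add_eq_0_iff2)
  show ?thesis
    unfolding H.algebraic_levi_civita_def
  proof (intro conjI allI bounded_bilinear_dual B)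
    fix u v w
    show "dual_bilinear B u v - dual_bilinear B v u = T.br u v"
      unfolding T_br_dual by (simp add: dual_bilinear_def tor)
    show "dual_gam (dual_bilinear B u v) w + dual_gam v (dual_bilinear B u w) = 0"
      using met[of "fst u" "fst v" "snd w"] met[of "fst u" "snd v" "fst w"] met[of "snd u" "fst v" "fst w"]
        gam_sym[of "fst w" "B (fst u) (snd v)"] gam_sym[of "fst w" "B (snd u) (fst v)"]
        gam_sym[of "B (fst u) (fst w)" "snd v"]
      by (simp add: dual_gam_def dual_bilinear_def gam_add)
  qed
qed

text \<open>
  The condition \<open>B x (j x) = j (B x x)\<close> is polarized before it is extended to the dual numbers, where the
  \<open>\<epsilon>\<close>-part of \<open>B u u\<close> is the mixed term.
\<close>

lemma hat_nearly_pseudo_kahler: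
  assumes "nearly_pseudo_kahler A g J"
  shows "nearly_pseudo_kahler TA (hat_g G A g) (hat_J G A J)"
proof -
  obtain B where B: "algebraic_levi_civita B" and n: "\<And>x. B x (j x) = j (B x x)"
    using nearly_pseudo_kahlerE[OF assms] by blast
  have bil: "bounded_bilinear B" using B by (simp add: algebraic_levi_civita_def)
  note Badd = bounded_bilinear.add_left[OF bil] bounded_bilinear.add_right[OF bil]
  have "B x (j y) + B y (j x) = j (B x y) + j (B y x)" for x y
    using n[of "x + y"] n[of x] n[of y] by (simp add: j_simps Badd) (simp add: add.commute)
  then have "dual_bilinear B u (dual_j u) = dual_j (dual_bilinear B u u)" for u
    by (simp add: dual_bilinear_def dual_j_def n j_simps)
  then show ?thesis by (rule H.nearly_pseudo_kahlerI[OF hat_levi_civita[OF B]])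
qed

text \<open>
  The vectors \<open>X\<^sup>c\<close> form a copy of the Lie algebra of \<open>G\<close>, stable under the induced \<open>J\<close>.
\<close>

lemma integrable_of_hat:
  assumes "integrable_complex TA (hat_J G A J)"
  shows "integrable_complex A J"
  unfolding integrable_iff
proof (intro allI)
  fix x y
  have "H.algebraic_nijenhuis (x, 0) (y, 0) = 0" using assms H.integrable_iff by blast
  then have "fst (H.algebraic_nijenhuis (x, 0) (y, 0)) = 0" by simp
  then show "algebraic_nijenhuis x y = 0"
    by (simp add: H.algebraic_nijenhuis_def algebraic_nijenhuis_def T_br_dual dual_bilinear_def dual_j_def)
qed

text \<open>
  The induced metric pairs \<open>c\<close>-lifts with \<open>v\<close>-lifts, so one of the three arguments has to be a
  \<open>v\<close>-lift.
\<close>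

lemma closed_of_hat:
  assumes "closed_form2 TA (fundamental_form (hat_g G A g) (hat_J G A J))"
  shows "closed_form2 A (fundamental_form g J)"
  unfolding closed_iff
proof (intro allI)
  fix x y z
  have z: "gam 0 y = 0" "gam y 0 = 0" for y
    using bounded_bilinear.zero_left[OF gam] bounded_bilinear.zero_right[OF gam] by auto
  have b: "br 0 y = 0" "br y 0 = 0" for y using br_zero_left[of y] br_antisym[of y 0] by simp_all
  have j0: "j 0 = 0" by (rule linear_0[OF linear_j])
  have "H.algebraic_d_omega (x, 0) (y, 0) (0, z) = 0" using assms H.closed_iff by blast
  then show "algebraic_d_omega x y z = 0"
    by (simp add: H.algebraic_d_omega_def algebraic_d_omega_def T_br_dual dual_bilinear_def dual_j_def dual_gam_def z b j0
        gam_sym[of y "j (br x z)"] gam_sym[of x "j (br y z)"])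
qed

lemma pseudo_kahler_of_hat:
  "pseudo_kahler TA (hat_g G A g) (hat_J G A J) \<Longrightarrow> pseudo_kahler A g J"
  unfolding pseudo_kahler_def using almost_pseudo_hermitian_gJ integrable_of_hat closed_of_hat by blast

lemma left_invariant_hat: "left_invariant_aph TG TA (hat_g G A g) (hat_J G A J)"
  by (rule H.left_invariant_gJ)

end

theorem theorem1:
  fixes G :: "('a, 'm) monoid_scheme"
    and A :: "('a, 'e::euclidean_space) chart set"
    and g :: "('a, 'e) metric_field"
    and J :: "('a, 'e) endo_field"
  assumes "lie_group G A"
    and "left_invariant_aph G A g J"
  shows "lie_group (tangent_group G A) (tangent_atlas G A) \<and>
    (nearly_pseudo_kahler A g J \<longrightarrow>
      left_invariant_aph (tangent_group G A) (tangent_atlas G A) (hat_g G A g) (hat_J G A J) \<and>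
      nearly_pseudo_kahler (tangent_atlas G A) (hat_g G A g) (hat_J G A J)) \<and>
    (\<not> integrable_complex A J \<longrightarrow>
      \<not> integrable_complex (tangent_atlas G A) (hat_J G A J)) \<and>
    (strictly_nearly_pseudo_kahler A g J \<longrightarrow>
      strictly_nearly_pseudo_kahler (tangent_atlas G A) (hat_g G A g) (hat_J G A J))"
proof -
  have "\<one>\<^bsub>G\<^esub> \<in> mcarrier A"
    using assms(1) by (simp add: lie_group_def group.is_monoid monoid.one_closed)
  then interpret lie_group_chart G A "chart_at A \<one>\<^bsub>G\<^esub>"
    by (intro lie_group_chart.intro assms(1) chart_at_in)
  interpret invariant_hermitian G A "chart_at A \<one>\<^bsub>G\<^esub>" g J
    "\<lambda>x y. g \<one>\<^bsub>G\<^esub> (unit_vec x) (unit_vec y)" "\<lambda>x. J \<one>\<^bsub>G\<^esub> (unit_vec x) (chart_at A \<one>\<^bsub>G\<^esub>)"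
    by (rule invariant_hermitian_at_unit[OF assms(2)])
  show ?thesis
    using lie_group_TG left_invariant_hat hat_nearly_pseudo_kahler integrable_of_hat pseudo_kahler_of_hat
    unfolding strictly_nearly_pseudo_kahler_def by blast
qed

end
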